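(* Let $\epsilon>0$, let $L=3/2-\epsilon$, and let $E\subseteq[0,L]$ be a measurable set of Lebesgue measure $1$. Let $\Lambda\subset\mathbb{R}$ be a discrete set with $0\in\Lambda$. Then: (a) if $E+\Lambda=\mathbb{R}$ is a tiling, then $\Lambda=\mathbb{Z}$; (b) if $\Lambda$ is a spectrum of $E$, then $\Lambda=\mathbb{Z}$.
   Context: For a measurable $E\subset\mathbb{R}^n$ with $0<|E|<\infty$ and a discrete set $T\subset\mathbb{R}^n$, $E+T=\mathbb{R}^n$ is a tiling if, up to sets of measure zero, the translates $E+t$, $t\in T$, are pairwise disjoint and their union is $\mathbb{R}^n$. A discrete set $\Lambda\subset\mathbb{R}^n$ is a spectrum of $E$ if $\{e^{2\pi i\lambda\cdot x}:\lambda\in\Lambda\}$ is an orthogonal basis of $L^2(E)$. *)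

theory Defs
  imports "HOL-Analysis.Analysis"
begin

definition discrete_set :: "real set \<Rightarrow> bool" where
  "discrete_set T \<longleftrightarrow> (\<forall>B. bounded B \<longrightarrow> finite (T \<inter> B))"

definition tiling :: "real set \<Rightarrow> real set \<Rightarrow> bool" where
  "tiling E T \<longleftrightarrow>
     (\<forall>s\<in>T. \<forall>t\<in>T. s \<noteq> t \<longrightarrow> ((\<lambda>x. x + s) ` E) \<inter> ((\<lambda>x. x + t) ` E) \<in> null_sets lebesgue) \<and>
     (UNIV - (\<Union>t\<in>T. (\<lambda>x. x + t) ` E)) \<in> null_sets lebesgue"

definition expo :: "real \<Rightarrow> real \<Rightarrow> complex" where
  "expo lam x = exp (2 * of_real pi * \<i> * of_real (lam * x))"

definition L2_on :: "real set \<Rightarrow> (real \<Rightarrow> complex) \<Rightarrow> bool" where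
  "L2_on E f \<longleftrightarrow> (\<lambda>x. indicator E x *\<^sub>R f x) \<in> borel_measurable lebesgue \<and>
                   set_integrable lebesgue E (\<lambda>x. (cmod (f x))^2)"

definition inner_L2 :: "real set \<Rightarrow> (real \<Rightarrow> complex) \<Rightarrow> (real \<Rightarrow> complex) \<Rightarrow> complex" where
  "inner_L2 E f g = (LINT x:E|lebesgue. f x * cnj (g x))"

definition spectrum :: "real set \<Rightarrow> real set \<Rightarrow> bool" where
  "spectrum E Lam \<longleftrightarrow>
     (\<forall>l\<in>Lam. \<forall>m\<in>Lam. l \<noteq> m \<longrightarrow> inner_L2 E (expo l) (expo m) = 0) \<and>
     (\<forall>f. L2_on E f \<and> (\<forall>l\<in>Lam. inner_L2 E f (expo l) = 0) \<longrightarrow>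
          (AE x in lebesgue. x \<in> E \<longrightarrow> f x = 0))"

end

theory Submission
  imports Defs
begin

text \<open>
  Both parts rest on the fact that a set \<open>E\<close> of measure 1 inside an interval of length less than \<open>3/2\<close>
  overlaps each of its translates by less than 1 in positive measure.

  For a tiling this separates the translation set by 1, and a measure count in a window around a gap longer
  than 1 is contradictory.

  For a spectrum \<open>\<Lambda>\<close>, Parseval's identity for exponentials says that Poisson summation over \<open>\<Lambda>\<close>,
  \<open>\<Sum>\<^sub>\<lambda> H^(\<lambda>) = H(0)\<close>, holds for all modulations of the autocorrelation of \<open>E\<close>. This autocorrelation
  does not vanish on \<open>(-1,1)\<close>, so a local form of Wiener's Tauberian theorem extends Poisson summation to
  narrow tents in \<open>(-1,1)\<close>, and by addition to the autocorrelation of \<open>[0,r]\<close> for \<open>r < 1\<close>. Letting \<open>r\<close>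
  tend to 1, all nonzero \<open>\<lambda>\<close> must be zeros of the Fourier transform of \<open>[0,1]\<close>, that is, integers.
  Conversely Bessel's inequality over \<open>\<int>\<close> shows that no integer is missing.
\<close>

section \<open>Orthonormal families and Parseval's identity\<close>

text \<open>The threshold 3/2 is where the overlap argument breaks: for [0,1/2] together with
  [1,3/2] the translate by 1/2 meets the set in measure 0, and this set tiles with {0,1/2} + 2Z. For
  L < 3/2 the autocorrelation lives in (-3/2,3/2), which fits into one period of length 3; this is
  why all expansions use the frequencies k/3. In distributional terms, Parseval says that the
  Fourier transform of the counting measure on \<open>\<Lambda>\<close>, multiplied by
  \<open>corr E\<close>, is a point mass at 0. The obstacle is that \<open>corr E\<close> is only
  continuous, so one cannot divide by it. Division is replaced by a contraction: near a point u0
  with \<open>corr E u0\<close> bounded below, the error in Poisson summation varies slowly with the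
  modulation n/3, while its weighted sums against the modulated Fourier coefficients of
  \<open>corr E\<close> vanish, and this forces its supremum M to satisfy M <= M/2. The sums over
  \<open>\<Lambda>\<close> need uniform bounds beforehand; Parseval supplies these too, since it
  keeps points of \<open>\<Lambda>\<close> from clustering.\<close>

lemma (in finite_measure) integrable_bounded:
  fixes f :: "'a \<Rightarrow> 'b::{banach, second_countable_topology}"
  assumes "f \<in> borel_measurable M" "\<And>x. x \<in> space M \<Longrightarrow> norm (f x) \<le> B"
  shows "integrable M f"
  using assms by (intro integrable_const_bound[where B=B]) auto

lemma borel_measurable_cnj [measurable (raw)]:
  "f \<in> borel_measurable M \<Longrightarrow> (\<lambda>x. cnj (f x)) \<in> borel_measurable M"
  by (rule borel_measurable_continuous_on[of cnj]) (auto intro: continuous_intros)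

text \<open>Bessel's inequality is the case where \<open>a\<close> are the Fourier coefficients of \<open>f\<close>, the Pythagorean
  theorem the case \<open>f = 0\<close>.\<close>

lemma (in finite_measure) orthonormal_dist_sq:
  fixes e :: "'i \<Rightarrow> 'a \<Rightarrow> complex"
  assumes fin: "finite F"
    and e_meas: "\<And>i. i \<in> F \<Longrightarrow> e i \<in> borel_measurable M"
    and e_bd: "\<And>i x. i \<in> F \<Longrightarrow> x \<in> space M \<Longrightarrow> cmod (e i x) \<le> C"
    and orth: "\<And>i j. i \<in> F \<Longrightarrow> j \<in> F \<Longrightarrow> (\<integral>x. e i x * cnj (e j x) \<partial>M) = (if i = j then 1 else 0)"
    and f_meas: "f \<in> borel_measurable M"
    and f_bd: "\<And>x. x \<in> space M \<Longrightarrow> cmod (f x) \<le> B"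
  shows "(\<integral>x. (cmod (f x - (\<Sum>i\<in>F. a i * e i x)))^2 \<partial>M)
    = (\<integral>x. (cmod (f x))^2 \<partial>M) - (\<Sum>i\<in>F. (cmod (\<integral>x. f x * cnj (e i x) \<partial>M))^2)
      + (\<Sum>i\<in>F. (cmod (a i - (\<integral>x. f x * cnj (e i x) \<partial>M)))^2)"
proof -
  note [measurable] = e_meas f_meas
  define c where "c i = (\<integral>x. f x * cnj (e i x) \<partial>M)" for i
  have B0: "0 \<le> B" if "x \<in> space M" for x using f_bd[OF that] norm_ge_zero order_trans by blast
  have i1: "integrable M (\<lambda>x. f x * cnj (f x))"
    by (rule integrable_bounded[where B="B*B"]) (auto simp: norm_mult intro!: mult_mono f_bd B0)
  have i2: "integrable M (\<lambda>x. f x * cnj (e i x))" if "i \<in> F" for i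
    by (rule integrable_bounded[where B="B*C"]) (use that in \<open>auto simp: norm_mult intro!: mult_mono f_bd B0 e_bd\<close>)
  have i2': "integrable M (\<lambda>x. e i x * cnj (f x))" if "i \<in> F" for i
    using integrable_cnj[OF i2[OF that]] by (simp add: mult.commute)
  have c': "(\<integral>x. e i x * cnj (f x) \<partial>M) = cnj (c i)" for i
    using Bochner_Integration.integral_cnj[of M "\<lambda>x. f x * cnj (e i x)"] by (simp add: c_def mult.commute)
  have i3: "integrable M (\<lambda>x. e i x * cnj (e j x))" if "i \<in> F" "j \<in> F" for i j
  proof (rule integrable_bounded[where B="C*C"])
    show "(\<lambda>x. e i x * cnj (e j x)) \<in> borel_measurable M" using that by measurable
    show "cmod (e i x * cnj (e j x)) \<le> C * C" if "x \<in> space M" for x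
      using e_bd[OF \<open>i \<in> F\<close> that] e_bd[OF \<open>j \<in> F\<close> that]
      by (auto simp: norm_mult intro!: mult_mono intro: order_trans[OF norm_ge_zero])
  qed
  have eq: "of_real ((cmod (f x - (\<Sum>i\<in>F. a i * e i x)))^2) =
     f x * cnj (f x) - (\<Sum>i\<in>F. cnj (a i) * (f x * cnj (e i x))) - (\<Sum>i\<in>F. a i * (e i x * cnj (f x)))
     + (\<Sum>i\<in>F. \<Sum>j\<in>F. a i * cnj (a j) * (e i x * cnj (e j x)))" for x
  proof -
    have "(\<Sum>i\<in>F. \<Sum>j\<in>F. a i * cnj (a j) * (e i x * cnj (e j x))) = (\<Sum>i\<in>F. a i * e i x) * (\<Sum>j\<in>F. cnj (a j) * cnj (e j x))"
      by (simp add: sum_product algebra_simps)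
    moreover have "(\<Sum>i\<in>F. cnj (a i) * (f x * cnj (e i x))) = f x * (\<Sum>i\<in>F. cnj (a i) * cnj (e i x))"
      by (simp add: sum_distrib_left algebra_simps)
    moreover have "(\<Sum>i\<in>F. a i * (e i x * cnj (f x))) = (\<Sum>i\<in>F. a i * e i x) * cnj (f x)"
      by (simp only: sum_distrib_right mult.assoc)
    ultimately show ?thesis
      by (subst complex_norm_square) (simp add: algebra_simps)
  qed
  have s1: "(\<integral>x. (\<Sum>i\<in>F. cnj (a i) * (f x * cnj (e i x))) \<partial>M) = (\<Sum>i\<in>F. cnj (a i) * c i)"
    by (subst Bochner_Integration.integral_sum) (auto intro!: integrable_mult_right i2 simp: c_def simp del: integrable_mult_left_iff integrable_mult_right_iff)
  have s2: "(\<integral>x. (\<Sum>i\<in>F. a i * (e i x * cnj (f x))) \<partial>M) = (\<Sum>i\<in>F. a i * cnj (c i))"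
    by (subst Bochner_Integration.integral_sum) (auto intro!: integrable_mult_right i2' simp: c' simp del: integrable_mult_left_iff integrable_mult_right_iff)
  have s3: "(\<integral>x. (\<Sum>i\<in>F. \<Sum>j\<in>F. a i * cnj (a j) * (e i x * cnj (e j x))) \<partial>M) = (\<Sum>i\<in>F. \<Sum>j\<in>F. a i * cnj (a j) * (if i = j then 1 else 0))"
    using i3 by (subst Bochner_Integration.integral_sum) (auto intro!: Bochner_Integration.integrable_sum integrable_mult_right sum.cong
        simp: Bochner_Integration.integral_sum orth simp del: integrable_mult_left_iff integrable_mult_right_iff)
  have "of_real (\<integral>x. (cmod (f x - (\<Sum>i\<in>F. a i * e i x)))^2 \<partial>M) =
      (\<integral>x. of_real ((cmod (f x - (\<Sum>i\<in>F. a i * e i x)))^2) \<partial>M :: complex)"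
    by (rule integral_complex_of_real[symmetric])
  also have "\<dots> = (\<integral>x. f x * cnj (f x) \<partial>M) - (\<Sum>i\<in>F. cnj (a i) * c i) - (\<Sum>i\<in>F. a i * cnj (c i))
     + (\<Sum>i\<in>F. \<Sum>j\<in>F. a i * cnj (a j) * (if i = j then 1 else 0))"
    unfolding eq
    apply (subst Bochner_Integration.integral_add)
      apply (intro Bochner_Integration.integrable_diff Bochner_Integration.integrable_sum integrable_mult_right i1 i2 i2'; assumption)
     apply (intro Bochner_Integration.integrable_sum integrable_mult_right i3; assumption)
    apply (subst Bochner_Integration.integral_diff)
      apply (intro Bochner_Integration.integrable_diff Bochner_Integration.integrable_sum integrable_mult_right i1 i2 i2'; assumption)
     apply (intro Bochner_Integration.integrable_sum integrable_mult_right i2'; assumption)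
    apply (subst Bochner_Integration.integral_diff)
      apply (rule i1)
     apply (intro Bochner_Integration.integrable_sum integrable_mult_right i2; assumption)
    by (simp add: s1 s2 s3)
  also have "(\<Sum>i\<in>F. \<Sum>j\<in>F. a i * cnj (a j) * (if i = j then 1 else 0)) = (\<Sum>i\<in>F. a i * cnj (a i))"
    by (intro sum.cong refl) (simp add: if_distrib[of "\<lambda>t. _ * t"] fin cong: if_cong)
  also have "(\<integral>x. f x * cnj (f x) \<partial>M) = of_real (\<integral>x. (cmod (f x))^2 \<partial>M)"
    by (subst integral_complex_of_real[symmetric]) (simp only: complex_norm_square)
  also have "of_real (\<integral>x. (cmod (f x))^2 \<partial>M) - (\<Sum>i\<in>F. cnj (a i) * c i) - (\<Sum>i\<in>F. a i * cnj (c i)) + (\<Sum>i\<in>F. a i * cnj (a i))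
     = of_real ((\<integral>x. (cmod (f x))^2 \<partial>M) - (\<Sum>i\<in>F. (cmod (c i))^2) + (\<Sum>i\<in>F. (cmod (a i - c i))^2))"
    by (simp only: of_real_diff of_real_add of_real_sum complex_norm_square)
       (simp add: algebra_simps sum.distrib sum_subtractf)
  finally show ?thesis unfolding c_def of_real_eq_iff .
qed

text \<open>Riesz--Fischer by hand: the expansion of \<open>f\<close> is summed along finite sets \<open>F k\<close> whose tails
  decay geometrically, so that the telescoping series of its blocks converges almost everywhere;
  completeness identifies the limit with \<open>f\<close>.\<close>

lemma (in finite_measure) orthonormal_complete_parseval:
  fixes e :: "'i \<Rightarrow> 'a \<Rightarrow> complex"
  assumes e_meas: "\<And>i. i \<in> I \<Longrightarrow> e i \<in> borel_measurable M"
    and e_bd: "\<And>i x. i \<in> I \<Longrightarrow> x \<in> space M \<Longrightarrow> cmod (e i x) \<le> 1"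
    and orth: "\<And>i j. i \<in> I \<Longrightarrow> j \<in> I \<Longrightarrow> (\<integral>x. e i x * cnj (e j x) \<partial>M) = (if i = j then 1 else 0)"
    and complete: "\<And>g. g \<in> borel_measurable M \<Longrightarrow> integrable M (\<lambda>x. (cmod (g x))^2) \<Longrightarrow>
        (\<And>i. i \<in> I \<Longrightarrow> (\<integral>x. g x * cnj (e i x) \<partial>M) = 0) \<Longrightarrow> AE x in M. g x = 0"
    and f_meas: "f \<in> borel_measurable M"
    and f_bd: "\<And>x. x \<in> space M \<Longrightarrow> cmod (f x) \<le> B"
  shows "((\<lambda>i. (cmod (\<integral>x. f x * cnj (e i x) \<partial>M))^2) has_sum (\<integral>x. (cmod (f x))^2 \<partial>M)) I"
proof -
  note [measurable] = e_meas f_meas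
  define c where "c i = (\<integral>x. f x * cnj (e i x) \<partial>M)" for i
  define p where "p F x = (\<Sum>i\<in>F. c i * e i x)" for F x
  define N where "N = (\<integral>x. (cmod (f x))^2 \<partial>M)"
  let ?s = "\<lambda>F. \<Sum>i\<in>F. (cmod (c i))^2"
  have dist: "(\<integral>x. (cmod (f x - p F x))^2 \<partial>M) = N - ?s F" if "finite F" "F \<subseteq> I" for F
    using orthonormal_dist_sq[of F e 1 f B c] that e_meas e_bd orth f_meas f_bd
    by (auto simp: p_def N_def c_def subset_iff)
  have bessel: "?s F \<le> N" if "finite F" "F \<subseteq> I" for F
    using dist[OF that] Bochner_Integration.integral_nonneg[of M "\<lambda>x. (cmod (f x - p F x))^2"] by simp
  have summ: "(\<lambda>i. (cmod (c i))^2) summable_on I"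
    by (rule nonneg_bounded_partial_sums_imp_summable_on[where C=N])
       (auto intro!: bessel eventually_finite_subsets_at_top_weakI)
  define \<alpha> where "\<alpha> = infsum (\<lambda>i. (cmod (c i))^2) I"
  have hs: "((\<lambda>i. (cmod (c i))^2) has_sum \<alpha>) I" using summ by (simp add: \<alpha>_def)
  have sle: "?s F \<le> \<alpha>" if "finite F" "F \<subseteq> I" for F
    unfolding \<alpha>_def by (rule finite_sum_le_infsum) (use summ that in auto)
  \<comment> \<open>Tails below 4^-k make the L2 distance of consecutive partial sums of order 2^-k;
    by the bound \<open>L1\<close> below their L1 norms are of the same order, hence
    summable.\<close>
  have "\<exists>F. finite F \<and> F \<subseteq> I \<and> \<alpha> - ?s F < (1/4)^k" for k :: nat
  proof -
    have "\<forall>\<^sub>F F in finite_subsets_at_top I. dist (?s F) \<alpha> < (1/4)^k"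
      using hs unfolding has_sum_def by (rule tendstoD) simp
    then obtain F where F: "finite F" "F \<subseteq> I" "dist (?s F) \<alpha> < (1/4)^k"
      unfolding eventually_finite_subsets_at_top by blast
    with sle[OF F(1,2)] show ?thesis by (intro exI[of _ F]) (auto simp: dist_real_def)
  qed
  then obtain F where F: "\<And>k. finite (F k)" "\<And>k. F k \<subseteq> I" "\<And>k. \<alpha> - ?s (F k) < (1/4)^k"
    by metis
  define q where "q k = p (F k)" for k
  have q_meas [measurable]: "q k \<in> borel_measurable M" for k
    unfolding q_def p_def using F(2)[of k] by (intro borel_measurable_sum borel_measurable_times e_meas) auto
  have q_bd: "cmod (q k x) \<le> (\<Sum>i\<in>F k. cmod (c i))" if "x \<in> space M" for k x
    unfolding q_def p_def using F(2)[of k] e_bd[OF _ that]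
    by (intro sum_norm_le) (auto simp: norm_mult intro!: mult_left_le)
  have diff: "(\<integral>x. (cmod (q k x - q l x))^2 \<partial>M) \<le> (1/4)^k + (1/4)^l" for k l
  proof -
    \<comment> \<open>Common terms cancel in \<open>q k - q l\<close>; on the symmetric difference
      the terms of \<open>F l\<close> carry a minus sign, which leaves the squared norm
      unchanged.\<close>
    define a where "a i = (if i \<in> F k then c i else - c i)" for i
    let ?D = "(F k - F l) \<union> (F l - F k)"
    have Dfin: "finite ?D" "?D \<subseteq> I" using F by auto
    have "q k x - q l x = (\<Sum>i\<in>?D. a i * e i x)" for x
    proof -
      have "q k x = (\<Sum>i\<in>F k - F l. c i * e i x) + (\<Sum>i\<in>F k \<inter> F l. c i * e i x)"
        unfolding q_def p_def by (subst sum.union_disjoint[symmetric]) (auto simp: F intro!: sum.cong)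
      moreover have "q l x = (\<Sum>i\<in>F l - F k. c i * e i x) + (\<Sum>i\<in>F k \<inter> F l. c i * e i x)"
        unfolding q_def p_def by (subst sum.union_disjoint[symmetric]) (auto simp: F intro!: sum.cong)
      moreover have "(\<Sum>i\<in>?D. a i * e i x) = (\<Sum>i\<in>F k - F l. c i * e i x) - (\<Sum>i\<in>F l - F k. c i * e i x)"
        by (subst sum.union_disjoint) (auto simp: F a_def sum_negf intro!: sum.cong)
      ultimately show ?thesis by simp
    qed
    then have "(\<integral>x. (cmod (q k x - q l x))^2 \<partial>M) = (\<integral>x. (cmod ((\<lambda>x. 0) x - (\<Sum>i\<in>?D. a i * e i x)))^2 \<partial>M)"
      by (simp only: diff_0 norm_minus_cancel)
    also have "\<dots> = (\<Sum>i\<in>?D. (cmod (a i))^2)"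
      using orthonormal_dist_sq[of ?D e 1 "\<lambda>x. 0" 0 a, OF Dfin(1) e_meas[OF subsetD[OF Dfin(2)]] e_bd[OF subsetD[OF Dfin(2)]]
        orth[OF subsetD[OF Dfin(2)] subsetD[OF Dfin(2)]]] by simp
    also have "\<dots> = (\<Sum>i\<in>F k - F l. (cmod (c i))^2) + (\<Sum>i\<in>F l - F k. (cmod (c i))^2)"
      by (subst sum.union_disjoint) (auto simp: F a_def intro!: sum.cong)
    also have "\<dots> \<le> (\<alpha> - ?s (F l)) + (\<alpha> - ?s (F k))"
    proof (rule add_mono)
      have *: "?s (F k - F l) + ?s (F l) \<le> \<alpha>" for k l
        using sle[of "(F k - F l) \<union> F l"] F by (subst sum.union_disjoint[symmetric]) auto
      show "?s (F k - F l) \<le> \<alpha> - ?s (F l)" "?s (F l - F k) \<le> \<alpha> - ?s (F k)"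
        using *[of k l] *[of l k] by auto
    qed
    also have "\<dots> \<le> (1/4)^k + (1/4)^l" using F(3)[of k] F(3)[of l] by simp
    finally show ?thesis .
  qed
  define \<mu> where "\<mu> = measure M (space M)"
  have L1: "(\<integral>x. cmod (h x) \<partial>M) \<le> (\<mu> + K) * (1/2)^k"
    if [measurable]: "h \<in> borel_measurable M" and i: "integrable M (\<lambda>x. (cmod (h x))^2)"
      and le: "(\<integral>x. (cmod (h x))^2 \<partial>M) \<le> K * (1/4)^k" for h :: "'a \<Rightarrow> complex" and k :: nat and K
  proof -
    \<comment> \<open>Splitting at the level 2^-k: larger values satisfy |h| <= 2^k |h|^2. On a
      finite measure space this trades an L2 bound for an L1 bound.\<close>
    have ptw: "cmod (h x) \<le> (1/2)^k + 2^k * (cmod (h x))^2" for x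
    proof (cases "cmod (h x) \<le> (1/2)^k")
      case False
      then have "1 \<le> 2^k * cmod (h x)" by (simp add: field_simps power_divide)
      then have "cmod (h x) * 1 \<le> cmod (h x) * (2^k * cmod (h x))" by (intro mult_left_mono) auto
      then have "cmod (h x) \<le> 2^k * (cmod (h x))^2" by (simp add: power2_eq_square algebra_simps)
      then show ?thesis by (smt (verit) zero_le_power divide_nonneg_nonneg)
    qed (simp add: add_increasing2)
    have "(\<integral>x. cmod (h x) \<partial>M) \<le> (\<integral>x. (1/2)^k + 2^k * (cmod (h x))^2 \<partial>M)"
    proof (rule integral_mono)
      show i2: "integrable M (\<lambda>x. (1/2)^k + 2^k * (cmod (h x))^2)" using i by simp
      show "integrable M (\<lambda>x. cmod (h x))"
        by (rule Bochner_Integration.integrable_bound[OF i2]) (auto intro!: order_trans[OF ptw] abs_ge_self)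
    qed (rule ptw)
    also have "\<dots> = (1/2)^k * \<mu> + 2^k * (\<integral>x. (cmod (h x))^2 \<partial>M)"
      using i by (simp add: \<mu>_def)
    also have "\<dots> \<le> (1/2)^k * \<mu> + 2^k * (K * (1/4)^k)" using le by (intro add_left_mono mult_left_mono) auto
    also have "(2::real)^k * (K * (1/4)^k) = K * (1/2)^k"
      by (simp add: power_divide field_simps) (simp add: power_mult_distrib[symmetric] flip: power_mult_distrib)
    finally show ?thesis by (simp add: algebra_simps)
  qed
  define d where "d k x = q (Suc k) x - q k x" for k x
  have d_meas [measurable]: "d k \<in> borel_measurable M" for k unfolding d_def by measurable
  have sq_int: "integrable M (\<lambda>x. (cmod (q k x - q l x))^2)" for k l
  proof (rule integrable_bounded)
    show "norm ((cmod (q k x - q l x))^2) \<le> ((\<Sum>i\<in>F k. cmod (c i)) + (\<Sum>i\<in>F l. cmod (c i)))^2" if "x \<in> space M" for x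
      using q_bd[OF that, of k] q_bd[OF that, of l] norm_triangle_ineq4[of "q k x" "q l x"]
      by (auto intro!: power_mono)
  qed measurable
  have q_int: "integrable M (q k)" for k by (rule integrable_bounded[OF q_meas q_bd])
  have d_int: "integrable M (d k)" for k
    unfolding d_def using q_int by (intro Bochner_Integration.integrable_diff)
  have dL1: "(\<integral>x. cmod (d k x) \<partial>M) \<le> (\<mu> + 2) * (1/2)^k" for k
  proof (rule L1)
    show "integrable M (\<lambda>x. (cmod (d k x))^2)" unfolding d_def by (rule sq_int)
    have "(\<integral>x. (cmod (d k x))^2 \<partial>M) \<le> (1/4)^Suc k + (1/4)^k" unfolding d_def by (rule diff)
    also have "\<dots> \<le> 2 * (1/4)^k" by simp
    finally show "(\<integral>x. (cmod (d k x))^2 \<partial>M) \<le> 2 * (1/4)^k" .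
  qed simp
  have "AE x in M. summable (\<lambda>k. cmod (d k x))"
  proof -
    have "(\<integral>\<^sup>+x. (\<Sum>k. ennreal (cmod (d k x))) \<partial>M) = (\<Sum>k. \<integral>\<^sup>+x. ennreal (cmod (d k x)) \<partial>M)"
      by (rule nn_integral_suminf) measurable
    also have "\<dots> \<le> (\<Sum>k. ennreal ((\<mu> + 2) * (1/2)^k))"
      using d_int dL1 by (intro suminf_le) (auto simp: nn_integral_eq_integral intro!: ennreal_leI)
    also have "\<dots> < \<infinity>"
      by (subst suminf_ennreal2) (auto simp: \<mu>_def intro!: summable_mult summable_geometric)
    finally have "(\<integral>\<^sup>+x. (\<Sum>k. ennreal (cmod (d k x))) \<partial>M) \<noteq> \<infinity>" by simp
    then have "AE x in M. (\<Sum>k. ennreal (cmod (d k x))) \<noteq> \<infinity>"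
      by (intro nn_integral_noteq_infinite) measurable
    then show ?thesis
      by eventually_elim (auto intro: summable_suminf_not_top)
  qed
  then have AEconv: "AE x in M. convergent (\<lambda>k. q k x)"
  proof eventually_elim
    case (elim x)
    then have "summable (\<lambda>k. d k x)" by (rule summable_norm_cancel)
    then have "convergent (\<lambda>n. \<Sum>k<n. d k x)" by (simp add: summable_iff_convergent)
    then have "convergent (\<lambda>n. q 0 x + (\<Sum>k<n. d k x))" by (intro convergent_add convergent_const)
    also have "(\<lambda>n. q 0 x + (\<Sum>k<n. d k x)) = (\<lambda>n. q n x)"
      unfolding d_def by (subst sum_lessThan_telescope) simp
    finally show ?case .
  qed
  define g where "g x = lim (\<lambda>k. q k x)" for x
  have g_meas [measurable]: "g \<in> borel_measurable M" unfolding g_def by measurable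
  have AElim: "AE x in M. (\<lambda>k. q k x) \<longlonglongrightarrow> g x"
    using AEconv by eventually_elim (simp add: g_def convergent_LIMSEQ_iff)
  \<comment> \<open>Fatou's lemma as l tends to infinity: the L2 distance of \<open>q (l+k)\<close>
    and \<open>q k\<close> is bounded uniformly in l.\<close>
  have nn_g: "(\<integral>\<^sup>+x. ennreal ((cmod (g x - q k x))^2) \<partial>M) \<le> ennreal (2 * (1/4)^k)" for k
  proof -
    have "(\<integral>\<^sup>+x. ennreal ((cmod (g x - q k x))^2) \<partial>M) = (\<integral>\<^sup>+x. liminf (\<lambda>l. ennreal ((cmod (q (l+k) x - q k x))^2)) \<partial>M)"
    proof (rule nn_integral_cong_AE)
      show "AE x in M. ennreal ((cmod (g x - q k x))^2) = liminf (\<lambda>l. ennreal ((cmod (q (l+k) x - q k x))^2))"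
        using AElim
      proof eventually_elim
        case (elim x)
        have "(\<lambda>l. ennreal ((cmod (q (l+k) x - q k x))^2)) \<longlonglongrightarrow> ennreal ((cmod (g x - q k x))^2)"
          using LIMSEQ_ignore_initial_segment[OF elim, of k] by (intro tendsto_ennrealI tendsto_intros)
        then show ?case by (rule lim_imp_Liminf[OF trivial_limit_sequentially, symmetric])
      qed
    qed
    also have "\<dots> \<le> liminf (\<lambda>l. \<integral>\<^sup>+x. ennreal ((cmod (q (l+k) x - q k x))^2) \<partial>M)"
      by (rule nn_integral_liminf) measurable
    also have "\<dots> \<le> limsup (\<lambda>l. \<integral>\<^sup>+x. ennreal ((cmod (q (l+k) x - q k x))^2) \<partial>M)"
      by (rule Liminf_le_Limsup) simp
    also have "\<dots> \<le> ennreal (2 * (1/4)^k)"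
    proof (rule Limsup_bounded, rule always_eventually, rule allI)
      fix l
      have "(\<integral>\<^sup>+x. ennreal ((cmod (q (l+k) x - q k x))^2) \<partial>M) = ennreal (\<integral>x. (cmod (q (l+k) x - q k x))^2 \<partial>M)"
        by (rule nn_integral_eq_integral[OF sq_int]) simp
      also have "\<dots> \<le> ennreal ((1/4)^(l+k) + (1/4)^k)" by (intro ennreal_leI diff)
      also have "\<dots> \<le> ennreal (2 * (1/4)^k)"
        by (intro ennreal_leI) (simp add: power_add mult_le_one power_le_one mult_left_le_one_le)
      finally show "(\<integral>\<^sup>+x. ennreal ((cmod (q (l+k) x - q k x))^2) \<partial>M) \<le> ennreal (2 * (1/4)^k)" .
    qed
    finally show ?thesis .
  qed
  have gq_int: "integrable M (\<lambda>x. (cmod (g x - q k x))^2)" for k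
    using nn_g[of k] by (intro integrableI_bounded) (auto simp: less_top[symmetric] top_unique)
  have gq: "(\<integral>x. (cmod (g x - q k x))^2 \<partial>M) \<le> 2 * (1/4)^k" for k
    using nn_g[of k] by (subst (asm) nn_integral_eq_integral[OF gq_int]) auto
  have gqL1: "(\<integral>x. cmod (g x - q k x) \<partial>M) \<le> (\<mu> + 2) * (1/2)^k" for k
    by (rule L1[OF _ gq_int gq]) measurable
  \<comment> \<open>\<open>g\<close> is only a pointwise limit; square integrability of
    \<open>h - g\<close> comes from comparison with the bounded function \<open>q 0\<close>.\<close>
  have g_sq: "integrable M (\<lambda>x. (cmod (h x - g x))^2)"
    if "h \<in> borel_measurable M" "\<And>x. x \<in> space M \<Longrightarrow> cmod (h x) \<le> K" for h :: "'a \<Rightarrow> complex" and K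
  proof (rule Bochner_Integration.integrable_bound)
    note [measurable] = that(1)
    show "(\<lambda>x. (cmod (h x - g x))^2) \<in> borel_measurable M" by measurable
    have "integrable M (\<lambda>x. (cmod (h x - q 0 x))^2)"
    proof (rule integrable_bounded)
      show "norm ((cmod (h x - q 0 x))^2) \<le> (K + (\<Sum>i\<in>F 0. cmod (c i)))^2" if "x \<in> space M" for x
        using q_bd[OF that, of 0] \<open>\<And>x. x \<in> space M \<Longrightarrow> cmod (h x) \<le> K\<close>[OF that] norm_triangle_ineq4[of "h x" "q 0 x"]
        by (auto intro!: power_mono)
    qed measurable
    with gq_int[of 0] show "integrable M (\<lambda>x. 2 * (cmod (h x - q 0 x))^2 + 2 * (cmod (g x - q 0 x))^2)"
      by simp
    have "(cmod (h x - g x))^2 \<le> 2 * (cmod (h x - q 0 x))^2 + 2 * (cmod (g x - q 0 x))^2" for x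
    proof -
      have "cmod (h x - g x) \<le> cmod (h x - q 0 x) + cmod (g x - q 0 x)"
        using norm_triangle_ineq4[of "h x - q 0 x" "g x - q 0 x"] by simp
      then have "(cmod (h x - g x))^2 \<le> (cmod (h x - q 0 x) + cmod (g x - q 0 x))^2" by (intro power_mono) auto
      also have "\<dots> \<le> 2 * (cmod (h x - q 0 x))^2 + 2 * (cmod (g x - q 0 x))^2"
        using zero_le_power2[of "cmod (h x - q 0 x) - cmod (g x - q 0 x)"] by (simp add: power2_eq_square algebra_simps)
      finally show ?thesis .
    qed
    then show "AE x in M. norm ((cmod (h x - g x))^2) \<le> norm (2 * (cmod (h x - q 0 x))^2 + 2 * (cmod (g x - q 0 x))^2)"
      by auto
  qed
  have fg_sq: "integrable M (\<lambda>x. (cmod (f x - g x))^2)" by (rule g_sq[OF f_meas f_bd])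
  have gq_int1: "integrable M (\<lambda>x. g x - q k x)" for k
  proof (rule Bochner_Integration.integrable_bound)
    show "integrable M (\<lambda>x. 1 + (cmod (g x - q k x))^2)" using gq_int by simp
    have "t \<le> 1 + t^2" for t :: real
      using zero_le_power2[of "t - 1"] by (simp add: power2_eq_square algebra_simps) (smt (verit) mult_nonneg_nonneg zero_le_square)
    then show "AE x in M. norm (g x - q k x) \<le> norm (1 + (cmod (g x - q k x))^2)"
      by (auto intro!: always_eventually order_trans[OF _ abs_ge_self])
  qed measurable
  have inner0: "(\<integral>x. (f x - g x) * cnj (e i x) \<partial>M) = 0" if "i \<in> I" for i
  proof -
    have ib: "integrable M (\<lambda>x. h x * cnj (e i x))" if "integrable M h" for h
      by (rule Bochner_Integration.integrable_bound[OF that])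
         (use that \<open>i \<in> I\<close> in \<open>auto simp: norm_mult e_bd mult_left_le\<close>)
    have f_int: "integrable M f" by (rule integrable_bounded[OF f_meas f_bd])
    have qi: "cmod ((\<integral>x. f x * cnj (e i x) \<partial>M) - (\<integral>x. q k x * cnj (e i x) \<partial>M)) \<le> (1/2)^k" for k
    proof -
      have "(\<integral>x. q k x * cnj (e i x) \<partial>M) = (\<Sum>j\<in>F k. c j * (\<integral>x. e j x * cnj (e i x) \<partial>M))"
        unfolding q_def p_def sum_distrib_right
        apply (subst Bochner_Integration.integral_sum)
        subgoal for j
          using F(2)[of k] that e_bd by (intro ib integrable_bounded[where B="cmod (c j)"] borel_measurable_times e_meas) (auto simp: norm_mult mult_left_le)
        by (simp add: mult.assoc)
      also have "\<dots> = (\<Sum>j\<in>F k. if j = i then c j else 0)"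
        using F(2)[of k] that by (intro sum.cong refl) (auto simp: orth)
      also have "\<dots> = (if i \<in> F k then c i else 0)" using F(1) by simp
      finally have eq: "(\<integral>x. q k x * cnj (e i x) \<partial>M) = (if i \<in> F k then c i else 0)" .
      \<comment> \<open>An index outside \<open>F k\<close> belongs to the tail, whose squared
        coefficients add up to less than 4^-k.\<close>
      have "cmod (c i) \<le> (1/2)^k" if "i \<notin> F k"
      proof (rule power2_le_imp_le)
        have "?s (insert i (F k)) \<le> \<alpha>" using F \<open>i \<in> I\<close> by (intro sle) auto
        then show "(cmod (c i))^2 \<le> ((1/2)^k)^2"
          using that F(1,3)[of k] by (simp add: power_even_eq power_mult[symmetric] mult.commute[of 2] power2_eq_square power_mult_distrib[symmetric] flip: power_mult_distrib)
      qed simp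
      then show ?thesis unfolding eq by (simp add: c_def[symmetric])
    qed
    have "cmod (\<integral>x. (f x - g x) * cnj (e i x) \<partial>M) \<le> (\<mu> + 3) * (1/2)^k" for k
    proof -
      have "(\<integral>x. (f x - g x) * cnj (e i x) \<partial>M) = (\<integral>x. f x * cnj (e i x) - q k x * cnj (e i x) - (g x - q k x) * cnj (e i x) \<partial>M)"
        by (intro Bochner_Integration.integral_cong refl) (simp add: algebra_simps)
      also have "\<dots> = (\<integral>x. f x * cnj (e i x) \<partial>M) - (\<integral>x. q k x * cnj (e i x) \<partial>M) - (\<integral>x. (g x - q k x) * cnj (e i x) \<partial>M)"
        by (subst Bochner_Integration.integral_diff, intro Bochner_Integration.integrable_diff ib f_int q_int, intro ib gq_int1,
            subst Bochner_Integration.integral_diff, intro ib f_int, intro ib q_int, simp)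
      also have "cmod \<dots> \<le> cmod ((\<integral>x. f x * cnj (e i x) \<partial>M) - (\<integral>x. q k x * cnj (e i x) \<partial>M)) + cmod (\<integral>x. (g x - q k x) * cnj (e i x) \<partial>M)"
        by (rule norm_triangle_ineq4)
      also have "cmod (\<integral>x. (g x - q k x) * cnj (e i x) \<partial>M) \<le> (\<integral>x. cmod (g x - q k x) \<partial>M)"
        using ib[OF gq_int1[of k]] gq_int1[of k] that by (intro order_trans[OF Bochner_Integration.integral_norm_bound] integral_mono integrable_norm) (auto simp: norm_mult e_bd mult_left_le)
      finally show ?thesis using qi[of k] gqL1[of k] by (simp add: algebra_simps)
    qed
    moreover have "(\<lambda>k. (\<mu> + 3) * (1/2::real)^k) \<longlonglongrightarrow> (\<mu> + 3) * 0"
      by (intro tendsto_intros LIMSEQ_realpow_zero) auto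
    ultimately have "cmod (\<integral>x. (f x - g x) * cnj (e i x) \<partial>M) \<le> 0"
      by (intro LIMSEQ_le_const[of "\<lambda>k. (\<mu> + 3) * (1/2::real)^k"]) auto
    then show ?thesis by simp
  qed
  have "AE x in M. f x - g x = 0" by (rule complete[OF _ fg_sq inner0]) measurable
  then have eqN: "N - ?s (F k) = (\<integral>x. (cmod (g x - q k x))^2 \<partial>M)" for k
    unfolding dist[OF F(1,2), symmetric] q_def[symmetric]
    by (intro integral_cong_AE) (auto elim: AE_mp)
  then have "N - \<alpha> \<le> 2 * (1/4)^k" for k
    using gq[of k] sle[OF F(1,2)[of k]] eqN[of k] by (smt (verit))
  moreover have "(\<lambda>k. 2 * (1/4::real)^k) \<longlonglongrightarrow> 2 * 0"
    by (intro tendsto_intros LIMSEQ_realpow_zero) auto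
  ultimately have "N - \<alpha> \<le> 0"
    by (intro LIMSEQ_le_const[of "\<lambda>k. 2 * (1/4::real)^k"]) auto
  moreover have "\<alpha> \<le> N"
    unfolding \<alpha>_def by (rule infsum_le_finite_sums[OF summ]) (use bessel in auto)
  ultimately have "\<alpha> = N" by simp
  with hs show ?thesis by (simp add: c_def N_def)
qed

section \<open>Trigonometric polynomials\<close>

lemma expo_cis: "expo l x = cis (2 * pi * l * x)"
  by (simp add: expo_def cis_conv_exp algebra_simps)

lemma norm_expo [simp]: "cmod (expo l x) = 1"
  by (simp add: expo_cis)

lemma expo_0 [simp]: "expo 0 x = 1" "expo l 0 = 1"
  by (simp_all add: expo_cis)

lemma expo_add: "expo (l + m) x = expo l x * expo m x"
  by (simp add: expo_cis cis_mult algebra_simps)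

lemma expo_add_right: "expo l (x + y) = expo l x * expo l y"
  by (simp add: expo_cis cis_mult algebra_simps)

lemma expo_minus: "expo (- l) x = cnj (expo l x)"
  by (simp add: expo_cis cis_cnj)

lemma expo_minus_right: "expo l (- x) = cnj (expo l x)"
  by (simp add: expo_cis cis_cnj)

lemma expo_diff: "expo (l - m) x = expo l x * cnj (expo m x)"
  using expo_add[of l "- m" x] by (simp add: expo_minus)

lemma expo_diff_right: "expo l (x - y) = expo l x * cnj (expo l y)"
  using expo_add_right[of l x "- y"] by (simp add: expo_minus_right)

lemma expo_mult_cnj [simp]: "expo l x * cnj (expo l x) = 1"
  using expo_diff[of l l x] by simp

lemma expo_int: "x \<in> \<int> \<Longrightarrow> l \<in> \<int> \<Longrightarrow> expo l x = 1"
  unfolding expo_cis by (metis Ints_mult cis_multiple_2pi mult.assoc)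

lemma continuous_on_expo [continuous_intros]: "continuous_on A f \<Longrightarrow> continuous_on A (\<lambda>x. expo l (f x))"
  unfolding expo_def by (intro continuous_intros)

lemma borel_measurable_expo [measurable]: "expo l \<in> borel_measurable borel"
  by (intro borel_measurable_continuous_onI continuous_intros)

lemma expo_minus_one_bound: "cmod (expo l x - 1) \<le> 2 * pi * \<bar>l * x\<bar>"
proof -
  have "cmod (cis t - 1) \<le> \<bar>t\<bar>" for t
  proof -
    have "(cmod (cis t - 1))^2 = (cos t - 1)^2 + (sin t)^2" by (simp add: cmod_power2)
    also have "\<dots> = 2 - 2 * cos t" using sin_cos_squared_add[of t] by (simp add: power2_eq_square algebra_simps)
    also have "\<dots> = (2 * sin (t/2))^2" using cos_double_sin[of "t/2"] by (simp add: power2_eq_square)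
    finally have "cmod (cis t - 1) = \<bar>2 * sin (t/2)\<bar>" by (metis abs_norm_cancel real_sqrt_abs)
    also have "\<dots> \<le> \<bar>t\<bar>" using abs_sin_x_le_abs_x[of "t/2"] by simp
    finally show ?thesis .
  qed
  from this[of "2 * pi * l * x"] show ?thesis by (simp add: expo_cis abs_mult)
qed

section \<open>Uniqueness of Fourier coefficients with period 3\<close>

lemma set_integrable_continuous_Icc:
  fixes f :: "real \<Rightarrow> 'b::euclidean_space"
  shows "continuous_on {a..b} f \<Longrightarrow> set_integrable lborel {a..b} f"
  by (rule borel_integrable_atLeastAtMost')

lemma integral_expo_int:
  "(LINT x:{0..3}|lborel. expo (of_int k / 3) x) = (if k = 0 then 3 else 0)"
proof (cases "k = 0")
  case True
  have "(LINT x:{0..3::real}|lborel. (1::complex)) = 3"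
    by (simp add: set_integral_const scaleR_conv_of_real)
  with True show ?thesis by simp
next
  case False
  define c where "c = 2 * of_real pi * \<i> * of_real (of_int k / 3)"
  have c0: "c \<noteq> 0" using False by (simp add: c_def)
  have "(LINT x:{0..3}|lborel. expo (of_int k / 3) x) = expo (of_int k / 3) 3 / c - expo (of_int k / 3) 0 / c"
    unfolding set_lebesgue_integral_def
  proof (rule integral_FTC_atLeastAtMost)
    show "((\<lambda>x. expo (of_int k / 3) x / c) has_vector_derivative expo (of_int k / 3) x) (at x within {0..3})" for x
    proof -
      have "((\<lambda>z. exp (c * z) / c) has_field_derivative exp (c * of_real x)) (at (of_real x))"
        using c0 by (auto intro!: derivative_eq_intros)
      from has_vector_derivative_real_field[OF this, of "{0..3}"] show ?thesis
        by (simp add: expo_def c_def mult_ac)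
    qed
  qed (auto intro: continuous_intros)
  also have "expo (of_int k / 3) 3 = expo (of_int k) 1" by (simp add: expo_def)
  finally show ?thesis using False by (simp add: expo_int)
qed

text \<open>Trigonometric polynomials of period 3, given by closure rules so that continuity,
  products and orthogonality relations follow by induction.\<close>

inductive_set trig :: "(real \<Rightarrow> complex) set" where
  trig_expo: "expo (of_int k / 3) \<in> trig"
| trig_add: "f \<in> trig \<Longrightarrow> g \<in> trig \<Longrightarrow> (\<lambda>x. f x + g x) \<in> trig"
| trig_scale: "f \<in> trig \<Longrightarrow> (\<lambda>x. c * f x) \<in> trig"

lemma trig_const: "(\<lambda>x. c) \<in> trig"
  using trig_scale[OF trig_expo[of 0], of c] by simp

lemma trig_mult:
  assumes "f \<in> trig" "g \<in> trig"
  shows "(\<lambda>x. f x * g x) \<in> trig"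
  using assms(1)
proof induction
  case (trig_expo k)
  show ?case using assms(2)
  proof induction
    case (trig_expo j)
    have "(\<lambda>x. expo (of_int k / 3) x * expo (of_int j / 3) x) = expo (of_int (k + j) / 3)"
      by (simp add: fun_eq_iff expo_add[symmetric] add_divide_distrib)
    then show ?case by (metis trig.trig_expo)
  next
    case (trig_add f g)
    then show ?case using trig.trig_add[OF trig_add.IH] by (simp add: algebra_simps)
  next
    case (trig_scale f c)
    then show ?case using trig.trig_scale[OF trig_scale.IH, of c] by (simp add: algebra_simps)
  qed
next
  case (trig_add f g)
  then show ?case using trig.trig_add[OF trig_add.IH] by (simp add: algebra_simps)
next
  case (trig_scale f c)
  then show ?case using trig.trig_scale[OF trig_scale.IH, of c] by (simp add: algebra_simps)
qed

lemma continuous_on_trig: "t \<in> trig \<Longrightarrow> continuous_on A t"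
  by (induction rule: trig.induct) (auto intro!: continuous_intros)

text \<open>A real-linear functional on the plane has the form u z + v cnj z, and on the unit circle
  conjugation is inversion: it turns \<open>expo (1/3) x\<close> into \<open>expo (-1/3) x\<close>.
  Sums and products are covered by the closure of \<open>trig\<close>.\<close>

lemma trig_real_polynomial:
  fixes p :: "complex \<Rightarrow> real"
  assumes "real_polynomial_function p"
  shows "(\<lambda>x. of_real (p (expo (1/3) x))) \<in> trig"
  using assms
proof induction
  case (linear f)
  interpret f: bounded_linear f by fact
  have lin: "f z = Re z * f 1 + Im z * f \<i>" for z
  proof -
    have "f z = f (Re z *\<^sub>R 1 + Im z *\<^sub>R \<i>)" by (rule arg_cong[of _ _ f]) (simp add: complex_eq_iff)
    then show ?thesis by (simp only: f.add f.scale real_scaleR_def)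
  qed
  define u where "u = (of_real (f 1) - \<i> * of_real (f \<i>)) / 2"
  define v where "v = (of_real (f 1) + \<i> * of_real (f \<i>)) / 2"
  have "of_real (f z) = u * z + v * cnj z" for z
    unfolding u_def v_def by (subst lin) (simp add: complex_eq_iff field_simps)
  moreover have "(\<lambda>x. u * expo (of_int 1 / 3) x + v * expo (of_int (-1) / 3) x) \<in> trig"
    by (rule trig_add[OF trig_scale[OF trig_expo] trig_scale[OF trig_expo]])
  ultimately show ?case by (simp add: expo_minus)
next
  case (const c)
  show ?case by (rule trig_const)
next
  case (add f g)
  then show ?case using trig_add[of "\<lambda>x. of_real (f (expo (1/3) x))"] by simp
next
  case (mult f g)
  then show ?case using trig_mult[of "\<lambda>x. of_real (f (expo (1/3) x))"] by simp
qed

lemma trig_polynomial: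
  fixes p :: "complex \<Rightarrow> complex"
  assumes "polynomial_function p"
  shows "(\<lambda>x. p (expo (1/3) x)) \<in> trig"
proof -
  have "real_polynomial_function (Re \<circ> p)" "real_polynomial_function (Im \<circ> p)"
    using assms bounded_linear_Re bounded_linear_Im unfolding polynomial_function_def by blast+
  from trig_add[OF trig_real_polynomial[OF this(1)] trig_scale[OF trig_real_polynomial[OF this(2)], of \<i>]]
  show ?thesis by (simp add: complex_eq[symmetric])
qed

text \<open>A function on \<open>{0..3}\<close> with equal end values is a function on the circle,
  where the Stone-Weierstrass theorem supplies a polynomial in the real and imaginary parts.\<close>

lemma trig_dense:
  assumes g: "continuous_on {0..3} g" "g 0 = g 3" and "\<epsilon> > 0"
  obtains t where "t \<in> trig" "\<And>x. x \<in> {0..3} \<Longrightarrow> cmod (g x - t x) < \<epsilon>"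
proof -
  define p where "p s = g (3 * s)" for s :: real
  have "path p" unfolding path_def p_def
    by (rule continuous_on_compose2[OF g(1)]) (auto intro: continuous_intros)
  \<comment> \<open>The trivial homotopy of the loop \<open>p\<close> to itself yields continuity of
    the induced map on the circle, including the point 1, where \<open>Arg2pi\<close> jumps.\<close>
  then have "homotopic_loops UNIV p p"
    using g(2) by (simp add: homotopic_loops_refl pathstart_def pathfinish_def p_def)
  from homotopic_with_imp_continuous[OF homotopic_loops_imp_homotopic_circlemaps[OF this]]
  have "continuous_on (sphere 0 1) (p \<circ> (\<lambda>z. Arg2pi z / (2 * pi)))" by simp
  then obtain h where h: "polynomial_function h"
      "\<And>z. z \<in> sphere 0 1 \<Longrightarrow> cmod ((p \<circ> (\<lambda>z. Arg2pi z / (2 * pi))) z - h z) < \<epsilon>"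
    using Stone_Weierstrass_polynomial_function[OF compact_sphere _ \<open>\<epsilon> > 0\<close>] by metis
  have "cmod (g x - h (expo (1/3) x)) < \<epsilon>" if "x \<in> {0..3}" for x
  proof -
    have "p (Arg2pi (expo (1/3) x) / (2 * pi)) = g x"
    proof (cases "x = 3")
      case True
      then show ?thesis using g(2) expo_int[of 1 1] by (simp add: p_def expo_def Arg2pi_of_real[of 1, simplified])
    next
      case False
      have "Arg2pi (expo (1/3) x) = 2 * pi * (x / 3)"
        using that False by (intro Arg2pi_unique[of 1]) (auto simp: expo_def field_simps)
      then have "Arg2pi (expo (1/3) x) / (2 * pi) = x / 3" by (simp add: field_simps)
      then show ?thesis by (simp only: p_def) simp
    qed
    with h(2)[of "expo (1/3) x"] show ?thesis by simp
  qed
  with trig_polynomial[OF h(1)] that show ?thesis by blast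
qed

text \<open>By orthogonality the integral of |g|^2 equals that of g (cnj g - t) for every t in
  \<open>trig\<close>, and a uniformly close t makes this arbitrarily small.\<close>

lemma trig_orthogonal_imp_zero:
  assumes g: "continuous_on {0..3} g" "g 0 = g 3"
    and orth: "\<And>k :: int. (LINT x:{0..3}|lborel. g x * expo (of_int k / 3) x) = 0"
    and x: "x \<in> {0..3}"
  shows "g x = 0"
proof -
  have gt: "(LINT x:{0..3}|lborel. g x * t x) = 0" if "t \<in> trig" for t
    using that
  proof induction
    case (trig_add f h)
    have "(LINT x:{0..3}|lborel. g x * (f x + h x)) = (LINT x:{0..3}|lborel. g x * f x) + (LINT x:{0..3}|lborel. g x * h x)"
      using trig_add.hyps unfolding distrib_left
      by (intro set_integral_add set_integrable_continuous_Icc continuous_intros g continuous_on_trig)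
    with trig_add show ?case by simp
  next
    case (trig_scale f c)
    have "(LINT x:{0..3}|lborel. g x * (c * f x)) = (LINT x:{0..3}|lborel. c * (g x * f x))"
      by (simp add: mult_ac)
    with trig_scale show ?case by simp
  qed (rule orth)
  define I where "I = (LINT x:{0..3}|lborel. (cmod (g x))^2)"
  define J where "J = (LINT x:{0..3}|lborel. cmod (g x))"
  have "I \<le> \<epsilon> * J" if e0: "\<epsilon> > 0" for \<epsilon>
  proof -
    have "continuous_on {0..3} (\<lambda>x. cnj (g x))" by (intro continuous_intros g)
    then obtain t where t: "t \<in> trig" "\<And>x. x \<in> {0..3} \<Longrightarrow> cmod (cnj (g x) - t x) < \<epsilon>"
      using trig_dense[of "\<lambda>x. cnj (g x)", OF _ _ e0] g(2) by metis
    have "of_real I = (LINT x:{0..3}|lborel. g x * cnj (g x))"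
      unfolding I_def complex_norm_square[symmetric] by (simp only: set_integral_complex_of_real)
    also have "\<dots> = (LINT x:{0..3}|lborel. g x * (cnj (g x) - t x)) + (LINT x:{0..3}|lborel. g x * t x)"
      by (subst set_integral_add(2)[symmetric], (intro set_integrable_continuous_Icc continuous_intros g continuous_on_trig[OF t(1)])+)
         (simp add: algebra_simps)
    also have "\<dots> = (LINT x:{0..3}|lborel. g x * (cnj (g x) - t x))" using gt[OF t(1)] by simp
    finally have "cmod (of_real I) = cmod (LINT x:{0..3}|lborel. g x * (cnj (g x) - t x))" by simp
    also have "\<dots> \<le> (LINT x:{0..3}|lborel. cmod (g x * (cnj (g x) - t x)))"
      by (intro set_integral_norm_bound set_integrable_continuous_Icc continuous_intros g continuous_on_trig t)
    also have "\<dots> \<le> (LINT x:{0..3}|lborel. \<epsilon> * cmod (g x))"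
      by (intro set_integral_mono set_integrable_continuous_Icc continuous_intros g continuous_on_trig[OF t(1)])
        (auto simp: norm_mult mult.commute[of \<epsilon>] intro!: mult_left_mono less_imp_le[OF t(2)])
    also have "\<dots> = \<epsilon> * J" by (simp add: J_def)
    finally show ?thesis by simp
  qed
  then have "((\<lambda>\<epsilon>. \<epsilon> * J) \<longlongrightarrow> 0 * J) (at_right 0) \<and> (\<forall>\<^sub>F \<epsilon> in at_right 0. I \<le> \<epsilon> * J)"
    by (intro conjI tendsto_mult tendsto_const tendsto_ident_at) (auto simp: eventually_at_filter)
  then have "I \<le> 0 * J" by (intro tendsto_lowerbound[of "\<lambda>\<epsilon>. \<epsilon> * J" _ "at_right 0"]) auto
  moreover have cont: "continuous_on {0..3} (\<lambda>x. (cmod (g x))^2)" by (intro continuous_intros g)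
  have "I = integral {0..3} (\<lambda>x. (cmod (g x))^2)"
    unfolding I_def by (rule set_borel_integral_eq_integral(2)[OF set_integrable_continuous_Icc[OF cont]])
  moreover have "integral {0..3} (\<lambda>x. (cmod (g x))^2) \<ge> 0"
    by (rule Henstock_Kurzweil_Integration.integral_nonneg[OF integrable_continuous_interval[OF cont]]) simp
  ultimately have "integral (cbox 0 3) (\<lambda>x. (cmod (g x))^2) = 0" by simp
  then show ?thesis
    using integral_cbox_eq_0_iff[of 0 "3::real" "\<lambda>x. (cmod (g x))^2"] cont x by auto
qed

section \<open>Autocorrelations and their Fourier series\<close>

definition hat :: "real set \<Rightarrow> real \<Rightarrow> complex" where
  "hat S \<xi> = (LINT x:S|lborel. expo (- \<xi>) x)"

text \<open>The convolution of the indicators of S and -S; for an interval it is a tent.\<close>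

definition corr :: "real set \<Rightarrow> real \<Rightarrow> real" where
  "corr S u = measure lborel {y \<in> S. y + u \<in> S}"

section \<open>Continuity and support of the autocorrelation\<close>

lemma measure_lborel_shift:
  fixes A :: "real set"
  assumes "A \<in> sets borel"
  shows "measure lborel {y. y + h \<in> A} = measure lborel A"
proof -
  have "measure lborel A = measure (distr lborel borel ((+) h)) A" by (simp only: lborel_distr_plus)
  also have "\<dots> = measure lborel {y. y + h \<in> A}"
    using assms by (subst measure_distr) (auto simp: vimage_def add.commute)
  finally show ?thesis ..
qed

lemma fmeasurable_Icc_subset:
  fixes A :: "real set"
  assumes "A \<in> sets borel" "A \<subseteq> {a..b}"
  shows "A \<in> fmeasurable lborel"
  using assms fmeasurableI2[of "{a..b}" lborel A] fmeasurable_cbox[of a b] by simp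

lemma shift_sets_borel [measurable]:
  fixes A :: "real set"
  assumes [measurable]: "A \<in> sets borel" shows "{y. y + h \<in> A} \<in> sets borel"
  by measurable

lemma corr_sets_borel:
  fixes S :: "real set"
  assumes [measurable]: "S \<in> sets borel" shows "{y \<in> S. y + u \<in> S} \<in> sets borel"
  by measurable

lemma corr_nonneg: "0 \<le> corr S u" by (simp add: corr_def)

lemma corr_0: "corr S 0 = measure lborel S" by (simp add: corr_def)

lemma corr_le:
  assumes "S \<in> sets borel" "S \<subseteq> {0..w}"
  shows "corr S u \<le> measure lborel S"
  unfolding corr_def
  by (rule measure_mono_fmeasurable[OF _ _ fmeasurable_Icc_subset[OF assms]]) (use corr_sets_borel[OF assms(1)] in auto)

lemma corr_eq_0:
  assumes "S \<subseteq> {0..w}" "w \<le> \<bar>u\<bar>"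
  shows "corr S u = 0"
proof -
  \<comment> \<open>At |u| = w a single point of overlap can remain, so the set is shown to be
    finite rather than empty.\<close>
  have "{y \<in> S. y + u \<in> S} \<subseteq> {0} \<union> {w}"
  proof
    fix y assume y: "y \<in> {y \<in> S. y + u \<in> S}"
    then have "0 \<le> y" "y \<le> w" "0 \<le> y + u" "y + u \<le> w" using assms(1) by (force simp: subset_iff)+
    with assms(2) show "y \<in> {0} \<union> {w}" by auto
  qed
  then have "finite {y \<in> S. y + u \<in> S}" using finite_subset by blast
  then show ?thesis unfolding corr_def by (simp add: measure_def emeasure_lborel_countable countable_finite)
qed

lemma corr_Icc:
  assumes "0 \<le> w" "\<bar>u\<bar> \<le> w"
  shows "corr {0..w} u = w - \<bar>u\<bar>"
proof -
  have "{y \<in> {0..w}. y + u \<in> {0..w}} = {max 0 (-u)..min w (w-u)}" by auto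
  moreover have "max 0 (-u) \<le> min w (w-u)" "min w (w-u) - max 0 (-u) = w - \<bar>u\<bar>" using assms by auto
  ultimately show ?thesis by (simp add: corr_def)
qed

lemma corr_minus: 
  assumes "S \<in> sets borel" shows "corr S (- u) = corr S u"
proof -
  have "corr S (-u) = measure lborel {y. y + u \<in> {y \<in> S. y + (-u) \<in> S}}"
    unfolding corr_def using measure_lborel_shift[OF corr_sets_borel[OF assms, of "-u"], of u] by simp
  also have "{y. y + u \<in> {y \<in> S. y + (-u) \<in> S}} = {y \<in> S. y + u \<in> S}" by auto
  finally show ?thesis by (simp add: corr_def)
qed

text \<open>Regularity: take a compact K inside S and an open U around K, both differences being
  small. A short shift moves K into U, so a point that leaves S either lies in S - K or is carried
  into U - K.\<close>

lemma measure_shift_diff_small: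
  fixes S :: "real set"
  assumes S: "S \<in> sets borel" "S \<subseteq> {a..b}" and "\<epsilon> > 0"
  obtains \<delta> where "\<delta> > 0" "\<And>h. \<bar>h\<bar> < \<delta> \<Longrightarrow> measure lborel {y \<in> S. y + h \<notin> S} < \<epsilon>"
proof -
  have "S \<in> sets lebesgue" using S(1) by simp
  then obtain K where K: "closed K" "K \<subseteq> S" "emeasure lebesgue (S - K) < ennreal (\<epsilon>/2)"
    using sets_lebesgue_inner_closed[of S "\<epsilon>/2"] \<open>\<epsilon> > 0\<close> by (metis half_gt_zero)
  have Kc: "compact K" using K(1,2) S(2)
    by (meson bounded_closed_interval bounded_subset compact_eq_bounded_closed)
  have Kb [measurable]: "K \<in> sets borel" using K(1) by simp
  obtain U where U: "open U" "K \<subseteq> U" "emeasure lebesgue (U - K) < ennreal (\<epsilon>/2)"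
    using sets_lebesgue_outer_open[of K "\<epsilon>/2"] \<open>\<epsilon> > 0\<close> Kb by (metis half_gt_zero sets_completionI_sets sets_lborel)
  obtain \<delta> where \<delta>: "\<delta> > 0" "(\<Union>x\<in>K. ball x \<delta>) \<subseteq> U"
    using compact_subset_open_imp_ball_epsilon_subset[OF Kc U(1,2)] by blast
  have Ub [measurable]: "U \<in> sets borel" using U(1) by simp
  have UK: "U - K \<in> fmeasurable lborel" "S - K \<in> fmeasurable lborel"
    using U(3) K(3) S(1) by (auto intro!: fmeasurableI simp: less_top[symmetric] top_unique)
  have m: "measure lborel (U - K) < \<epsilon>/2" "measure lborel (S - K) < \<epsilon>/2"
    using U(3) K(3) S(1) UK \<open>\<epsilon> > 0\<close> by (auto simp: emeasure_eq_measure2 ennreal_less_iff)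
  show ?thesis
  proof (rule that[OF \<delta>(1)])
    fix h :: real assume h: "\<bar>h\<bar> < \<delta>"
    have "{y \<in> S. y + h \<notin> S} \<subseteq> (S - K) \<union> {y. y + h \<in> U - K}"
    proof
      fix y assume y: "y \<in> {y \<in> S. y + h \<notin> S}"
      show "y \<in> (S - K) \<union> {y. y + h \<in> U - K}"
      proof (cases "y \<in> K")
        case True
        have "y + h \<in> ball y \<delta>" using h by (simp add: dist_real_def)
        then have "y + h \<in> U" using \<delta>(2) True by blast
        then show ?thesis using y K(2) by auto
      qed (use y in auto)
    qed
    moreover have f2: "{y. y + h \<in> U - K} \<in> fmeasurable lborel"
    proof (rule fmeasurableI)
      have "emeasure lborel {y. y + h \<in> U - K} = emeasure (distr lborel borel ((+) h)) (U - K)"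
        by (subst emeasure_distr) (auto simp: vimage_def add.commute)
      also have "\<dots> = emeasure lborel (U - K)" by (simp only: lborel_distr_plus)
      finally show "emeasure lborel {y. y + h \<in> U - K} < \<infinity>" using UK(1) by (simp add: fmeasurable_def)
    qed measurable
    ultimately have "measure lborel {y \<in> S. y + h \<notin> S} \<le> measure lborel ((S - K) \<union> {y. y + h \<in> U - K})"
      using S(1) UK by (intro measure_mono_fmeasurable fmeasurable.Un) auto
    also have "\<dots> \<le> measure lborel (S - K) + measure lborel {y. y + h \<in> U - K}"
      using UK f2 by (intro measure_Un_le) (auto simp: fmeasurable_def)
    also have "measure lborel {y. y + h \<in> U - K} = measure lborel (U - K)"
      by (rule measure_lborel_shift) simp
    finally show "measure lborel {y \<in> S. y + h \<notin> S} < \<epsilon>" using m by simp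
  qed
qed

text \<open>The loss in passing from u to v is carried by the y with y + u in S and y + v outside S.
  After translation by u these are points of S that leave S under the short shift v - u.\<close>

lemma continuous_on_corr:
  assumes S: "S \<in> sets borel" "S \<subseteq> {0..w}"
  shows "continuous_on A (corr S)"
proof (rule continuous_on_subset[of UNIV])
  have le: "corr S u \<le> corr S v + measure lborel {y \<in> S. y + (v - u) \<notin> S}" for u v
  proof -
    let ?B = "{y \<in> S. y + u \<in> S \<and> y + v \<notin> S}"
    have Bb: "?B \<in> sets borel" "{y \<in> S. y + (v - u) \<notin> S} \<in> sets borel" using S(1) by measurable
    have fm: "C \<in> fmeasurable lborel" if "C \<in> sets borel" "C \<subseteq> S" for C
      using fmeasurable_Icc_subset[of C 0 w] that S(2) by auto
    have fB: "?B \<in> fmeasurable lborel" using fm[OF Bb(1)] by auto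
    have fC: "{y \<in> S. y + v \<in> S} \<in> fmeasurable lborel" using fm[OF corr_sets_borel[OF S(1)]] by auto
    have "corr S u \<le> measure lborel ({y \<in> S. y + v \<in> S} \<union> ?B)"
      unfolding corr_def using fB fC corr_sets_borel[OF S(1)] by (intro measure_mono_fmeasurable fmeasurable.Un) auto
    also have "\<dots> \<le> corr S v + measure lborel ?B"
      unfolding corr_def using fB fC by (intro measure_Un_le) (auto simp: fmeasurable_def)
    also have "measure lborel ?B \<le> measure lborel {y. y + u \<in> {y \<in> S. y + (v - u) \<notin> S}}"
    proof (rule measure_mono_fmeasurable)
      show "{y. y + u \<in> {y \<in> S. y + (v - u) \<notin> S}} \<in> fmeasurable lborel"
      proof (rule fmeasurable_Icc_subset)
        show "{y. y + u \<in> {y \<in> S. y + (v - u) \<notin> S}} \<in> sets borel" by (rule shift_sets_borel[OF Bb(2)])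
        show "{y. y + u \<in> {y \<in> S. y + (v - u) \<notin> S}} \<subseteq> {-u..w-u}" using S(2) by force
      qed
    qed (use Bb in \<open>auto simp: algebra_simps\<close>)
    also have "\<dots> = measure lborel {y \<in> S. y + (v - u) \<notin> S}" by (rule measure_lborel_shift[OF Bb(2)])
    finally show ?thesis by simp
  qed
  show "continuous_on UNIV (corr S)"
    unfolding continuous_on_iff
  proof (intro ballI allI impI)
    fix u \<epsilon> :: real assume "\<epsilon> > 0"
    obtain \<delta> where \<delta>: "\<delta> > 0" "\<And>h. \<bar>h\<bar> < \<delta> \<Longrightarrow> measure lborel {y \<in> S. y + h \<notin> S} < \<epsilon>"
      using measure_shift_diff_small[OF S \<open>\<epsilon> > 0\<close>] by blast
    show "\<exists>d>0. \<forall>v\<in>UNIV. dist v u < d \<longrightarrow> dist (corr S v) (corr S u) < \<epsilon>"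
    proof (intro exI[of _ \<delta>] conjI ballI impI \<delta>(1))
      fix v assume "dist v u < \<delta>"
      then have "\<bar>v - u\<bar> < \<delta>" "\<bar>u - v\<bar> < \<delta>" by (auto simp: dist_real_def)
      from \<delta>(2)[OF this(1)] \<delta>(2)[OF this(2)] le[of u v] le[of v u]
      show "dist (corr S v) (corr S u) < \<epsilon>" by (auto simp: dist_real_def)
    qed
  qed
qed simp

lemma borel_measurable_corr [measurable]:
  assumes "S \<in> sets borel" "S \<subseteq> {0..w}"
  shows "corr S \<in> borel_measurable borel"
  using continuous_on_corr[OF assms] by (rule borel_measurable_continuous_onI)

section \<open>Fourier transform and Fourier series of the autocorrelation\<close>

lemma set_integrable_expo:
  assumes "S \<in> sets borel" "S \<subseteq> {a..b}"
  shows "set_integrable lborel S (expo \<xi>)"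
proof (rule set_integrable_subset)
  show "set_integrable lborel {a..b} (expo \<xi>)"
    by (intro set_integrable_continuous_Icc continuous_intros)
qed (use assms in auto)

lemma norm_hat_le:
  assumes "S \<in> sets borel" "S \<subseteq> {a..b}"
  shows "cmod (hat S \<xi>) \<le> measure lborel S"
proof -
  have "cmod (hat S \<xi>) \<le> (LINT x:S|lborel. cmod (expo (-\<xi>) x))"
    unfolding hat_def by (rule set_integral_norm_bound[OF set_integrable_expo[OF assms]])
  also have "\<dots> = measure lborel S"
    using fmeasurable_Icc_subset[OF assms] by (simp add: set_lebesgue_integral_def fmeasurable_def)
  finally show ?thesis .
qed

text \<open>Fubini's theorem, with the substitution v = y + u separating the two variables.\<close>

lemma corr_FT:
  assumes S: "S \<in> sets borel" "S \<subseteq> {0..w}"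
  shows "(LINT u|lborel. of_real (corr S u) * expo (- \<xi>) u) = of_real ((cmod (hat S \<xi>))^2)"
proof -
  note [measurable] = S(1)
  define f where "f y u = indicator S y * indicator S (y + u) * expo (- \<xi>) u" for y u :: real
  have meas: "(\<lambda>(y, u). f y u) \<in> borel_measurable (lborel \<Otimes>\<^sub>M lborel)"
    unfolding f_def by measurable
  have Sb: "0 \<le> x \<and> x \<le> w" if "x \<in> S" for x using S(2) that by auto
  have int: "integrable (lborel \<Otimes>\<^sub>M lborel) (\<lambda>(y, u). f y u)"
  proof (rule integrableI_bounded_set[where A="{0..w} \<times> {-w..w}" and B=1, OF _ meas])
    show "emeasure (lborel \<Otimes>\<^sub>M lborel) ({0..w} \<times> {- w..w}) < \<infinity>"
      by (subst lborel.emeasure_pair_measure_Times) (auto simp: ennreal_mult_less_top emeasure_lborel_Icc_eq)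
    show "AE x in lborel \<Otimes>\<^sub>M lborel. x \<in> {0..w} \<times> {- w..w} \<longrightarrow> norm (case x of (y, u) \<Rightarrow> f y u) \<le> 1"
      by (auto simp: f_def norm_mult indicator_def intro!: always_eventually)
    show "AE x in lborel \<Otimes>\<^sub>M lborel. x \<notin> {0..w} \<times> {- w..w} \<longrightarrow> (case x of (y, u) \<Rightarrow> f y u) = 0"
      by (rule always_eventually) (auto simp: f_def indicator_def dest!: Sb)
  qed simp
  have "(LINT u|lborel. of_real (corr S u) * expo (- \<xi>) u) = (LINT u|lborel. LINT y|lborel. f y u)"
  proof (rule Bochner_Integration.integral_cong[OF refl])
    fix u
    have "(LINT y|lborel. f y u) = (LINT y|lborel. expo (-\<xi>) u * of_real (indicator {y \<in> S. y + u \<in> S} y))"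
      by (intro Bochner_Integration.integral_cong refl) (auto simp: f_def indicator_def)
    also have "\<dots> = expo (-\<xi>) u * of_real (corr S u)"
      using corr_sets_borel[OF S(1), of u] by (simp add: corr_def del: of_real_indicator)
    finally show "of_real (corr S u) * expo (- \<xi>) u = (LINT y|lborel. f y u)" by simp
  qed
  also have "\<dots> = (LINT y|lborel. LINT u|lborel. f y u)"
    by (rule lborel_pair.Fubini_integral[OF int])
  also have "\<dots> = (LINT y|lborel. hat S \<xi> * (indicator S y *\<^sub>R expo \<xi> y))"
  proof (rule Bochner_Integration.integral_cong[OF refl])
    fix y
    have "(LINT u|lborel. f y u) = (LINT v|lborel. f y (-y + 1 * v))"
      using lborel_integral_real_affine[of 1 "f y" "-y"] by simp
    also have "\<dots> = (LINT v|lborel. (indicator S y * expo \<xi> y) * (indicator S v *\<^sub>R expo (-\<xi>) v))"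
      by (intro Bochner_Integration.integral_cong refl)
         (auto simp: f_def indicator_def expo_diff_right expo_minus)
    also have "\<dots> = (indicator S y * expo \<xi> y) * hat S \<xi>"
      by (simp add: hat_def set_lebesgue_integral_def del: mult_scaleR_right)
    finally show "(LINT u|lborel. f y u) = hat S \<xi> * (indicator S y *\<^sub>R expo \<xi> y)"
      by (simp add: indicator_def)
  qed
  also have "\<dots> = hat S \<xi> * (LINT y:S|lborel. expo \<xi> y)"
    by (simp add: set_lebesgue_integral_def del: mult_scaleR_right)
  also have "(LINT y:S|lborel. expo \<xi> y) = cnj (hat S \<xi>)"
  proof -
    have "cnj (hat S \<xi>) = (LINT y|lborel. cnj (indicator S y *\<^sub>R expo (-\<xi>) y))"
      unfolding hat_def set_lebesgue_integral_def by (rule Bochner_Integration.integral_cnj[symmetric])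
    also have "\<dots> = (LINT y:S|lborel. expo \<xi> y)"
      unfolding set_lebesgue_integral_def by (simp add: expo_minus)
    finally show ?thesis ..
  qed
  finally show ?thesis by (simp only: complex_norm_square)
qed

lemma integrable_corr_mult:
  fixes g :: "real \<Rightarrow> complex"
  assumes S: "S \<in> sets borel" "S \<subseteq> {0..w}" and g: "g \<in> borel_measurable borel" "\<And>x. cmod (g x) \<le> 1"
  shows "integrable lborel (\<lambda>u. of_real (corr S u) * g u)"
proof (rule integrableI_bounded_set[where A="{-w..w}" and B="measure lborel S"])
  show "AE x in lborel. x \<in> {-w..w} \<longrightarrow> cmod (of_real (corr S x) * g x) \<le> measure lborel S"
    using corr_le[OF S] corr_nonneg[of S] g(2)
    by (auto simp: norm_mult intro!: always_eventually order_trans[OF mult_left_le])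
  show "AE x in lborel. x \<notin> {- w..w} \<longrightarrow> of_real (corr S x) * g x = 0"
    using corr_eq_0[OF S(2)] by (auto intro!: always_eventually)
  show "(\<lambda>u. of_real (corr S u) * g u) \<in> borel_measurable lborel"
    using borel_measurable_corr[OF S] g(1) by measurable
qed (auto simp: emeasure_lborel_Icc_eq)

lemma bessel_expo:
  fixes f :: "real \<Rightarrow> complex" and F :: "int set"
  assumes [measurable]: "f \<in> borel_measurable borel" and bd: "\<And>x. cmod (f x) \<le> B" and "finite F"
  shows "(\<Sum>k\<in>F. (cmod (LINT x:{0..3}|lborel. f x * expo (- (of_int k / 3)) x))^2)
    \<le> 3 * (LINT x:{0..3}|lborel. (cmod (f x))^2)"
proof -
  define M where "M = restrict_space lborel {0..3::real}"
  interpret M: finite_measure M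
    by (rule finite_measureI) (simp add: M_def emeasure_restrict_space space_restrict_space emeasure_lborel_Icc_eq)
  have LM: "integral\<^sup>L M g = (LINT x:{0..3}|lborel. g x)" for g :: "real \<Rightarrow> 'b::{banach,second_countable_topology}"
    unfolding M_def set_lebesgue_integral_def by (rule integral_restrict_space) simp
  have meas: "g \<in> borel_measurable M" if "g \<in> borel_measurable borel" for g :: "real \<Rightarrow> complex"
    unfolding M_def using that by (intro measurable_restrict_space1) simp
  define e where "e k x = expo (of_int k / 3) x / of_real (sqrt 3)" for k :: int and x
  have e_meas: "e k \<in> borel_measurable M" for k
    unfolding e_def by (intro meas) measurable
  have f_meas: "f \<in> borel_measurable M" by (intro meas) simp
  have e_bd: "cmod (e k x) \<le> 1 / sqrt 3" for k x
    by (simp add: e_def norm_divide)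
  have sq: "of_real (sqrt 3) * of_real (sqrt 3) = (3 :: complex)"
    unfolding of_real_mult[symmetric] by simp
  have orth: "(\<integral>x. e i x * cnj (e j x) \<partial>M) = (if i = j then 1 else 0)" for i j
  proof -
    have "(\<integral>x. e i x * cnj (e j x) \<partial>M) = (LINT x:{0..3}|lborel. expo (of_int (i - j) / 3) x / 3)"
      unfolding LM e_def using expo_diff[of "of_int i / 3" "of_int j / 3"]
      by (simp add: sq diff_divide_distrib)
    also have "\<dots> = (LINT x:{0..3}|lborel. expo (of_int (i - j) / 3) x) / 3" by (rule set_integral_divide_zero)
    also have "\<dots> = (if i = j then 1 else 0)" unfolding integral_expo_int by simp
    finally show ?thesis .
  qed
  have c: "(\<integral>x. f x * cnj (e k x) \<partial>M) = (LINT x:{0..3}|lborel. f x * expo (- (of_int k / 3)) x) / of_real (sqrt 3)" for k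
    unfolding LM e_def by (simp add: expo_minus)
  have "0 \<le> (\<integral>x. (cmod (f x - (\<Sum>k\<in>F. (\<integral>x. f x * cnj (e k x) \<partial>M) * e k x)))^2 \<partial>M)"
    by (rule Bochner_Integration.integral_nonneg) simp
  also have "\<dots> = (\<integral>x. (cmod (f x))^2 \<partial>M) - (\<Sum>k\<in>F. (cmod (\<integral>x. f x * cnj (e k x) \<partial>M))^2)"
    using M.orthonormal_dist_sq[OF \<open>finite F\<close> e_meas e_bd orth f_meas bd, of "\<lambda>k. \<integral>x. f x * cnj (e k x) \<partial>M"] by simp
  finally have "(\<Sum>k\<in>F. (cmod (\<integral>x. f x * cnj (e k x) \<partial>M))^2) \<le> (LINT x:{0..3}|lborel. (cmod (f x))^2)"
    by (simp add: LM)
  then show ?thesis unfolding c norm_divide by (simp add: power_divide sum_divide_distrib[symmetric])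
qed

text \<open>Termwise integration, since the remainder of the series is bounded by the tail of the
  sum of |c i| uniformly in u. The expansion of p is demanded only where q does not vanish; in the
  applications q has compact support and the series represents the desired function only
  there.\<close>

lemma integral_expo_series:
  fixes c :: "'i \<Rightarrow> complex" and l :: "'i \<Rightarrow> real" and p q :: "real \<Rightarrow> complex"
  assumes summ: "(\<lambda>i. cmod (c i)) summable_on A"
    and q: "integrable lborel q"
    and p: "\<And>u. q u \<noteq> 0 \<Longrightarrow> ((\<lambda>i. c i * expo (l i) u) has_sum p u) A"
    and qp: "(\<lambda>u. q u * p u) \<in> borel_measurable lborel"
  shows "((\<lambda>i. c i * (LINT u|lborel. q u * expo (l i) u)) has_sum (LINT u|lborel. q u * p u)) A"
proof -
  define R where "R = infsum (\<lambda>i. cmod (c i)) A"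
  have R: "((\<lambda>i. cmod (c i)) has_sum R) A" using summ by (simp add: R_def)
  have qe: "integrable lborel (\<lambda>u. q u * expo \<xi> u)" for \<xi>
    by (rule Bochner_Integration.integrable_bound[OF q]) (use q in \<open>auto simp: norm_mult\<close>)
  have tail: "cmod (p u - (\<Sum>i\<in>F. c i * expo (l i) u)) \<le> R - (\<Sum>i\<in>F. cmod (c i))"
    if F: "finite F" "F \<subseteq> A" and u: "q u \<noteq> 0" for F u
  proof -
    have 1: "((\<lambda>i. c i * expo (l i) u) has_sum (p u - (\<Sum>i\<in>F. c i * expo (l i) u))) (A - F)"
      by (rule has_sum_Diff[OF p[OF u] has_sum_finite[OF F(1)] F(2)])
    have 2: "((\<lambda>i. cmod (c i)) has_sum (R - (\<Sum>i\<in>F. cmod (c i)))) (A - F)"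
      by (rule has_sum_Diff[OF R has_sum_finite[OF F(1)] F(2)])
    have "cmod (infsum (\<lambda>i. c i * expo (l i) u) (A - F)) \<le> infsum (\<lambda>i. cmod (c i * expo (l i) u)) (A - F)"
      by (rule norm_infsum_bound) (use has_sum_imp_summable[OF 2] in \<open>simp add: norm_mult\<close>)
    then show ?thesis using infsumI[OF 1] infsumI[OF 2] by (simp add: norm_mult)
  qed
  have qp_int: "integrable lborel (\<lambda>u. q u * p u)"
  proof (rule Bochner_Integration.integrable_bound[OF _ qp])
    show "integrable lborel (\<lambda>u. R * cmod (q u))" using q by simp
    have "R \<ge> 0" using has_sum_nonneg[OF R] by simp
    then have "cmod (q u * p u) \<le> \<bar>R * cmod (q u)\<bar>" for u
      using tail[of "{}" u] by (cases "q u = 0") (simp_all add: norm_mult abs_mult mult.commute[of R] mult_left_mono)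
    then show "AE u in lborel. cmod (q u * p u) \<le> norm (R * cmod (q u))" by simp
  qed
  have bound: "cmod ((\<Sum>i\<in>F. c i * (LINT u|lborel. q u * expo (l i) u)) - (LINT u|lborel. q u * p u))
      \<le> (R - (\<Sum>i\<in>F. cmod (c i))) * (LINT u|lborel. cmod (q u))" if F: "finite F" "F \<subseteq> A" for F
  proof -
    have i: "integrable lborel (\<lambda>u. \<Sum>i\<in>F. c i * (q u * expo (l i) u))"
      by (rule Bochner_Integration.integrable_sum) (rule integrable_mult_right[OF qe])
    have "(\<Sum>i\<in>F. c i * (LINT u|lborel. q u * expo (l i) u)) = (LINT u|lborel. (\<Sum>i\<in>F. c i * (q u * expo (l i) u)))"
      by (subst Bochner_Integration.integral_sum[OF integrable_mult_right[OF qe]]) simp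
    then have "(\<Sum>i\<in>F. c i * (LINT u|lborel. q u * expo (l i) u)) - (LINT u|lborel. q u * p u) =
       (LINT u|lborel. (\<Sum>i\<in>F. c i * (q u * expo (l i) u)) - q u * p u)"
      using i qp_int by simp
    also have "cmod \<dots> \<le> (LINT u|lborel. cmod ((\<Sum>i\<in>F. c i * (q u * expo (l i) u)) - q u * p u))"
      by (rule Bochner_Integration.integral_norm_bound)
    also have "\<dots> \<le> (LINT u|lborel. (R - (\<Sum>i\<in>F. cmod (c i))) * cmod (q u))"
    proof (rule integral_mono)
      show "integrable lborel (\<lambda>u. cmod ((\<Sum>i\<in>F. c i * (q u * expo (l i) u)) - q u * p u))"
        using i qp_int by (intro integrable_norm Bochner_Integration.integrable_diff)
      show "integrable lborel (\<lambda>u. (R - (\<Sum>i\<in>F. cmod (c i))) * cmod (q u))" using q by simp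
      fix u
      have "cmod ((\<Sum>i\<in>F. c i * (q u * expo (l i) u)) - q u * p u) = cmod (q u) * cmod (p u - (\<Sum>i\<in>F. c i * expo (l i) u))"
      proof -
        have "(\<Sum>i\<in>F. c i * (q u * expo (l i) u)) - q u * p u = - (q u * (p u - (\<Sum>i\<in>F. c i * expo (l i) u)))"
          by (simp add: right_diff_distrib sum_distrib_left mult.left_commute)
        then show ?thesis by (simp only: norm_minus_cancel norm_mult)
      qed
      also have "\<dots> \<le> (R - (\<Sum>i\<in>F. cmod (c i))) * cmod (q u)"
        using tail[OF F, of u] by (cases "q u = 0") (simp_all add: mult.commute[of "R - _"] mult_left_mono)
      finally show "cmod ((\<Sum>i\<in>F. c i * (q u * expo (l i) u)) - q u * p u) \<le> (R - (\<Sum>i\<in>F. cmod (c i))) * cmod (q u)" .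
    qed
    finally show ?thesis by simp
  qed
  have "((\<lambda>F. (R - (\<Sum>i\<in>F. cmod (c i))) * (LINT u|lborel. cmod (q u))) \<longlongrightarrow> (R - R) * (LINT u|lborel. cmod (q u))) (finite_subsets_at_top A)"
    using R unfolding has_sum_def by (intro tendsto_intros)
  then have lim: "((\<lambda>F. (R - (\<Sum>i\<in>F. cmod (c i))) * (LINT u|lborel. cmod (q u))) \<longlongrightarrow> 0) (finite_subsets_at_top A)"
    by simp
  have "((\<lambda>F. (\<Sum>i\<in>F. c i * (LINT u|lborel. q u * expo (l i) u)) - (LINT u|lborel. q u * p u)) \<longlongrightarrow> 0) (finite_subsets_at_top A)"
    by (rule Lim_null_comparison[OF eventually_finite_subsets_at_top_weakI[OF bound] lim])
  then show ?thesis unfolding has_sum_def by (rule LIM_zero_cancel)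
qed

lemma corr_coeff_summable:
  assumes S: "S \<in> sets borel" "S \<subseteq> {0..3}"
  shows "(\<lambda>k :: int. (cmod (hat S (of_int k / 3)))^2 / 3) summable_on UNIV"
proof (rule nonneg_bounded_partial_sums_imp_summable_on)
  note [measurable] = S(1)
  have h: "hat S \<xi> = (LINT x:{0..3}|lborel. indicator S x * expo (- \<xi>) x)" for \<xi>
    unfolding hat_def set_lebesgue_integral_def using S(2)
    by (intro Bochner_Integration.integral_cong) (auto simp: indicator_def)
  show "\<forall>\<^sub>F F in finite_subsets_at_top UNIV. (\<Sum>k\<in>F. (cmod (hat S (of_int k / 3)))^2 / 3)
      \<le> (LINT x:{0..3}|lborel. (cmod (indicator S x))^2)"
  proof (rule eventually_finite_subsets_at_top_weakI)
    fix F :: "int set" assume "finite F"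
    have "(\<lambda>x. indicator S x :: complex) \<in> borel_measurable borel" by measurable
    from bessel_expo[OF this _ \<open>finite F\<close>, of 1] have
      "(\<Sum>k\<in>F. (cmod (hat S (of_int k / 3)))^2) \<le> 3 * (LINT x:{0..3}|lborel. (cmod (indicator S x))^2)"
      unfolding h by (auto simp: indicator_def)
    then show "(\<Sum>k\<in>F. (cmod (hat S (of_int k / 3)))^2 / 3) \<le> (LINT x:{0..3}|lborel. (cmod (indicator S x))^2)"
      by (simp add: sum_divide_distrib[symmetric])
  qed
qed simp

text \<open>Unfolding: the integral of the periodization over one period is the integral of the
  function over \<open>{-3..3}\<close>, which contains its support, and this is the Fourier
  transform computed in \<open>corr_FT\<close>.\<close>

lemma periodized_corr_coeff:
  assumes S: "S \<in> sets borel" "S \<subseteq> {0..w}" and w: "0 \<le> w" "w \<le> 3"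
  shows "(LINT x:{0..3}|lborel. of_real (corr S x + corr S (x - 3)) * expo (- (of_int k / 3)) x)
    = of_real ((cmod (hat S (of_int k / 3)))^2)"
proof -
  let ?e = "expo (- (of_int k / 3))"
  define f where "f u = of_real (corr S u) * ?e u" for u
  have cs: "continuous_on A (corr S)" for A by (rule continuous_on_corr[OF S])
  have cf: "continuous_on A f" for A unfolding f_def by (intro continuous_intros cs)
  have per: "?e x = ?e (x - 3)" for x
  proof -
    have "?e 3 = expo (- of_int k) 1" by (simp add: expo_def)
    then show ?thesis using expo_add_right[of "- (of_int k / 3)" "x - 3" 3] by (simp add: expo_int)
  qed
  have "of_real (corr S x + corr S (x - 3)) * ?e x = f x + f (x - 3)" for x
    using per[of x] by (simp add: f_def distrib_right)
  then have "(LINT x:{0..3}|lborel. of_real (corr S x + corr S (x - 3)) * ?e x)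
      = (LINT x:{0..3}|lborel. f x + f (x - 3))" by simp
  also have "\<dots> = (LINT x:{0..3}|lborel. f x) + (LINT x:{0..3}|lborel. f (x - 3))"
    by (intro set_integral_add set_integrable_continuous_Icc cf continuous_on_compose2[OF cf[of UNIV]] continuous_intros) auto
  also have "(LINT x:{0..3}|lborel. f (x - 3)) = (LINT x:{-3..0}|lborel. f x)"
  proof -
    have "(LINT x:{-3..0}|lborel. f x) = (LINT x|lborel. indicator {-3..0} (-3 + 1 * x) *\<^sub>R f (-3 + 1 * x))"
      unfolding set_lebesgue_integral_def
      using lborel_integral_real_affine[of 1 "\<lambda>x. indicator {-3..0} x *\<^sub>R f x" "-3"] by simp
    also have "\<dots> = (LINT x:{0..3}|lborel. f (x - 3))"
      unfolding set_lebesgue_integral_def by (intro Bochner_Integration.integral_cong) (auto simp: indicator_def)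
    finally show ?thesis ..
  qed
  also have "(LINT x:{0..3}|lborel. f x) + (LINT x:{-3..0}|lborel. f x) = (LINT x:{-3..3}|lborel. f x)"
  proof -
    have "(LINT x:{-3..3}|lborel. f x) = (LINT x:{-3..0} \<union> {0..3}|lborel. f x)"
      by (rule arg_cong[of _ _ "\<lambda>A. LINT x:A|lborel. f x"]) auto
    also have "\<dots> = (LINT x:{-3..0}|lborel. f x) + (LINT x:{0..3}|lborel. f x)"
    proof (rule set_integral_Un_AE)
      have "AE x in lborel. x \<noteq> (0::real)" by (rule AE_lborel_singleton)
      then show "AE x in lborel. \<not> (x \<in> {-3..0} \<and> x \<in> {0..3::real})" by eventually_elim auto
    qed (auto intro: set_integrable_continuous_Icc cf)
    finally show ?thesis by simp
  qed
  also have "\<dots> = (LINT u|lborel. f u)"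
    unfolding set_lebesgue_integral_def
  proof (intro Bochner_Integration.integral_cong refl)
    fix x
    show "indicator {-3..3} x *\<^sub>R f x = f x"
      using corr_eq_0[OF S(2), of x] w by (auto simp: indicator_def f_def)
  qed
  also have "\<dots> = of_real ((cmod (hat S (of_int k / 3)))^2)"
    unfolding f_def by (rule corr_FT[OF S])
  finally show ?thesis .
qed

text \<open>The period 3 is at least twice the length of \<open>{0..w}\<close>, so the periodization of \<open>corr S\<close> does not overlap
  itself.\<close>

lemma corr_series:
  assumes S: "S \<in> sets borel" "S \<subseteq> {0..w}" and w: "0 \<le> w" "w \<le> 3/2" and u: "\<bar>u\<bar> \<le> 3 - w"
  shows "((\<lambda>k :: int. of_real ((cmod (hat S (of_int k / 3)))^2 / 3) * expo (of_int k / 3) u)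
    has_sum of_real (corr S u)) UNIV"
proof -
  define c where "c k = (cmod (hat S (of_int k / 3)))^2 / 3" for k :: int
  have csum: "c summable_on UNIV" unfolding c_def
    using S(2) w by (intro corr_coeff_summable[OF S(1)]) auto
  have c0: "c k \<ge> 0" for k by (simp add: c_def)
  define F where "F x = infsum (\<lambda>k. of_real (c k) * expo (of_int k / 3) x) UNIV" for x
  have Fsum: "((\<lambda>k. of_real (c k) * expo (of_int k / 3) x) has_sum F x) UNIV" for x
  proof -
    have "(\<lambda>k. cmod (of_real (c k) * expo (of_int k / 3) x)) summable_on UNIV"
      using csum c0 by (simp add: norm_mult)
    from has_sum_infsum[OF abs_summable_summable[OF this]] show ?thesis unfolding F_def .
  qed
  have Fcont: "continuous_on A F" for A
  proof (rule uniform_limit_theorem)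
    show "uniform_limit A (\<lambda>X y. \<Sum>k\<in>X. of_real (c k) * expo (of_int k / 3) y) F (finite_subsets_at_top UNIV)"
      by (rule Weierstrass_m_test_general'[OF _ Fsum csum]) (use c0 in \<open>simp add: norm_mult\<close>)
    show "\<forall>\<^sub>F X in finite_subsets_at_top UNIV. continuous_on A (\<lambda>y. \<Sum>k\<in>X. of_real (c k) * expo (of_int k / 3) y)"
      by (rule always_eventually, rule allI, intro continuous_intros)
  qed simp
  have Fper: "F (x + 3) = F x" for x
  proof -
    have "expo (of_int k / 3) (x + 3) = expo (of_int k / 3) x" for k :: int
    proof -
      have "expo (of_int k / 3) 3 = expo (of_int k) 1" by (simp add: expo_def)
      then show ?thesis by (simp add: expo_add_right expo_int)
    qed
    then show ?thesis unfolding F_def by simp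
  qed
  \<comment> \<open>The periodization minus its Fourier series: continuous, equal at both ends, with
    all coefficients 0, hence identically 0.\<close>
  define g where "g x = of_real (corr S x + corr S (x - 3)) - F x" for x
  have cs: "continuous_on A (corr S)" for A by (rule continuous_on_corr[OF S])
  have cs3: "continuous_on A (\<lambda>x. corr S (x - 3))" for A
    by (rule continuous_on_compose2[OF cs[of UNIV]]) (auto intro: continuous_intros)
  have gcont: "continuous_on A g" for A
    unfolding g_def by (intro continuous_intros cs cs3 Fcont)
  have z: "corr S u = 0" if "w \<le> \<bar>u\<bar>" for u using corr_eq_0[OF S(2) that] .
  have g_ends: "g 0 = g 3" using Fper[of 0] w z[of 3] z[of "-3"] by (simp add: g_def)
  have coefF: "(LINT x:{0..3}|lborel. F x * expo (of_int j / 3) x) = of_real (3 * c (- j))" for j :: int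
  proof -
    have A: "((\<lambda>k. of_real (c k) * (LINT x|lborel. (indicator {0..3} x * expo (of_int j / 3) x) * expo (of_int k / 3) x))
       has_sum (LINT x|lborel. (indicator {0..3} x * expo (of_int j / 3) x) * F x)) UNIV"
    proof (rule integral_expo_series)
      show "(\<lambda>k. cmod (of_real (c k))) summable_on UNIV" using csum c0 by simp
      have "set_integrable lborel {0..3} (expo (of_int j / 3))"
        by (intro set_integrable_continuous_Icc continuous_intros)
      then show "integrable lborel (\<lambda>x. indicator {0..3} x * expo (of_int j / 3) x)"
        unfolding set_integrable_def
        by (rule Bochner_Integration.integrable_cong[THEN iffD1, rotated -1]) (simp_all add: indicator_def)
      have [measurable]: "F \<in> borel_measurable borel"
        by (rule borel_measurable_continuous_onI[OF Fcont])
      show "(\<lambda>x. indicator {0..3} x * expo (of_int j / 3) x * F x) \<in> borel_measurable lborel" by measurable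
    qed (rule Fsum)
    have B: "(LINT x|lborel. (indicator {0..3} x * expo (of_int j / 3) x) * expo (of_int k / 3) x)
        = (if k = - j then 3 else 0)" for k
    proof -
      have "(LINT x|lborel. (indicator {0..3} x * expo (of_int j / 3) x) * expo (of_int k / 3) x)
        = (LINT x:{0..3}|lborel. expo (of_int (j + k) / 3) x)"
        unfolding set_lebesgue_integral_def by (intro Bochner_Integration.integral_cong refl)
          (simp add: indicator_def expo_add add_divide_distrib)
      also have "\<dots> = (if k = - j then 3 else 0)"
        unfolding integral_expo_int by (simp add: eq_neg_iff_add_eq_0 add.commute)
      finally show ?thesis .
    qed
    have C: "(LINT x|lborel. (indicator {0..3} x * expo (of_int j / 3) x) * F x) = (LINT x:{0..3}|lborel. F x * expo (of_int j / 3) x)"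
      unfolding set_lebesgue_integral_def by (intro Bochner_Integration.integral_cong refl) (auto simp: indicator_def)
    from A have h1: "((\<lambda>k. of_real (c k) * (if k = - j then 3 else 0)) has_sum (LINT x:{0..3}|lborel. F x * expo (of_int j / 3) x)) UNIV"
      unfolding B C .
    have h2: "((\<lambda>k. of_real (c k) * (if k = - j then 3 else 0 :: complex)) has_sum (\<Sum>k\<in>{-j}. of_real (c k) * 3)) UNIV"
      by (rule has_sum_cong_neutral[where T="{-j}" and g="\<lambda>k. of_real (c k) * 3", THEN iffD2, OF _ _ _ has_sum_finite]) simp_all
    from has_sum_unique[OF h1 h2] show ?thesis by simp
  qed
  have "g x = 0" if "x \<in> {0..3}" for x
  proof (rule trig_orthogonal_imp_zero[OF gcont g_ends _ that])
    fix k :: int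
    have "(LINT x:{0..3}|lborel. g x * expo (of_int k / 3) x)
      = (LINT x:{0..3}|lborel. of_real (corr S x + corr S (x - 3)) * expo (of_int k / 3) x) - (LINT x:{0..3}|lborel. F x * expo (of_int k / 3) x)"
      unfolding g_def left_diff_distrib
      by (intro set_integral_diff set_integrable_continuous_Icc continuous_intros cs cs3 Fcont)
    also have "(LINT x:{0..3}|lborel. of_real (corr S x + corr S (x - 3)) * expo (of_int k / 3) x) = of_real (3 * c (- k))"
      using periodized_corr_coeff[OF S w(1), of "- k"] w(2) by (simp add: c_def)
    finally show "(LINT x:{0..3}|lborel. g x * expo (of_int k / 3) x) = 0" using coefF[of k] by simp
  qed
  then have eq: "F x = of_real (corr S x + corr S (x - 3))" if "x \<in> {0..3}" for x
    using that by (simp add: g_def)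
  have "F u = of_real (corr S u)"
  proof (cases "u \<ge> 0")
    case True
    then show ?thesis using eq[of u] z[of "u - 3"] u w by simp
  next
    case False
    then show ?thesis using eq[of "u + 3"] z[of "u + 3"] u w Fper[of u] by simp
  qed
  with Fsum[of u] show ?thesis by (simp add: c_def)
qed

section \<open>Interchange of sums and coefficient estimates for intervals\<close>

lemma has_sum_norm_le:
  fixes f :: "'a \<Rightarrow> 'b::real_normed_vector"
  assumes "(f has_sum s) A" and "\<And>F. finite F \<Longrightarrow> F \<subseteq> A \<Longrightarrow> (\<Sum>x\<in>F. norm (f x)) \<le> C"
  shows "norm s \<le> C"
proof (rule tendsto_upperbound[OF tendsto_norm[OF assms(1)[unfolded has_sum_def]]])
  show "\<forall>\<^sub>F F in finite_subsets_at_top A. norm (sum f F) \<le> C"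
    by (rule eventually_finite_subsets_at_top_weakI) (rule order_trans[OF norm_sum assms(2)])
qed simp

text \<open>Absolute summability on the product comes from summability in i and a bound on the sums
  over l that is uniform in i. The common value V lets one sum over \<open>\<Lambda>\<close> link
  two different expansions.\<close>

lemma has_sum_exchange:
  fixes c :: "'i \<Rightarrow> complex" and g :: "'i \<Rightarrow> 'l \<Rightarrow> complex"
  assumes c: "(\<lambda>i. cmod (c i)) summable_on I"
    and B: "\<And>i F. i \<in> I \<Longrightarrow> finite F \<Longrightarrow> F \<subseteq> A \<Longrightarrow> (\<Sum>l\<in>F. cmod (g i l)) \<le> B"
    and s: "\<And>l. l \<in> A \<Longrightarrow> ((\<lambda>i. c i * g i l) has_sum s l) I"
    and t: "\<And>i. i \<in> I \<Longrightarrow> (g i has_sum t i) A"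
  obtains V where "(s has_sum V) A" "((\<lambda>i. c i * t i) has_sum V) I"
proof -
  let ?f = "\<lambda>(i, l). c i * g i l"
  have gs: "(\<lambda>l. cmod (g i l)) summable_on A" if "i \<in> I" for i
    by (rule nonneg_bounded_partial_sums_imp_summable_on[where C=B])
       (auto intro!: eventually_finite_subsets_at_top_weakI B that)
  have gB: "infsum (\<lambda>l. cmod (g i l)) A \<le> B" if "i \<in> I" for i
    by (rule infsum_le_finite_sums[OF gs[OF that]]) (use B that in auto)
  have "(\<lambda>x. cmod (?f x)) summable_on I \<times> A"
  proof (rule summable_on_SigmaI)
    show "((\<lambda>l. cmod (?f (i, l))) has_sum (cmod (c i) * infsum (\<lambda>l. cmod (g i l)) A)) A" if "i \<in> I" for i
      using has_sum_cmult_right[OF has_sum_infsum[OF gs[OF that]], of "cmod (c i)"] by (simp add: norm_mult)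
    show "(\<lambda>i. cmod (c i) * infsum (\<lambda>l. cmod (g i l)) A) summable_on I"
    proof (rule summable_on_comparison_test)
      show "(\<lambda>i. cmod (c i) * B) summable_on I" by (rule summable_on_cmult_left[OF c])
      show "0 \<le> cmod (c i) * infsum (\<lambda>l. cmod (g i l)) A" for i
        by (intro mult_nonneg_nonneg infsum_nonneg) auto
      show "cmod (c i) * infsum (\<lambda>l. cmod (g i l)) A \<le> cmod (c i) * B" if "i \<in> I" for i
        by (intro mult_left_mono gB that) simp
    qed
  qed simp
  then have "?f summable_on I \<times> A" by (rule abs_summable_summable)
  then have V: "(?f has_sum infsum ?f (I \<times> A)) (I \<times> A)" by (rule has_sum_infsum)
  have "((\<lambda>i. c i * t i) has_sum infsum ?f (I \<times> A)) I"
    by (rule has_sum_SigmaD[OF V]) (use t in \<open>simp add: has_sum_cmult_right\<close>)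
  moreover have "(s has_sum infsum ?f (I \<times> A)) A"
  proof (rule has_sum_SigmaD)
    show "((\<lambda>(l, i). ?f (i, l)) has_sum infsum ?f (I \<times> A)) (A \<times> I)"
      using V by (subst (asm) has_sum_swap) (simp add: case_prod_unfold)
  qed (use s in simp)
  ultimately show ?thesis using that by blast
qed

text \<open>The map from m to |m| is injective on each sign class, whence the factor 2; the bound is
  uniform in M.\<close>

lemma finite_int_sum_inverse_squares:
  fixes M :: "int set"
  assumes "finite M"
  shows "(\<Sum>m\<in>M. 1 / (\<bar>of_int m\<bar> + 1)^2) \<le> 2 * (\<Sum>n. 1 / (real n + 1)^2)"
proof -
  have summ: "summable (\<lambda>n. 1 / (real n + 1)^2)"
    using summable_Suc_iff[of "\<lambda>n. inverse (real n ^ 2)"] inverse_power_summable[of 2, where 'a=real]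
    by (simp add: field_simps)
  let ?b = "\<lambda>m :: int. 1 / (\<bar>real_of_int m\<bar> + 1)^2"
  have half: "(\<Sum>m\<in>K. ?b m) \<le> (\<Sum>n. 1 / (real n + 1)^2)"
    if "finite K" "inj_on (\<lambda>m. nat \<bar>m\<bar>) K" for K
  proof -
    have "(\<Sum>m\<in>K. ?b m) = (\<Sum>n\<in>(\<lambda>m. nat \<bar>m\<bar>) ` K. 1 / (real n + 1)^2)"
      by (subst sum.reindex[OF that(2)]) simp
    also have "\<dots> \<le> (\<Sum>n. 1 / (real n + 1)^2)"
      by (rule sum_le_suminf[OF summ]) (use that in auto)
    finally show ?thesis .
  qed
  have "(\<Sum>m\<in>M. ?b m) = (\<Sum>m\<in>M \<inter> {0..}. ?b m) + (\<Sum>m\<in>M \<inter> {..<0}. ?b m)"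
    using assms by (subst sum.union_disjoint[symmetric]) (auto intro!: sum.cong)
  also have "\<dots> \<le> (\<Sum>n. 1 / (real n + 1)^2) + (\<Sum>n. 1 / (real n + 1)^2)"
    using assms by (intro add_mono half) (auto simp: inj_on_def)
  finally show ?thesis by simp
qed

lemma hat_Icc:
  assumes "\<xi> \<noteq> 0" "0 \<le> w"
  shows "hat {0..w} \<xi> = (1 - expo (- \<xi>) w) / (2 * of_real pi * \<i> * of_real \<xi>)"
proof -
  define c where "c = 2 * of_real pi * \<i> * of_real (- \<xi>)"
  have c0: "c \<noteq> 0" using assms(1) by (simp add: c_def)
  have "hat {0..w} \<xi> = expo (- \<xi>) w / c - expo (- \<xi>) 0 / c"
    unfolding hat_def set_lebesgue_integral_def
  proof (rule integral_FTC_atLeastAtMost)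
    show "((\<lambda>x. expo (- \<xi>) x / c) has_vector_derivative expo (- \<xi>) x) (at x within {0..w})" for x
    proof -
      have "((\<lambda>z. exp (c * z) / c) has_field_derivative exp (c * of_real x)) (at (of_real x))"
        using c0 by (auto intro!: derivative_eq_intros)
      from has_vector_derivative_real_field[OF this, of "{0..w}"] show ?thesis
        by (simp add: expo_def c_def mult_ac)
    qed
  qed (use assms in \<open>auto intro: continuous_intros\<close>)
  moreover have "c = - (2 * of_real pi * \<i> * of_real \<xi>)" by (simp add: c_def)
  ultimately show ?thesis by (simp only: divide_minus_right expo_0 diff_divide_distrib) simp
qed

lemma norm_hat_Icc_le:
  assumes "\<xi> \<noteq> 0" "0 \<le> w"
  shows "cmod (hat {0..w} \<xi>) \<le> 1 / (pi * \<bar>\<xi>\<bar>)"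
proof -
  have "cmod (hat {0..w} \<xi>) = cmod (1 - expo (- \<xi>) w) / (2 * pi * \<bar>\<xi>\<bar>)"
    by (simp add: hat_Icc[OF assms] norm_divide norm_mult)
  also have "\<dots> \<le> 2 / (2 * pi * \<bar>\<xi>\<bar>)"
    using norm_triangle_ineq4[of 1 "expo (- \<xi>) w"] by (intro divide_right_mono) auto
  finally show ?thesis by simp
qed

lemma hat_Icc_zero_le: "0 \<le> w \<Longrightarrow> cmod (hat {0..w} \<xi>) \<le> w"
  using norm_hat_le[of "{0..w}" 0 w \<xi>] by simp

text \<open>This is \<open>corr_series\<close> at u = 0, where all terms are nonnegative and the
  value is the measure of S.\<close>

lemma coeff_sum_le:
  assumes S: "S \<in> sets borel" "S \<subseteq> {0..w}" and w: "0 \<le> w" "w \<le> 3/2" and "finite F"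
  shows "(\<Sum>k\<in>F. (cmod (hat S (of_int k / 3)))^2) \<le> 3 * measure lborel S"
proof -
  have "((\<lambda>k :: int. of_real ((cmod (hat S (of_int k / 3)))^2 / 3) * expo (of_int k / 3) 0)
    has_sum of_real (corr S 0)) UNIV"
    by (rule corr_series[OF S w]) (use w in simp)
  then have "((\<lambda>k :: int. of_real ((cmod (hat S (of_int k / 3)))^2 / 3) :: complex) has_sum of_real (measure lborel S)) UNIV"
    by (simp add: corr_0)
  then have "((\<lambda>k :: int. (cmod (hat S (of_int k / 3)))^2 / 3) has_sum measure lborel S) UNIV"
    unfolding has_sum_of_real_iff .
  from has_sum_mono2[OF has_sum_finite[OF \<open>finite F\<close>] this] 
  show ?thesis by (simp add: sum_divide_distrib[symmetric])
qed

text \<open>A frequency shift by m/3 multiplies the indicator by a modulation that differs from 1 by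
  at most s = 2 pi |m| w / 3 on \<open>{0..w}\<close>. Bessel's inequality bounds the l2 distance of
  the coefficients, and pairing it with their l2 norms gives an l1 bound of order w s. The power w^2
  matters: after the division by w in \<open>trapez\<close> a factor w survives.\<close>

lemma coeff_shift_sum_le:
  fixes m :: int
  assumes w: "0 < w" "w \<le> 3/2" and "finite F"
  shows "(\<Sum>k\<in>F. \<bar>(cmod (hat {0..w} (of_int (k - m) / 3)))^2 - (cmod (hat {0..w} (of_int k / 3)))^2\<bar>)
    \<le> 5 * pi * \<bar>of_int m\<bar> * w^2"
proof (cases "m = 0")
  case False
  define a where "a k = hat {0..w} (of_int (k - m) / 3)" for k
  define b where "b k = hat {0..w} (of_int k / 3)" for k :: int
  define s where "s = 2 * pi * \<bar>of_int m\<bar> * w / 3"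
  have s: "s > 0" using False w by (simp add: s_def)
  define f where "f x = indicator {0..w} x * (expo (of_int m / 3) x - 1)" for x
  have [measurable]: "f \<in> borel_measurable borel" unfolding f_def by measurable
  have fb: "cmod (f x) \<le> s * indicator {0..w} x" for x
  proof -
    have "cmod (expo (of_int m / 3) x - 1) \<le> s" if "x \<in> {0..w}"
    proof -
      have "cmod (expo (of_int m / 3) x - 1) \<le> 2 * pi * \<bar>of_int m / 3 * x\<bar>" by (rule expo_minus_one_bound)
      also have "\<dots> \<le> s" unfolding s_def using that by (simp add: abs_mult field_simps mult_right_mono)
      finally show ?thesis .
    qed
    then show ?thesis by (simp add: f_def indicator_def norm_mult)
  qed
  have ab: "a k - b k = (LINT x:{0..3}|lborel. f x * expo (- (of_int k / 3)) x)" for k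
  proof -
    have "a k - b k = (LINT x:{0..w}|lborel. expo (- (of_int (k - m) / 3)) x - expo (- (of_int k / 3)) x)"
      unfolding a_def b_def hat_def
      by (rule set_integral_diff(2)[symmetric]) (intro set_integrable_expo[of _ 0 w]; simp)+
    also have "\<dots> = (LINT x:{0..3}|lborel. f x * expo (- (of_int k / 3)) x)"
      unfolding set_lebesgue_integral_def
    proof (intro Bochner_Integration.integral_cong refl)
      fix x
      have "expo (- (of_int (k - m) / 3)) x = expo (of_int m / 3) x * expo (- (of_int k / 3)) x"
        unfolding expo_add[symmetric] by (rule arg_cong[of _ _ "\<lambda>l. expo l x"]) (simp add: field_simps)
      then show "indicator {0..w} x *\<^sub>R (expo (- (of_int (k - m) / 3)) x - expo (- (of_int k / 3)) x)
        = indicator {0..3} x *\<^sub>R (f x * expo (- (of_int k / 3)) x)"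
        using w by (auto simp: f_def indicator_def left_diff_distrib)
    qed
    finally show ?thesis .
  qed
  have "(\<Sum>k\<in>F. (cmod (a k - b k))^2) \<le> 3 * (LINT x:{0..3}|lborel. (cmod (f x))^2)"
    unfolding ab by (rule bessel_expo[OF _ _ \<open>finite F\<close>, of _ s])
      (auto intro: order_trans[OF fb] simp: s less_imp_le indicator_def)
  also have "(LINT x:{0..3}|lborel. (cmod (f x))^2) \<le> (LINT x:{0..w}|lborel. s^2)"
    unfolding set_lebesgue_integral_def
  proof (rule integral_mono_AE')
    show "integrable lborel (\<lambda>x. indicator {0..w} x *\<^sub>R s\<^sup>2)"
      by (intro integrable_scaleR_left integrable_real_indicator) (auto simp: emeasure_lborel_Icc_eq)
    show "AE x in lborel. indicator {0..3} x *\<^sub>R (cmod (f x))\<^sup>2 \<le> indicator {0..w} x *\<^sub>R s\<^sup>2"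
    proof (rule AE_I2)
      fix x
      have "(cmod (f x))^2 \<le> (s * indicator {0..w} x)^2" by (intro power_mono fb) simp
      then show "indicator {0..3} x *\<^sub>R (cmod (f x))\<^sup>2 \<le> indicator {0..w} x *\<^sub>R s\<^sup>2"
        by (auto simp: indicator_def split: if_splits)
    qed
  qed simp
  also have "(LINT x:{0..w}|lborel. s^2) = w * s^2" using w by (simp add: set_lebesgue_integral_def)
  finally have d: "(\<Sum>k\<in>F. (cmod (a k - b k))^2) \<le> 3 * (w * s^2)" by simp
  have Sb: "(\<Sum>k\<in>F. (cmod (b k))^2) \<le> 3 * w"
    unfolding b_def using coeff_sum_le[of "{0..w}" w F] w \<open>finite F\<close> by simp
  have Sa: "(\<Sum>k\<in>F. (cmod (a k))^2) \<le> 3 * w"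
  proof -
    have "(\<Sum>k\<in>F. (cmod (a k))^2) = (\<Sum>k\<in>(\<lambda>k. k - m) ` F. (cmod (b k))^2)"
      by (subst sum.reindex) (auto simp: a_def b_def inj_on_def)
    then show ?thesis unfolding b_def using coeff_sum_le[of "{0..w}" w "(\<lambda>k. k - m) ` F"] w \<open>finite F\<close> by simp
  qed
  \<comment> \<open>The inequality between arithmetic and geometric means, weighted by s: summed
    over k, the three terms are then all of order w s.\<close>
  have ptw: "\<bar>(cmod (a k))^2 - (cmod (b k))^2\<bar> \<le> (cmod (a k - b k))^2 / (2 * s) + s * (cmod (a k))^2 + s * (cmod (b k))^2" for k
  proof -
    define d e where "d = cmod (a k - b k)" and "e = cmod (a k) + cmod (b k)"
    have "\<bar>(cmod (a k))^2 - (cmod (b k))^2\<bar> = \<bar>cmod (a k) - cmod (b k)\<bar> * e"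
      by (simp add: e_def power2_eq_square abs_mult square_diff_square_factored flip: abs_mult)
         (simp add: abs_mult mult.commute)
    also have "\<dots> \<le> d * e" unfolding d_def e_def by (intro mult_right_mono norm_triangle_ineq3) auto
    also have "d * e \<le> d^2 / (2 * s) + s * e^2 / 2"
    proof -
      have "0 \<le> (d - s * e)^2" by simp
      then have "2 * s * (d * e) \<le> d^2 + s^2 * e^2" by (simp add: power2_eq_square algebra_simps)
      then show ?thesis using s by (simp add: field_simps power2_eq_square)
    qed
    also have "e^2 \<le> 2 * (cmod (a k))^2 + 2 * (cmod (b k))^2"
      unfolding e_def using zero_le_power2[of "cmod (a k) - cmod (b k)"] by (simp add: power2_eq_square algebra_simps)
    finally show ?thesis using s by (simp add: d_def distrib_left add_divide_distrib)
  qed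
  have "(\<Sum>k\<in>F. \<bar>(cmod (a k))^2 - (cmod (b k))^2\<bar>)
     \<le> (\<Sum>k\<in>F. (cmod (a k - b k))^2 / (2 * s) + s * (cmod (a k))^2 + s * (cmod (b k))^2)"
    by (intro sum_mono ptw)
  also have "\<dots> = (\<Sum>k\<in>F. (cmod (a k - b k))^2) / (2 * s) + s * (\<Sum>k\<in>F. (cmod (a k))^2) + s * (\<Sum>k\<in>F. (cmod (b k))^2)"
    by (simp add: sum.distrib sum_divide_distrib sum_distrib_left)
  also have "\<dots> \<le> 3 * (w * s^2) / (2 * s) + s * (3 * w) + s * (3 * w)"
    using s d Sa Sb by (intro add_mono divide_right_mono mult_left_mono) auto
  also have "\<dots> = 15/2 * w * s" using s by (simp add: field_simps power2_eq_square)
  also have "\<dots> = 5 * pi * \<bar>of_int m\<bar> * w^2" by (simp add: s_def power2_eq_square)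
  finally show ?thesis by (simp add: a_def b_def)
qed simp

section \<open>Poisson summation over a spectrum\<close>

text \<open>The assumption \<open>frame\<close> is all that is used of a spectrum of \<open>E\<close>: it is Parseval's identity
  for the functions \<open>expo x\<close> on \<open>E\<close>.\<close>

locale spectral_tile =
  fixes E \<Lambda> :: "real set" and L :: real
  assumes E_borel: "E \<in> sets borel" and E_sub: "E \<subseteq> {0..L}" and L: "L < 3/2"
    and E_measure: "measure lborel E = 1"
    and frame: "\<And>x. ((\<lambda>l. (cmod (hat E (l - x)))^2) has_sum 1) \<Lambda>"
begin

lemma E_sub': "E \<subseteq> {0..3/2}"
  using E_sub L by force

lemma frame_sum_le:
  assumes "finite F" "F \<subseteq> \<Lambda>" shows "(\<Sum>l\<in>F. (cmod (hat E (l - x)))^2) \<le> 1"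
  using has_sum_mono2[OF has_sum_finite[OF assms(1)] frame assms(2)] by simp

text \<open>With pi < 4, a frequency of size at most 1/40 changes the exponential by at most 2 * 4 *
  (1/40) * (3/2) < 1/2 on \<open>{0..3/2}\<close>. Together with \<open>frame\<close> this limits
  the number of points of \<open>\<Lambda>\<close> near a given frequency, as each contributes at
  least 1/4.\<close>

lemma hat_E_lower:
  assumes "\<bar>\<xi>\<bar> \<le> 1/40" shows "1/4 \<le> (cmod (hat E \<xi>))^2"
proof -
  have fm: "E \<in> fmeasurable lborel" by (rule fmeasurable_Icc_subset[OF E_borel E_sub])
  have i1: "set_integrable lborel E (\<lambda>x. 1 :: complex)"
    using set_integrable_expo[OF E_borel E_sub, of 0] by (simp add: expo_def[abs_def])
  have "1 - hat E \<xi> = (LINT x:E|lborel. 1 - expo (- \<xi>) x)"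
    unfolding hat_def using fm E_measure
    by (subst set_integral_diff(2)[OF i1 set_integrable_expo[OF E_borel E_sub]])
       (use fm in \<open>auto simp: set_integral_const fmeasurable_def scaleR_conv_of_real\<close>)
  also have "cmod \<dots> \<le> (LINT x:E|lborel. cmod (1 - expo (- \<xi>) x))"
    by (intro set_integral_norm_bound set_integral_diff(1) i1 set_integrable_expo[OF E_borel E_sub])
  also have "\<dots> \<le> (LINT x:E|lborel. 1/2)"
  proof (rule set_integral_mono)
    show "set_integrable lborel E (\<lambda>x. cmod (1 - expo (- \<xi>) x))"
      by (intro set_integrable_norm set_integral_diff(1) i1 set_integrable_expo[OF E_borel E_sub])
    show "set_integrable lborel E (\<lambda>x. 1/2 :: real)"
      using set_integrable_norm[OF i1] by (simp add: set_integrable_def)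
    fix x assume "x \<in> E"
    then have x: "0 \<le> x" "x \<le> 3/2" using E_sub' by auto
    have "pi * (\<bar>\<xi>\<bar> * x) \<le> 4 * (1/40 * (3/2))"
      using x assms pi_less_4 by (intro mult_mono) auto
    moreover have "cmod (1 - expo (- \<xi>) x) \<le> 2 * pi * \<bar>- \<xi> * x\<bar>"
      using expo_minus_one_bound[of "- \<xi>" x] by (simp add: norm_minus_commute)
    ultimately show "cmod (1 - expo (- \<xi>) x) \<le> 1/2" using x by (simp add: abs_mult)
  qed
  also have "\<dots> = 1/2" using E_measure fm by (simp add: set_lebesgue_integral_def fmeasurable_def)
  finally have "1/2 \<le> cmod (hat E \<xi>)"
    using norm_triangle_ineq2[of 1 "hat E \<xi>"] norm_triangle_ineq2[of 1 "1 - hat E \<xi>"] by simp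
  then have "(1/2)^2 \<le> (cmod (hat E \<xi>))^2" by (intro power_mono) auto
  then show ?thesis by (simp add: power2_eq_square)
qed

text \<open>At most four points of \<open>\<Lambda>\<close> lie within 1/40 of any frequency, and
  the squared transform of an interval decays like the inverse square of the distance; a grid of
  spacing 1/20 combines the two. The bound is independent of x, which later makes the defect a
  bounded sequence.\<close>

lemma interval_sum_bounded:
  assumes "0 \<le> w"
  obtains B where "\<And>x F. finite F \<Longrightarrow> F \<subseteq> \<Lambda> \<Longrightarrow> (\<Sum>l\<in>F. (cmod (hat {0..w} (l - x)))^2) \<le> B"
proof -
  \<comment> \<open>The summand w^2 serves the grid point 0. For m >= 1 the distance is at least
    m/20 - 1/40 >= (m + 1)/80, which accounts for 6400 = 80^2.\<close>
  define K where "K = w^2 + 6400"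
  define G where "G \<xi> = (cmod (hat {0..w} \<xi>))^2" for \<xi>
  define r where "r \<xi> = round (20 * \<xi>)" for \<xi> :: real
  have K0: "K \<ge> 0" by (simp add: K_def)
  have close: "\<bar>\<xi> - of_int (r \<xi>) / 20\<bar> \<le> 1/40" for \<xi>
    using of_int_round_abs_le[of "20 * \<xi>"] by (auto simp: r_def abs_if field_simps split: if_splits)
  have G: "G \<xi> \<le> K / (\<bar>of_int (r \<xi>)\<bar> + 1)^2" for \<xi>
  proof (cases "r \<xi> = 0")
    case True
    have "G \<xi> \<le> w^2" unfolding G_def by (intro power_mono hat_Icc_zero_le assms) simp
    with True show ?thesis by (simp add: K_def)
  next
    case False
    define m where "m = \<bar>real_of_int (r \<xi>)\<bar>"
    have m: "m \<ge> 1" using False by (simp add: m_def)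
    have xi: "(m + 1) / 80 \<le> \<bar>\<xi>\<bar>" using close[of \<xi>] m unfolding m_def by (simp add: field_simps abs_if split: if_splits)
    have "\<xi> \<noteq> 0" using xi m by auto
    then have "G \<xi> \<le> (1 / (pi * \<bar>\<xi>\<bar>))^2" unfolding G_def by (intro power_mono norm_hat_Icc_le assms) auto
    also have "\<dots> \<le> (1 / (1 * ((m + 1) / 80)))^2"
      using xi m pi_gt3 by (intro power_mono divide_left_mono mult_mono mult_pos_pos) auto
    also have "\<dots> = 6400 / (m + 1)^2" by (simp add: power_divide)
    also have "\<dots> \<le> K / (m + 1)^2" by (intro divide_right_mono) (auto simp: K_def)
    finally show ?thesis by (simp add: m_def)
  qed
  show ?thesis
  proof (rule that)
    fix x F assume F: "finite F" "F \<subseteq> \<Lambda>"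
    define M where "M = (\<lambda>l. r (l - x)) ` F"
    have "finite M" using F by (simp add: M_def)
    let ?b = "\<lambda>m :: int. 1 / (\<bar>of_int m\<bar> + 1 :: real)^2"
    let ?g = "\<lambda>l m. (cmod (hat E (l - (x + of_int m / 20))))^2"
    \<comment> \<open>Each l is charged to its nearest grid point, one term of a nonnegative sum.
      Exchanging the sums then allows \<open>frame_sum_le\<close> at every grid point.\<close>
    have "G (l - x) \<le> (\<Sum>m\<in>M. 4 * K * ?b m * ?g l m)" if "l \<in> F" for l
    proof -
      let ?m = "r (l - x)"
      have "1/4 \<le> ?g l ?m" using hat_E_lower[OF close[of "l - x"]] by (simp add: diff_diff_eq)
      then have "K * ?b ?m * 1 \<le> K * ?b ?m * (4 * ?g l ?m)"
        using K0 by (intro mult_left_mono) auto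
      then have "G (l - x) \<le> 4 * K * ?b ?m * ?g l ?m" using G[of "l - x"] by (simp add: mult_ac)
      also have "\<dots> \<le> (\<Sum>m\<in>M. 4 * K * ?b m * ?g l m)"
        using that K0 \<open>finite M\<close> by (intro member_le_sum) (auto simp: M_def)
      finally show ?thesis .
    qed
    then have "(\<Sum>l\<in>F. G (l - x)) \<le> (\<Sum>l\<in>F. \<Sum>m\<in>M. 4 * K * ?b m * ?g l m)"
      by (rule sum_mono)
    also have "\<dots> = (\<Sum>m\<in>M. 4 * K * ?b m * (\<Sum>l\<in>F. ?g l m))"
      by (subst sum.swap) (simp add: sum_distrib_left)
    also have "\<dots> \<le> (\<Sum>m\<in>M. 4 * K * ?b m * 1)"
      using K0 by (intro sum_mono mult_left_mono frame_sum_le F) auto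
    also have "\<dots> = 4 * K * (\<Sum>m\<in>M. ?b m)" by (simp add: sum_distrib_left)
    also have "\<dots> \<le> 4 * K * (2 * (\<Sum>n. 1 / (real n + 1)^2))"
      using K0 by (intro mult_left_mono finite_int_sum_inverse_squares \<open>finite M\<close>) auto
    finally show "(\<Sum>l\<in>F. (cmod (hat {0..w} (l - x)))^2) \<le> 4 * K * (2 * (\<Sum>n. 1 / (real n + 1)^2))"
      by (simp add: G_def)
  qed
qed

end

text \<open>The Fourier coefficients of the trapezoid that equals 1 on \<open>{-w..w}\<close> and vanishes outside
  \<open>{-2*w..2*w}\<close>.\<close>

definition trapez :: "real \<Rightarrow> int \<Rightarrow> real" where
  "trapez w k = ((cmod (hat {0..2*w} (of_int k / 3)))^2 - (cmod (hat {0..w} (of_int k / 3)))^2) / (3 * w)"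

text \<open>The wider of the two tents has width parameter 2*w, so its expansion holds up to 3 -
  2*w, which is at least 5/2.\<close>

lemma trapez_series:
  assumes w: "0 < w" "w \<le> 1/4" and u: "\<bar>u\<bar> \<le> 5/2"
  shows "((\<lambda>k. of_real (trapez w k) * expo (of_int k / 3) u) has_sum of_real ((corr {0..2*w} u - corr {0..w} u) / w)) UNIV"
proof -
  define c where "c v k = (cmod (hat {0..v} (of_int k / 3)))^2 / 3" for v and k :: int
  have "((\<lambda>k. of_real (1 / w) * (of_real (c (2*w) k) * expo (of_int k / 3) u) + of_real (- 1 / w) * (of_real (c w k) * expo (of_int k / 3) u))
    has_sum (of_real (1 / w) * of_real (corr {0..2*w} u) + of_real (- 1 / w) * of_real (corr {0..w} u))) UNIV"
    unfolding c_def by (intro has_sum_cmult_right has_sum_add corr_series) (use w u in auto)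
  moreover have "of_real (1 / w) * (of_real (c (2*w) k) * expo (of_int k / 3) u) + of_real (- 1 / w) * (of_real (c w k) * expo (of_int k / 3) u)
      = of_real (trapez w k) * expo (of_int k / 3) u" for k
  proof -
    have "trapez w k = 1 / w * c (2*w) k + - 1 / w * c w k"
      using w by (simp add: trapez_def c_def diff_divide_distrib)
    then show ?thesis by (simp only: of_real_add of_real_mult distrib_right mult.assoc)
  qed
  moreover have "of_real (1 / w) * of_real (corr {0..2*w} u) + of_real (- 1 / w) * of_real (corr {0..w} u)
    = (of_real ((corr {0..2*w} u - corr {0..w} u) / w) :: complex)"
    unfolding of_real_mult[symmetric] of_real_add[symmetric] by (simp add: diff_divide_distrib)
  ultimately show ?thesis by simp
qed

lemma corr_trapezoid:
  assumes "0 < w" "\<bar>u\<bar> \<le> w" shows "(corr {0..2*w} u - corr {0..w} u) / w = 1"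
  using assms by (simp add: corr_Icc)

text \<open>The constant is (3 * 2w + 3 * w) / (3 * w), from \<open>coeff_sum_le\<close> for both
  intervals; it does not grow as the trapezoid narrows.\<close>

lemma trapez_abs_sum_le:
  assumes w: "0 < w" "w \<le> 1/4" and "finite F"
  shows "(\<Sum>k\<in>F. \<bar>trapez w k\<bar>) \<le> 3"
proof -
  have "(\<Sum>k\<in>F. \<bar>trapez w k\<bar>) \<le> (\<Sum>k\<in>F. ((cmod (hat {0..2*w} (of_int k / 3)))^2 + (cmod (hat {0..w} (of_int k / 3)))^2) / (3 * w))"
  proof (rule sum_mono)
    fix k
    have "\<bar>a - b\<bar> \<le> a + b" if "0 \<le> a" "0 \<le> b" for a b :: real using that by linarith
    then show "\<bar>trapez w k\<bar> \<le> ((cmod (hat {0..2*w} (of_int k / 3)))^2 + (cmod (hat {0..w} (of_int k / 3)))^2) / (3 * w)"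
      unfolding trapez_def abs_divide using w by (simp add: divide_right_mono)
  qed
  also have "\<dots> = ((\<Sum>k\<in>F. (cmod (hat {0..2*w} (of_int k / 3)))^2) + (\<Sum>k\<in>F. (cmod (hat {0..w} (of_int k / 3)))^2)) / (3 * w)"
    by (simp only: sum.distrib sum_divide_distrib[symmetric])
  also have "\<dots> \<le> (3 * (2 * w) + 3 * w) / (3 * w)"
    using coeff_sum_le[of "{0..2*w}" "2*w" F] coeff_sum_le[of "{0..w}" w F] w \<open>finite F\<close>
    by (intro divide_right_mono add_mono) auto
  also have "\<dots> = 3" using w by simp
  finally show ?thesis .
qed

text \<open>The bound 6 holds for all shifts and will handle the far ones; the second bound makes
  bounded shifts harmless for small w. The factor 40 exceeds 25 pi / 3.\<close>

lemma trapez_shift_sum_le: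
  assumes w: "0 < w" "w \<le> 1/4" and "finite F"
  shows "(\<Sum>k\<in>F. \<bar>trapez w (k - m) - trapez w k\<bar>) \<le> min 6 (40 * \<bar>of_int m\<bar> * w)"
proof -
  have "(\<Sum>k\<in>F. \<bar>trapez w (k - m) - trapez w k\<bar>) \<le> (\<Sum>k\<in>F. \<bar>trapez w (k - m)\<bar> + \<bar>trapez w k\<bar>)"
    by (intro sum_mono) auto
  also have "\<dots> = (\<Sum>k\<in>(\<lambda>k. k - m) ` F. \<bar>trapez w k\<bar>) + (\<Sum>k\<in>F. \<bar>trapez w k\<bar>)"
    by (subst sum.reindex) (auto simp: sum.distrib inj_on_def)
  also have "\<dots> \<le> 3 + 3" by (intro add_mono trapez_abs_sum_le w) (use \<open>finite F\<close> in auto)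
  finally have 1: "(\<Sum>k\<in>F. \<bar>trapez w (k - m) - trapez w k\<bar>) \<le> 6" by simp
  define d where "d v k = \<bar>(cmod (hat {0..v} (of_int (k - m) / 3)))^2 - (cmod (hat {0..v} (of_int k / 3)))^2\<bar>" for v k
  have "\<bar>trapez w (k - m) - trapez w k\<bar> \<le> (d (2*w) k + d w k) / (3 * w)" for k
  proof -
    have "\<bar>(a - b) / (3 * w) - (a' - b') / (3 * w)\<bar> \<le> (\<bar>a - a'\<bar> + \<bar>b - b'\<bar>) / (3 * w)" for a b a' b' :: real
    proof -
      have "\<bar>(a - b) / (3 * w) - (a' - b') / (3 * w)\<bar> = \<bar>(a - b) - (a' - b')\<bar> / (3 * w)"
        using w by (simp add: diff_divide_distrib[symmetric] abs_divide)
      also have "\<dots> \<le> (\<bar>a - a'\<bar> + \<bar>b - b'\<bar>) / (3 * w)" using w by (intro divide_right_mono) auto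
      finally show ?thesis .
    qed
    then show ?thesis unfolding trapez_def d_def by blast
  qed
  then have "(\<Sum>k\<in>F. \<bar>trapez w (k - m) - trapez w k\<bar>) \<le> (\<Sum>k\<in>F. (d (2*w) k + d w k) / (3 * w))"
    by (intro sum_mono)
  also have "\<dots> = ((\<Sum>k\<in>F. d (2*w) k) + (\<Sum>k\<in>F. d w k)) / (3 * w)"
    by (simp only: sum.distrib sum_divide_distrib[symmetric])
  also have "\<dots> \<le> (5 * pi * \<bar>of_int m\<bar> * (2*w)^2 + 5 * pi * \<bar>of_int m\<bar> * w^2) / (3 * w)"
    unfolding d_def using w by (intro divide_right_mono add_mono coeff_shift_sum_le \<open>finite F\<close>) auto
  also have "\<dots> = (25 / 3 * pi) * (\<bar>of_int m\<bar> * w)" using w by (simp add: field_simps power2_eq_square)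
  also have "\<dots> \<le> 40 * (\<bar>of_int m\<bar> * w)"
    using w pi_less_4 by (intro mult_right_mono) auto
  finally show ?thesis using 1 by simp
qed

lemma (in spectral_tile) weighted_sum_exists:
  assumes "0 \<le> w"
  shows "((\<lambda>l. of_real ((cmod (hat {0..w} (l - x)))^2) * expo (- u0) l)
    has_sum infsum (\<lambda>l. of_real ((cmod (hat {0..w} (l - x)))^2) * expo (- u0) l) \<Lambda>) \<Lambda>"
proof -
  obtain B where B: "\<And>x F. finite F \<Longrightarrow> F \<subseteq> \<Lambda> \<Longrightarrow> (\<Sum>l\<in>F. (cmod (hat {0..w} (l - x)))^2) \<le> B"
    using interval_sum_bounded[OF assms] by blast
  have "(\<lambda>l. cmod (of_real ((cmod (hat {0..w} (l - x)))^2) * expo (- u0) l)) summable_on \<Lambda>"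
    by (rule nonneg_bounded_partial_sums_imp_summable_on[where C=B])
       (auto simp: norm_mult norm_power intro!: eventually_finite_subsets_at_top_weakI B)
  then show ?thesis by (intro has_sum_infsum[OF abs_summable_summable])
qed

text \<open>Multiplying \<open>corr E\<close> by a small translated tent in two ways gives a convolution identity
  for the defect \<open>\<psi>\<close> in Poisson summation over \<open>\<Lambda>\<close>.\<close>

lemma (in spectral_tile) defect_convolution:
  fixes w u0 :: real and n :: int
  defines "T \<equiv> (\<lambda>n :: int. infsum (\<lambda>l. of_real ((cmod (hat {0..w} (l - of_int n / 3)))^2) * expo (- u0) l) \<Lambda>)"
  defines "\<psi> \<equiv> (\<lambda>n :: int. T n - of_real (corr {0..w} (- u0)) * expo (- u0) (of_int n / 3))"
  assumes w: "0 < w" "w \<le> 1/4" and u0: "\<bar>u0\<bar> \<le> 1"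
  shows "((\<lambda>m :: int. of_real ((cmod (hat E (of_int m / 3)))^2 / 3) * expo (of_int m / 3) u0 * \<psi> (n + m)) has_sum 0) UNIV"
proof -
  define a where "a m = of_real ((cmod (hat E (of_int m / 3)))^2 / 3) * expo (of_int m / 3) u0" for m :: int
  define b where "b k = of_real ((cmod (hat {0..w} (of_int k / 3)))^2 / 3) * expo (of_int k / 3) (- u0)" for k :: int
  \<comment> \<open>The Fourier transform of a product of the tent with a translate of
    \<open>corr E\<close>. Expanding \<open>corr E\<close> gives \<open>aJ\<close>, expanding the
    tent gives \<open>bJ\<close>.\<close>
  define J where "J \<xi> = (LINT u|lborel. of_real (corr {0..w} u) * expo (- \<xi>) u * of_real (corr E (u + u0)))" for \<xi>
  have W: "{0..w} \<in> sets borel" by simp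
  have cmE [measurable]: "corr E \<in> borel_measurable borel" by (rule borel_measurable_corr[OF E_borel E_sub])
  have cmW [measurable]: "corr {0..w} \<in> borel_measurable borel" by (rule borel_measurable_corr[OF W order_refl])
  have a_sum: "(\<lambda>m. cmod (a m)) summable_on UNIV"
    using corr_coeff_summable[OF E_borel order_trans[OF E_sub']] by (simp add: a_def norm_mult norm_power)
  have b_sum: "(\<lambda>k. cmod (b k)) summable_on UNIV"
    using corr_coeff_summable[OF W] w by (simp add: b_def norm_mult norm_power)
  have aJ: "((\<lambda>m. a m * of_real ((cmod (hat {0..w} (\<xi> - of_int m / 3)))^2)) has_sum J \<xi>) UNIV" for \<xi>
  proof -
    have "((\<lambda>m. a m * (LINT u|lborel. (of_real (corr {0..w} u) * expo (- \<xi>) u) * expo (of_int m / 3) u)) has_sum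
        (LINT u|lborel. (of_real (corr {0..w} u) * expo (- \<xi>) u) * of_real (corr E (u + u0)))) UNIV"
    proof (rule integral_expo_series[OF a_sum])
      show "integrable lborel (\<lambda>u. of_real (corr {0..w} u) * expo (- \<xi>) u)"
        by (rule integrable_corr_mult[OF W order_refl]) auto
      fix u assume "of_real (corr {0..w} u) * expo (- \<xi>) u \<noteq> 0"
      then have "corr {0..w} u \<noteq> 0" by auto
      then have "\<bar>u\<bar> < w" using corr_eq_0[of "{0..w}" w u] by (meson not_less order_refl)
      \<comment> \<open>On the support of the tent |u + u0| <= 1/4 + 1, inside the range of validity
        of the series of \<open>corr E\<close>. In \<open>bJ\<close> the argument is at most 3/2 + 1
        <= 3 - w, inside the range for the tent.\<close>
      then have "\<bar>u + u0\<bar> \<le> 3 - 3/2" using w u0 by linarith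
      then have "((\<lambda>k :: int. of_real ((cmod (hat E (of_int k / 3)))^2 / 3) * expo (of_int k / 3) (u + u0))
          has_sum of_real (corr E (u + u0))) UNIV"
        by (intro corr_series[OF E_borel E_sub']) auto
      then show "((\<lambda>m. a m * expo (of_int m / 3) u) has_sum of_real (corr E (u + u0))) UNIV"
        by (simp add: a_def expo_add_right mult_ac)
    qed measurable
    moreover have "(LINT u|lborel. (of_real (corr {0..w} u) * expo (- \<xi>) u) * expo (of_int m / 3) u)
        = of_real ((cmod (hat {0..w} (\<xi> - of_int m / 3)))^2)" for m :: int
    proof -
      have "expo (- \<xi>) u * expo (of_int m / 3) u = expo (- (\<xi> - of_int m / 3)) u" for u
        by (simp add: expo_add[symmetric])
      then show ?thesis unfolding corr_FT[OF W order_refl, symmetric] by (simp add: mult.assoc)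
    qed
    ultimately show ?thesis by (simp add: J_def)
  qed
  have bJ: "((\<lambda>k. b k * (expo \<xi> u0 * of_real ((cmod (hat E (\<xi> - of_int k / 3)))^2))) has_sum J \<xi>) UNIV" for \<xi>
  proof -
    have "((\<lambda>k. b k * (LINT v|lborel. (of_real (corr E v) * expo (- \<xi>) v) * expo (of_int k / 3) v)) has_sum
        (LINT v|lborel. (of_real (corr E v) * expo (- \<xi>) v) * of_real (corr {0..w} (v - u0)))) UNIV"
    proof (rule integral_expo_series[OF b_sum])
      show "integrable lborel (\<lambda>u. of_real (corr E u) * expo (- \<xi>) u)"
        by (rule integrable_corr_mult[OF E_borel E_sub]) auto
      fix v assume "of_real (corr E v) * expo (- \<xi>) v \<noteq> 0"
      then have "corr E v \<noteq> 0" by auto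
      then have "\<bar>v\<bar> < 3/2" using corr_eq_0[OF E_sub', of v] by (meson not_less)
      then have "((\<lambda>k :: int. of_real ((cmod (hat {0..w} (of_int k / 3)))^2 / 3) * expo (of_int k / 3) (v + (- u0)))
          has_sum of_real (corr {0..w} (v + (- u0)))) UNIV"
        using w u0 by (intro corr_series[OF W order_refl]) auto
      then show "((\<lambda>k. b k * expo (of_int k / 3) v) has_sum of_real (corr {0..w} (v - u0))) UNIV"
        unfolding expo_add_right b_def by (simp add: mult_ac)
    qed measurable
    moreover have "(LINT v|lborel. (of_real (corr E v) * expo (- \<xi>) v) * expo (of_int k / 3) v)
        = of_real ((cmod (hat E (\<xi> - of_int k / 3)))^2)" for k :: int
    proof -
      have "expo (- \<xi>) u * expo (of_int k / 3) u = expo (- (\<xi> - of_int k / 3)) u" for u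
        by (simp add: expo_add[symmetric])
      then show ?thesis unfolding corr_FT[OF E_borel E_sub, symmetric] by (simp add: mult.assoc)
    qed
    moreover have "(LINT v|lborel. (of_real (corr E v) * expo (- \<xi>) v) * of_real (corr {0..w} (v - u0))) = expo (- \<xi>) u0 * J \<xi>"
    proof -
      have "(LINT v|lborel. (of_real (corr E v) * expo (- \<xi>) v) * of_real (corr {0..w} (v - u0)))
        = (LINT u|lborel. (of_real (corr E (u0 + 1 * u)) * expo (- \<xi>) (u0 + 1 * u)) * of_real (corr {0..w} ((u0 + 1 * u) - u0)))"
        using lborel_integral_real_affine[of 1 "\<lambda>v. (of_real (corr E v) * expo (- \<xi>) v) * of_real (corr {0..w} (v - u0))" u0] by simp
      also have "\<dots> = (LINT u|lborel. expo (- \<xi>) u0 * (of_real (corr {0..w} u) * expo (- \<xi>) u * of_real (corr E (u + u0))))"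
        by (intro Bochner_Integration.integral_cong refl) (simp add: expo_add_right add.commute)
      also have "\<dots> = expo (- \<xi>) u0 * J \<xi>" by (simp add: J_def)
      finally show ?thesis .
    qed
    ultimately have "((\<lambda>k. b k * of_real ((cmod (hat E (\<xi> - of_int k / 3)))^2)) has_sum expo (- \<xi>) u0 * J \<xi>) UNIV"
      by simp
    from has_sum_cmult_right[OF this, of "expo \<xi> u0"] show ?thesis
      by (simp add: expo_minus mult.assoc[symmetric]) (simp add: mult_ac)
  qed
  have a0: "(a has_sum of_real (corr E u0)) UNIV"
    unfolding a_def using w u0 by (intro corr_series[OF E_borel E_sub']) auto
  have a00: "((\<lambda>m :: int. of_real ((cmod (hat E (of_int m / 3)))^2 / 3) * expo (of_int m / 3) 0) has_sum of_real (corr E 0)) UNIV"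
    by (intro corr_series[OF E_borel E_sub']) auto
  have b0: "(b has_sum of_real (corr {0..w} (- u0))) UNIV"
    unfolding b_def using w u0 by (intro corr_series[OF W order_refl]) auto
  define s where "s l = expo (- u0) l * J (l - of_int n / 3)" for l
  obtain B where B: "\<And>x F. finite F \<Longrightarrow> F \<subseteq> \<Lambda> \<Longrightarrow> (\<Sum>l\<in>F. (cmod (hat {0..w} (l - x)))^2) \<le> B"
    using interval_sum_bounded[of w] w by (metis less_imp_le)
  \<comment> \<open>Summing the expansion \<open>aJ\<close> over \<open>\<Lambda>\<close> produces
    the convolution of \<open>a\<close> with \<open>T\<close>.\<close>
  obtain V where V: "(s has_sum V) \<Lambda>" "((\<lambda>m. a m * T (n + m)) has_sum V) UNIV"
  proof (rule has_sum_exchange[OF a_sum])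
    fix m :: int
    show "(\<Sum>l\<in>F. cmod (of_real ((cmod (hat {0..w} (l - of_int (n + m) / 3)))^2) * expo (- u0) l)) \<le> B"
      if "finite F" "F \<subseteq> \<Lambda>" for F
      using B[OF that] by (simp add: norm_mult norm_power)
    show "((\<lambda>l. of_real ((cmod (hat {0..w} (l - of_int (n + m) / 3)))^2) * expo (- u0) l) has_sum T (n + m)) \<Lambda>"
      unfolding T_def using w by (intro weighted_sum_exists) simp
  next
    fix l
    have A: "((\<lambda>m. expo (- u0) l * (a m * of_real ((cmod (hat {0..w} ((l - of_int n / 3) - of_int m / 3)))^2))) has_sum expo (- u0) l * J (l - of_int n / 3)) UNIV"
      by (rule has_sum_cmult_right[OF aJ])
    have eq: "expo (- u0) l * (a m * of_real ((cmod (hat {0..w} ((l - of_int n / 3) - of_int m / 3)))^2))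
        = a m * (of_real ((cmod (hat {0..w} (l - of_int (n + m) / 3)))^2) * expo (- u0) l)" for m
      by (simp add: add_divide_distrib diff_diff_eq)
    show "((\<lambda>m. a m * (of_real ((cmod (hat {0..w} (l - of_int (n + m) / 3)))^2) * expo (- u0) l)) has_sum s l) UNIV"
      using A unfolding eq s_def .
  qed
  \<comment> \<open>With \<open>bJ\<close> each inner sum over \<open>\<Lambda>\<close> is an
    instance of \<open>frame\<close>, so the same total is found in closed form.\<close>
  obtain V' where V': "(s has_sum V') \<Lambda>" "((\<lambda>k. b k * expo (- u0) (of_int n / 3)) has_sum V') UNIV"
  proof (rule has_sum_exchange[OF b_sum])
    fix k :: int
    show "(\<Sum>l\<in>F. cmod (of_real ((cmod (hat E (l - of_int (n + k) / 3)))^2) * expo (- u0) (of_int n / 3))) \<le> 1"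
      if "finite F" "F \<subseteq> \<Lambda>" for F
      using frame_sum_le[OF that] by (simp add: norm_mult norm_power)
    have "((\<lambda>l. of_real ((cmod (hat E (l - of_int (n + k) / 3)))^2)) has_sum (of_real 1 :: complex)) \<Lambda>"
      unfolding has_sum_of_real_iff by (rule frame)
    from has_sum_cmult_left[OF this, of "expo (- u0) (of_int n / 3)"]
    show "((\<lambda>l. of_real ((cmod (hat E (l - of_int (n + k) / 3)))^2) * expo (- u0) (of_int n / 3)) has_sum expo (- u0) (of_int n / 3)) \<Lambda>"
      by simp
  next
    fix l
    have A: "((\<lambda>k. expo (- u0) l * (b k * (expo (l - of_int n / 3) u0 * of_real ((cmod (hat E ((l - of_int n / 3) - of_int k / 3)))^2)))) has_sum expo (- u0) l * J (l - of_int n / 3)) UNIV"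
      by (rule has_sum_cmult_right[OF bJ])
    have eq: "expo (- u0) l * (b k * (expo (l - of_int n / 3) u0 * of_real ((cmod (hat E ((l - of_int n / 3) - of_int k / 3)))^2)))
       = b k * (of_real ((cmod (hat E (l - of_int (n + k) / 3)))^2) * expo (- u0) (of_int n / 3))" for k
    proof -
      have "expo (- u0) l * expo (l - of_int n / 3) u0 = expo (- u0) (of_int n / 3)"
        by (simp add: expo_cis cis_mult algebra_simps)
      moreover have "l - of_int n / 3 - of_int k / 3 = l - of_int (n + k) / 3" by (simp add: add_divide_distrib)
      moreover have "x * (b k * (y * z)) = b k * (z * (x * y))" for x y z :: complex
        by (simp add: mult_ac)
      ultimately show ?thesis by (simp only:)
    qed
    show "((\<lambda>k. b k * (of_real ((cmod (hat E (l - of_int (n + k) / 3)))^2) * expo (- u0) (of_int n / 3))) has_sum s l) UNIV"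
      using A unfolding eq s_def .
  qed
  have "V = of_real (corr {0..w} (- u0)) * expo (- u0) (of_int n / 3)"
    using has_sum_unique[OF V(1) V'(1)] has_sum_unique[OF V'(2) has_sum_cmult_left[OF b0]] by simp
  note hT = V(2)[unfolded this]
  \<comment> \<open>The exponential subtracted in \<open>\<psi>\<close> has the same convolution
    with \<open>a\<close>: the modulations cancel and leave the series of \<open>corr E\<close> at
    0, whose value is 1.\<close>
  have hS: "((\<lambda>m. a m * (of_real (corr {0..w} (- u0)) * expo (- u0) (of_int (n + m) / 3))) has_sum
      of_real (corr {0..w} (- u0)) * expo (- u0) (of_int n / 3)) UNIV"
  proof -
    have eq: "a m * (of_real (corr {0..w} (- u0)) * expo (- u0) (of_int (n + m) / 3))
       = of_real (corr {0..w} (- u0)) * expo (- u0) (of_int n / 3) * (of_real ((cmod (hat E (of_int m / 3)))^2 / 3) * expo (of_int m / 3) 0)" for m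
    proof -
      have "expo (of_int m / 3) u0 * expo (- u0) (of_int (n + m) / 3) = expo (- u0) (of_int n / 3)"
        by (simp add: expo_cis cis_mult field_simps)
      then show ?thesis by (simp add: a_def mult_ac)
    qed
    from has_sum_cmult_right[OF a00, of "of_real (corr {0..w} (- u0)) * expo (- u0) (of_int n / 3)"]
    show ?thesis unfolding eq by (simp only: corr_0 E_measure of_real_1 mult_1_right)
  qed
  have "((\<lambda>m. a m * T (n + m) + - (a m * (of_real (corr {0..w} (- u0)) * expo (- u0) (of_int (n + m) / 3)))) has_sum
    (of_real (corr {0..w} (- u0)) * expo (- u0) (of_int n / 3) + - (of_real (corr {0..w} (- u0)) * expo (- u0) (of_int n / 3)))) UNIV"
    by (rule has_sum_add[OF hT has_sum_uminusI[OF hS]])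
  moreover have "a m * \<psi> (n + m) = a m * T (n + m) + - (a m * (of_real (corr {0..w} (- u0)) * expo (- u0) (of_int (n + m) / 3)))" for m
    by (simp add: \<psi>_def right_diff_distrib)
  ultimately show ?thesis unfolding a_def[symmetric] by simp
qed

text \<open>The defect reproduces itself under convolution with \<open>trapez w\<close>,
  because the trapezoid equals 1 on the support of the tent.\<close>

lemma (in spectral_tile) defect_reproducing:
  fixes w u0 :: real and n :: int
  defines "T \<equiv> (\<lambda>n :: int. infsum (\<lambda>l. of_real ((cmod (hat {0..w} (l - of_int n / 3)))^2) * expo (- u0) l) \<Lambda>)"
  defines "\<psi> \<equiv> (\<lambda>n :: int. T n - of_real (corr {0..w} (- u0)) * expo (- u0) (of_int n / 3))"
  assumes w: "0 < w" "w \<le> 1/4" and u0: "\<bar>u0\<bar> \<le> 1"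
  shows "((\<lambda>k. of_real (trapez w k) * \<psi> (n + k)) has_sum \<psi> n) UNIV"
proof -
  have W: "{0..w} \<in> sets borel" by simp
  define p :: "real \<Rightarrow> complex" where "p u = of_real ((corr {0..2*w} u - corr {0..w} u) / w)" for u
  have p1: "of_real (corr {0..w} u) * p u = of_real (corr {0..w} u)" for u
  proof (cases "\<bar>u\<bar> \<le> w")
    case True
    then show ?thesis using corr_trapezoid[OF w(1), of u] by (simp add: p_def)
  next
    case False
    then show ?thesis using corr_eq_0[of "{0..w}" w u] by simp
  qed
  have v_sum: "(\<lambda>k. cmod (of_real (trapez w k))) summable_on UNIV"
    by (rule nonneg_bounded_partial_sums_imp_summable_on[where C=3])
       (auto intro!: eventually_finite_subsets_at_top_weakI trapez_abs_sum_le w)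
  have vG: "((\<lambda>k. of_real (trapez w k) * of_real ((cmod (hat {0..w} (\<xi> - of_int k / 3)))^2)) has_sum (of_real ((cmod (hat {0..w} \<xi>))^2) :: complex)) UNIV" for \<xi>
  proof -
    have "((\<lambda>k. of_real (trapez w k) * (LINT u|lborel. (of_real (corr {0..w} u) * expo (- \<xi>) u) * expo (of_int k / 3) u)) has_sum
        (LINT u|lborel. (of_real (corr {0..w} u) * expo (- \<xi>) u) * p u)) UNIV"
    proof (rule integral_expo_series[OF v_sum])
      show i: "integrable lborel (\<lambda>u. of_real (corr {0..w} u) * expo (- \<xi>) u)"
        by (rule integrable_corr_mult[OF W order_refl]) auto
      have "(\<lambda>u. of_real (corr {0..w} u) * expo (- \<xi>) u * p u) = (\<lambda>u. of_real (corr {0..w} u) * expo (- \<xi>) u)"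
        using p1 by (simp add: fun_eq_iff mult.commute mult.left_commute)
      then show "(\<lambda>u. of_real (corr {0..w} u) * expo (- \<xi>) u * p u) \<in> borel_measurable lborel"
        using borel_measurable_integrable[OF i] by simp
      fix u assume "of_real (corr {0..w} u) * expo (- \<xi>) u \<noteq> 0"
      then have "corr {0..w} u \<noteq> 0" by auto
      then have "\<bar>u\<bar> < w" using corr_eq_0[of "{0..w}" w u] by (meson not_less order_refl)
      then show "((\<lambda>k. of_real (trapez w k) * expo (of_int k / 3) u) has_sum p u) UNIV"
        unfolding p_def using w by (intro trapez_series) auto
    qed
    moreover have "(LINT u|lborel. (of_real (corr {0..w} u) * expo (- \<xi>) u) * expo (of_int k / 3) u)
        = of_real ((cmod (hat {0..w} (\<xi> - of_int k / 3)))^2)" for k :: int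
    proof -
      have "expo (- \<xi>) u * expo (of_int k / 3) u = expo (- (\<xi> - of_int k / 3)) u" for u
        by (simp add: expo_add[symmetric])
      then show ?thesis unfolding corr_FT[OF W order_refl, symmetric] by (simp add: mult.assoc)
    qed
    moreover have "(LINT u|lborel. (of_real (corr {0..w} u) * expo (- \<xi>) u) * p u) = of_real ((cmod (hat {0..w} \<xi>))^2)"
      unfolding corr_FT[OF W order_refl, symmetric]
      by (intro Bochner_Integration.integral_cong refl) (metis mult.assoc mult.commute p1)
    ultimately show ?thesis by simp
  qed
  obtain B where B: "\<And>x F. finite F \<Longrightarrow> F \<subseteq> \<Lambda> \<Longrightarrow> (\<Sum>l\<in>F. (cmod (hat {0..w} (l - x)))^2) \<le> B"
    using interval_sum_bounded[of w] w by (metis less_imp_le)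
  have Tn: "((\<lambda>l. of_real ((cmod (hat {0..w} (l - of_int n / 3)))^2) * expo (- u0) l) has_sum T n) \<Lambda>" for n
    unfolding T_def using w by (intro weighted_sum_exists) simp
  obtain V where V: "((\<lambda>l. of_real ((cmod (hat {0..w} (l - of_int n / 3)))^2) * expo (- u0) l) has_sum V) \<Lambda>"
      "((\<lambda>k. of_real (trapez w k) * T (n + k)) has_sum V) UNIV"
  proof (rule has_sum_exchange[OF v_sum])
    fix m :: int
    show "(\<Sum>l\<in>F. cmod (of_real ((cmod (hat {0..w} (l - of_int (n + m) / 3)))^2) * expo (- u0) l)) \<le> B"
      if "finite F" "F \<subseteq> \<Lambda>" for F
      using B[OF that] by (simp add: norm_mult norm_power)
    show "((\<lambda>l. of_real ((cmod (hat {0..w} (l - of_int (n + m) / 3)))^2) * expo (- u0) l) has_sum T (n + m)) \<Lambda>"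
      by (rule Tn)
  next
    fix l
    have "((\<lambda>k. (of_real (trapez w k) * of_real ((cmod (hat {0..w} ((l - of_int n / 3) - of_int k / 3)))^2)) * expo (- u0) l) has_sum
        of_real ((cmod (hat {0..w} (l - of_int n / 3)))^2) * expo (- u0) l) UNIV"
      by (rule has_sum_cmult_left[OF vG])
    moreover have "l - of_int n / 3 - of_int m / 3 = l - of_int (n + m) / 3" for m
      by (simp add: add_divide_distrib)
    ultimately show "((\<lambda>k. of_real (trapez w k) * (of_real ((cmod (hat {0..w} (l - of_int (n + k) / 3)))^2) * expo (- u0) l)) has_sum
        of_real ((cmod (hat {0..w} (l - of_int n / 3)))^2) * expo (- u0) l) UNIV"
      by (simp add: mult.assoc)
  qed
  have hT: "((\<lambda>k. of_real (trapez w k) * T (n + k)) has_sum T n) UNIV"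
    using V(2) has_sum_unique[OF V(1) Tn] by simp
  define h where "h = of_real (corr {0..w} (- u0)) * expo (- u0) (of_int n / 3)"
  have hS: "((\<lambda>k. of_real (trapez w k) * (of_real (corr {0..w} (- u0)) * expo (- u0) (of_int (n + k) / 3))) has_sum h) UNIV"
  proof -
    have "((\<lambda>k. h * (of_real (trapez w k) * expo (of_int k / 3) (- u0))) has_sum h * p (- u0)) UNIV"
      unfolding p_def using w u0 by (intro has_sum_cmult_right trapez_series) auto
    moreover have "h * p (- u0) = h" unfolding h_def using p1[of "- u0"] by (metis mult.assoc mult.commute)
    moreover have "h * (of_real (trapez w k) * expo (of_int k / 3) (- u0)) =
        of_real (trapez w k) * (of_real (corr {0..w} (- u0)) * expo (- u0) (of_int (n + k) / 3))" for k
    proof -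
      have "expo (- u0) (of_int n / 3) * expo (of_int k / 3) (- u0) = expo (- u0) (of_int (n + k) / 3)"
        by (simp add: expo_cis cis_mult field_simps)
      then show ?thesis unfolding h_def by (metis (no_types, lifting) mult.assoc mult.left_commute)
    qed
    ultimately show ?thesis by simp
  qed
  have "((\<lambda>k. of_real (trapez w k) * T (n + k) + - (of_real (trapez w k) * (of_real (corr {0..w} (- u0)) * expo (- u0) (of_int (n + k) / 3)))) has_sum (T n + - h)) UNIV"
    by (rule has_sum_add[OF hT has_sum_uminusI[OF hS]])
  then show ?thesis by (simp add: \<psi>_def h_def right_diff_distrib)
qed

text \<open>Two sets inside an interval shorter than the sum of their measures must overlap. For x
  up to 1/2 these are S and S - x, inside an interval of length L + x < 2. For larger x, S is cut at
  x and its right part folded back by x: both pieces then lie in an interval of length max x (L - x)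
  < 1.\<close>

lemma corr_pos:
  assumes S: "S \<in> sets borel" "S \<subseteq> {0..L}" and L: "L < 3/2" and S1: "measure lborel S = 1" and x: "\<bar>x\<bar> < 1"
  shows "corr S x > 0"
proof -
  have pos: "corr S x > 0" if x: "0 \<le> x" "x < 1" for x
  proof (rule ccontr)
    assume "\<not> corr S x > 0"
    then have c0: "corr S x = 0" using corr_nonneg[of S x] by simp
    have fS: "S \<in> fmeasurable lborel" by (rule fmeasurable_Icc_subset[OF S])
    note [measurable] = S(1)
    have fc: "{y \<in> S. y + x \<in> S} \<in> fmeasurable lborel"
      by (rule fmeasurable_Icc_subset[OF corr_sets_borel[OF S(1)]]) (use S(2) in auto)
    have "\<exists>A B a b. A \<in> sets borel \<and> B \<in> sets borel \<and> A \<union> B \<subseteq> {a..b} \<and> A \<inter> B \<subseteq> {y \<in> S. y + x \<in> S} \<and>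
        a \<le> b \<and> b - a < measure lborel A + measure lborel B"
    proof (cases "x \<le> 1/2")
      case True
      have "{y. y + x \<in> S} \<in> sets borel" by measurable
      moreover have "S \<union> {y. y + x \<in> S} \<subseteq> {- x..L}" using S(2) x by force
      moreover have "- x \<le> L" 
      proof (rule ccontr)
        assume "\<not> - x \<le> L"
        then have "S = {}" using S(2) x by force
        then show False using S1 by simp
      qed
      ultimately show ?thesis
        using True L S1 measure_lborel_shift[OF S(1), of x] S(1)
        by (intro exI[of _ S] exI[of _ "{y. y + x \<in> S}"] exI[of _ "- x"] exI[of _ L]) auto
    next
      case False
      let ?A = "S \<inter> {..<x}" and ?C = "S \<inter> {x..}" and ?b = "max x (L - x)"
      let ?B = "{y. y + x \<in> ?C}"
      have sets: "?A \<in> sets borel" "?B \<in> sets borel" "?C \<in> sets borel" by measurable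
      have "?A \<in> fmeasurable lborel" "?C \<in> fmeasurable lborel"
        using S(2) by (auto intro!: fmeasurable_Icc_subset[of _ 0 L] sets)
      then have "measure lborel (?A \<union> ?C) = measure lborel ?A + measure lborel ?C"
        by (intro measure_Union) (auto simp: fmeasurable_def)
      moreover have "?A \<union> ?C = S" by auto
      ultimately have "1 = measure lborel ?A + measure lborel ?C" using S1 by simp
      moreover have "measure lborel ?B = measure lborel ?C"
        by (rule measure_lborel_shift[OF sets(3)])
      moreover have "?A \<union> ?B \<subseteq> {0..?b}" using S(2) by force
      ultimately show ?thesis
        using False L x sets
        by (intro exI[of _ ?A] exI[of _ ?B] exI[of _ 0] exI[of _ ?b]) auto
    qed
    then obtain A B a b where AB: "A \<in> sets borel" "B \<in> sets borel" "A \<union> B \<subseteq> {a..b}" "A \<inter> B \<subseteq> {y \<in> S. y + x \<in> S}"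
        "a \<le> b" "b - a < measure lborel A + measure lborel B" by blast
    have f: "A \<in> fmeasurable lborel" "B \<in> fmeasurable lborel"
      using AB(3) by (auto intro!: fmeasurable_Icc_subset[of _ a b] AB)
    have "measure lborel (A \<inter> B) \<le> corr S x"
      unfolding corr_def by (rule measure_mono_fmeasurable[OF AB(4) _ fc]) (use AB in auto)
    then have "measure lborel (A \<inter> B) = 0" using c0 measure_nonneg[of lborel "A \<inter> B"] by simp
    then have "measure lborel (A \<union> B) = measure lborel A + measure lborel B"
      using measure_Un3[OF f] by simp
    moreover have "measure lborel (A \<union> B) \<le> measure lborel {a..b}"
      by (rule measure_mono_fmeasurable[OF AB(3)]) (use AB fmeasurable_cbox[of a b] in auto)
    ultimately show False using AB(5,6) by simp
  qed
  show ?thesis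
    using pos[of x] pos[of "- x"] corr_minus[OF S(1), of x] x by (cases "x \<ge> 0") auto
qed

context spectral_tile
begin

text \<open>A local form of Wiener's Tauberian theorem: the defect is a bounded sequence that is nearly
  constant on long ranges (after modulation), and it is annihilated by convolution with a summable
  sequence of nonzero total mass \<open>corr E u0\<close>, hence it vanishes.\<close>

lemma poisson_narrow:
  assumes "\<alpha> > 0"
  obtains w0 where "w0 > 0"
    "\<And>w u0. 0 < w \<Longrightarrow> w \<le> w0 \<Longrightarrow> \<bar>u0\<bar> \<le> 1 \<Longrightarrow> \<alpha> \<le> corr E u0 \<Longrightarrow>
       ((\<lambda>l. of_real ((cmod (hat {0..w} l))^2) * expo (- u0) l) has_sum of_real (corr {0..w} (- u0))) \<Lambda>"
proof -
  define a where "a m = (cmod (hat E (of_int m / 3)))^2 / 3" for m :: int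
  have a0: "a m \<ge> 0" for m by (simp add: a_def)
  have "((\<lambda>m. of_real (a m) * expo (of_int m / 3) 0) has_sum of_real (corr E 0)) UNIV"
    unfolding a_def by (intro corr_series[OF E_borel E_sub']) auto
  then have "((\<lambda>m. of_real (a m) :: complex) has_sum of_real 1) UNIV"
    by (simp add: corr_0 E_measure)
  then have a1: "(a has_sum 1) UNIV"
    unfolding has_sum_of_real_iff .
  \<comment> \<open>The mass outside \<open>F0\<close> will be multiplied by the bound 6 of
    \<open>trapez_shift_sum_le\<close>, which gives \<alpha>/4.\<close>
  obtain F0 where F0: "finite F0" "1 - \<alpha> / 24 < sum a F0"
  proof -
    have "\<forall>\<^sub>F F in finite_subsets_at_top UNIV. dist (sum a F) 1 < \<alpha> / 24"
      using a1 assms unfolding has_sum_def by (intro tendstoD) auto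
    then obtain F where "finite F" "dist (sum a F) 1 < \<alpha> / 24"
      unfolding eventually_finite_subsets_at_top by blast
    moreover from this have "1 - \<alpha> / 24 < sum a F" unfolding dist_real_def by linarith
    ultimately show ?thesis using that by blast
  qed
  define K where "K = (\<Sum>m\<in>F0. \<bar>real_of_int m\<bar>) + 1"
  have K1: "K \<ge> 1" by (simp add: K_def sum_nonneg)
  have K: "\<bar>real_of_int m\<bar> \<le> K" if "m \<in> F0" for m
    unfolding K_def using member_le_sum[OF that, of "\<lambda>m. \<bar>real_of_int m\<bar>"] F0(1) by simp
  \<comment> \<open>The value 1/4 is the range of the tent lemmas; 160 = 4 * 40 makes the other
    bound of \<open>trapez_shift_sum_le\<close> at most \<alpha>/4 for |m| <= K.\<close>
  define w0 where "w0 = min (1/4) (\<alpha> / (160 * K))"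
  show ?thesis
  proof (rule that)
    show "w0 > 0" using assms K1 by (simp add: w0_def)
    fix w u0 :: real assume w: "0 < w" "w \<le> w0" and u0: "\<bar>u0\<bar> \<le> 1" and \<alpha>: "\<alpha> \<le> corr E u0"
    have w': "0 < w" "w \<le> 1/4" using w by (auto simp: w0_def)
    have wK: "40 * K * w \<le> \<alpha> / 4" using w(2) K1 by (auto simp: w0_def field_simps)
    define T where "T n = infsum (\<lambda>l. of_real ((cmod (hat {0..w} (l - of_int n / 3)))^2) * expo (- u0) l) \<Lambda>" for n :: int
    define h where "h = corr {0..w} (- u0)"
    define \<psi> where "\<psi> n = T n - of_real h * expo (- u0) (of_int n / 3)" for n :: int
    have conv: "((\<lambda>m. of_real (a m) * expo (of_int m / 3) u0 * \<psi> (n + m)) has_sum 0) UNIV" for n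
      unfolding a_def \<psi>_def T_def h_def by (rule defect_convolution[OF w' u0])
    have repr: "((\<lambda>k. of_real (trapez w k) * \<psi> (n + k)) has_sum \<psi> n) UNIV" for n
      unfolding \<psi>_def T_def h_def by (rule defect_reproducing[OF w' u0])
    obtain B where B: "\<And>x F. finite F \<Longrightarrow> F \<subseteq> \<Lambda> \<Longrightarrow> (\<Sum>l\<in>F. (cmod (hat {0..w} (l - x)))^2) \<le> B"
      using interval_sum_bounded[of w] w' by (metis less_imp_le)
    have "cmod (T n) \<le> B" for n
      unfolding T_def
      by (rule has_sum_norm_le[OF weighted_sum_exists]) (use w' B in \<open>auto simp: norm_mult norm_power\<close>)
    then have bdd: "cmod (\<psi> n) \<le> B + \<bar>h\<bar>" for n
      unfolding \<psi>_def using norm_triangle_ineq4[of "T n" "of_real h * expo (- u0) (of_int n / 3)"]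
      by (smt (verit) norm_mult norm_of_real norm_expo mult_cancel_left2 real_norm_def mult.right_neutral)
    define M where "M = (SUP n. cmod (\<psi> n))"
    have M: "cmod (\<psi> n) \<le> M" for n
      unfolding M_def by (rule cSUP_upper) (auto intro!: bdd_aboveI2 bdd)
    have M0: "M \<ge> 0" using M[of 0] norm_ge_zero[of "\<psi> 0"] by linarith
    \<comment> \<open>Writing both values through \<open>repr\<close> with a common summation index
      moves the difference from \<open>\<psi>\<close> onto the kernel
      \<open>trapez w\<close>.\<close>
    have shift: "cmod (\<psi> n - \<psi> (n + m)) \<le> M * min 6 (40 * \<bar>of_int m\<bar> * w)" for n m
    proof -
      have "((\<lambda>k. of_real (trapez w (k - m)) * \<psi> (n + k)) has_sum \<psi> (n + m)) UNIV"
      proof -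
        have "bij_betw (\<lambda>k :: int. k - m) UNIV UNIV" by (rule bij_betwI[of _ _ _ "\<lambda>k. k + m"]) auto
        from has_sum_reindex_bij_betw[OF this, of "\<lambda>k. of_real (trapez w k) * \<psi> ((n + m) + k)" "\<psi> (n + m)"] repr[of "n + m"]
        show ?thesis by (simp add: algebra_simps)
      qed
      from has_sum_add[OF repr[of n] has_sum_uminusI[OF this]]
      have "((\<lambda>k. of_real (trapez w k - trapez w (k - m)) * \<psi> (n + k)) has_sum (\<psi> n - \<psi> (n + m))) UNIV"
        by (simp add: left_diff_distrib)
      then show ?thesis
      proof (rule has_sum_norm_le)
        fix F :: "int set" assume "finite F"
        have "(\<Sum>k\<in>F. cmod (of_real (trapez w k - trapez w (k - m)) * \<psi> (n + k))) \<le> (\<Sum>k\<in>F. \<bar>trapez w (k - m) - trapez w k\<bar> * M)"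
          by (intro sum_mono) (auto simp: norm_mult abs_minus_commute simp flip: of_real_diff intro!: mult_left_mono M)
        also have "\<dots> = M * (\<Sum>k\<in>F. \<bar>trapez w (k - m) - trapez w k\<bar>)"
          by (simp add: sum_distrib_left mult.commute)
        also have "\<dots> \<le> M * min 6 (40 * \<bar>of_int m\<bar> * w)"
          by (intro mult_left_mono trapez_shift_sum_le w' \<open>finite F\<close> M0)
        finally show "(\<Sum>k\<in>F. cmod (of_real (trapez w k - trapez w (k - m)) * \<psi> (n + k))) \<le> M * min 6 (40 * \<bar>of_int m\<bar> * w)" .
      qed
    qed
    \<comment> \<open>The modulated coefficients of \<open>corr E\<close> sum to
      \<open>corr E u0\<close> and annihilate \<open>\<psi>\<close>, so
      \<open>corr E u0 * \<psi> n\<close> is a weighted sum of the differences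
      \<open>\<psi> n - \<psi> (n + m)\<close>. Indices in \<open>F0\<close> contribute at most M *
      \<alpha>/4 by slow variation, the others as much by their small mass.\<close>
    have half: "cmod (\<psi> n) \<le> M / 2" for n
    proof -
      have "((\<lambda>m. of_real (a m) * expo (of_int m / 3) u0) has_sum of_real (corr E u0)) UNIV"
        unfolding a_def using u0 by (intro corr_series[OF E_borel E_sub']) auto
      from has_sum_add[OF has_sum_cmult_left[OF this, of "\<psi> n"] has_sum_uminusI[OF conv[of n]]]
      have "((\<lambda>m. of_real (a m) * expo (of_int m / 3) u0 * (\<psi> n - \<psi> (n + m))) has_sum of_real (corr E u0) * \<psi> n) UNIV"
        by (simp add: right_diff_distrib)
      then have "cmod (of_real (corr E u0) * \<psi> n) \<le> M * (\<alpha> / 2)"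
      proof (rule has_sum_norm_le)
        fix F :: "int set" assume F: "finite F"
        have tail: "sum a (F - F0) \<le> \<alpha> / 24"
        proof -
          have "sum a (F - F0) + sum a F0 = sum a (F \<union> F0)"
            using F F0(1) by (subst sum.union_disjoint[symmetric]) (auto intro!: sum.cong)
          also have "\<dots> \<le> 1" using has_sum_mono2[OF has_sum_finite[of "F \<union> F0"] a1] F F0(1) a0 by simp
          finally show ?thesis using F0(2) by simp
        qed
        have "cmod (of_real (a m) * expo (of_int m / 3) u0 * (\<psi> n - \<psi> (n + m))) \<le> M * (a m * min 6 (40 * \<bar>of_int m\<bar> * w))" for m
          using mult_left_mono[OF shift[of n m] a0[of m]] a0[of m] by (simp add: norm_mult mult_ac)
        then have "(\<Sum>m\<in>F. cmod (of_real (a m) * expo (of_int m / 3) u0 * (\<psi> n - \<psi> (n + m))))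
          \<le> M * (\<Sum>m\<in>F. a m * min 6 (40 * \<bar>of_int m\<bar> * w))"
          unfolding sum_distrib_left by (intro sum_mono)
        also have "(\<Sum>m\<in>F. a m * min 6 (40 * \<bar>of_int m\<bar> * w))
          = (\<Sum>m\<in>F \<inter> F0. a m * min 6 (40 * \<bar>of_int m\<bar> * w)) + (\<Sum>m\<in>F - F0. a m * min 6 (40 * \<bar>of_int m\<bar> * w))"
          using F by (subst sum.union_disjoint[symmetric]) (auto intro!: sum.cong)
        also have "\<dots> \<le> (\<Sum>m\<in>F \<inter> F0. a m * (\<alpha> / 4)) + (\<Sum>m\<in>F - F0. a m * 6)"
        proof (intro add_mono sum_mono mult_left_mono a0)
          fix m assume "m \<in> F \<inter> F0"
          then have "40 * \<bar>of_int m\<bar> * w \<le> 40 * K * w" using K[of m] w by (intro mult_right_mono mult_left_mono) auto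
          then show "min 6 (40 * \<bar>of_int m\<bar> * w) \<le> \<alpha> / 4" using wK by simp
        qed simp
        also have "\<dots> = sum a (F \<inter> F0) * (\<alpha> / 4) + sum a (F - F0) * 6"
          by (simp only: sum_distrib_right)
        also have "\<dots> \<le> 1 * (\<alpha> / 4) + \<alpha> / 24 * 6"
          using has_sum_mono2[OF has_sum_finite[of "F \<inter> F0"] a1] F a0 assms tail
          by (intro add_mono mult_right_mono) auto
        also have "\<dots> = \<alpha> / 2" by simp
        finally show "(\<Sum>m\<in>F. cmod (of_real (a m) * expo (of_int m / 3) u0 * (\<psi> n - \<psi> (n + m)))) \<le> M * (\<alpha> / 2)"
          using M0 by (simp add: mult_left_mono)
      qed
      moreover have "\<alpha> * cmod (\<psi> n) \<le> cmod (of_real (corr E u0) * \<psi> n)"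
        using \<alpha> assms by (simp add: norm_mult mult_right_mono)
      ultimately have "\<alpha> * cmod (\<psi> n) \<le> \<alpha> * (M / 2)" by (simp add: mult.commute[of M])
      then show ?thesis using assms by simp
    qed
    have "M \<le> M / 2" by (subst (1) M_def) (rule cSUP_least, simp, rule half)
    then have "cmod (\<psi> 0) \<le> 0" using M[of 0] by linarith
    then have "\<psi> 0 = 0" by simp
    then have "T 0 = of_real h" by (simp add: \<psi>_def)
    with weighted_sum_exists[of w 0 u0] w' show "((\<lambda>l. of_real ((cmod (hat {0..w} l))^2) * expo (- u0) l) has_sum of_real (corr {0..w} (- u0))) \<Lambda>"
      by (simp add: T_def h_def)
  qed
qed

end

section \<open>From narrow tents to intervals, and the integrality of the spectrum\<close>

lemma has_sum_sum:
  fixes f :: "'i \<Rightarrow> 'a \<Rightarrow> 'b::topological_comm_monoid_add"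
  assumes "\<And>i. i \<in> I \<Longrightarrow> (f i has_sum s i) A"
  shows "((\<lambda>x. \<Sum>i\<in>I. f i x) has_sum (\<Sum>i\<in>I. s i)) A"
  using assms by (induction I rule: infinite_finite_induct) (auto intro: has_sum_add)

text \<open>The long interval consists of N translates of the short one, each contributing a
  modulation. Taking the squared modulus turns the differences (i - j) w into the centres of narrow
  tents.\<close>

lemma hat_Icc_multiple:
  assumes "0 \<le> w"
  shows "hat {0..real N * w} \<xi> = (\<Sum>i<N. expo (- (real i * w)) \<xi>) * hat {0..w} \<xi>"
proof (cases "\<xi> = 0")
  case True
  have "hat {0..v} 0 = of_real v" if "0 \<le> v" for v
    using that by (simp add: hat_def set_integral_const scaleR_conv_of_real emeasure_lborel_Icc_eq)
  with True assms show ?thesis by simp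
next
  case False
  define c where "c = 2 * of_real pi * \<i> * of_real \<xi>"
  have e: "expo (- (real i * w)) \<xi> = expo (- \<xi>) (real i * w)" for i by (simp add: expo_cis mult_ac)
  have "(\<Sum>i<N. expo (- \<xi>) (real i * w)) * (1 - expo (- \<xi>) w) = 1 - expo (- \<xi>) (real N * w)"
  proof (induction N)
    case (Suc N)
    have "expo (- \<xi>) (real (Suc N) * w) = expo (- \<xi>) (real N * w) * expo (- \<xi>) w"
      by (simp add: expo_add_right[symmetric] algebra_simps)
    then show ?case
      unfolding sum.lessThan_Suc distrib_right[of "sum _ _"] Suc.IH by (simp add: algebra_simps)
  qed simp
  then show ?thesis unfolding e using False assms by (simp add: hat_Icc)
qed

context spectral_tile
begin

text \<open>Since r < 1, \<open>corr E\<close> has a positive minimum on the compact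
  \<open>{-r..r}\<close>, hence one width w is admissible for all shifts up to r. The
  autocorrelation of \<open>{0..r}\<close> is a sum of N^2 translated tents; at 0 only the N
  diagonal ones survive, each with value w, and N w = r.\<close>

lemma poisson_interval:
  assumes r: "0 < r" "r < 1"
  shows "((\<lambda>l. (cmod (hat {0..r} l))^2) has_sum r) \<Lambda>"
proof -
  have "compact {-r..r}" "{-r..r} \<noteq> {}" "continuous_on {-r..r} (corr E)"
    using r by (auto intro: continuous_on_corr[OF E_borel E_sub])
  from continuous_attains_inf[OF this] obtain x where x: "x \<in> {-r..r}" "\<And>y. y \<in> {-r..r} \<Longrightarrow> corr E x \<le> corr E y" by blast
  have "corr E x > 0" using x(1) r by (intro corr_pos[OF E_borel E_sub L E_measure]) auto
  then obtain w0 where w0: "w0 > 0"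
    "\<And>w u0. 0 < w \<Longrightarrow> w \<le> w0 \<Longrightarrow> \<bar>u0\<bar> \<le> 1 \<Longrightarrow> corr E x \<le> corr E u0 \<Longrightarrow>
       ((\<lambda>l. of_real ((cmod (hat {0..w} l))^2) * expo (- u0) l) has_sum of_real (corr {0..w} (- u0))) \<Lambda>"
    using poisson_narrow by blast
  obtain N :: nat where N: "r / w0 < real N" using reals_Archimedean2 by blast
  have N0: "real N > 0" using N r w0(1) by (smt (verit) divide_pos_pos)
  define w where "w = r / real N"
  have w: "0 < w" "w \<le> w0" "real N * w = r" using N N0 r w0(1) by (auto simp: w_def field_simps)
  have hs: "((\<lambda>l. of_real ((cmod (hat {0..w} l))^2) * expo (- (real i * w - real j * w)) l)
      has_sum (if i = j then of_real w else 0)) \<Lambda>" if ij: "i < N" "j < N" for i j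
  proof -
    have "real i * w \<le> real N * w" "real j * w \<le> real N * w" "0 \<le> real i * w" "0 \<le> real j * w"
      using ij w(1) by (auto intro!: mult_right_mono)
    then have u: "\<bar>real i * w - real j * w\<bar> \<le> r" using w(3) by linarith
    have "corr {0..w} (- (real i * w - real j * w)) = (if i = j then w else 0)" (is "?c = _")
    proof (cases "i = j")
      case False
      have "1 \<le> \<bar>real i - real j\<bar>" using False by linarith
      then have "w * 1 \<le> w * \<bar>real i - real j\<bar>" using w(1) by (intro mult_left_mono) auto
      moreover have "\<bar>- (real i * w - real j * w)\<bar> = w * \<bar>real i - real j\<bar>"
        using w(1) unfolding left_diff_distrib[symmetric] abs_minus_cancel abs_mult by simp
      ultimately have "w \<le> \<bar>- (real i * w - real j * w)\<bar>" by linarith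
      then show ?thesis using False corr_eq_0[of "{0..w}" w] by simp
    qed (use w in \<open>simp add: corr_Icc\<close>)
    then have eq: "of_real ?c = (if i = j then of_real w else 0 :: complex)" by (cases "i = j") simp_all
    have "corr E x \<le> corr E (real i * w - real j * w)" using u by (intro x(2)) (auto simp: abs_le_iff)
    then have "((\<lambda>l. of_real ((cmod (hat {0..w} l))^2) * expo (- (real i * w - real j * w)) l)
      has_sum of_real ?c) \<Lambda>"
      using u r by (intro w0(2)[OF w(1,2)]) simp_all
    then show ?thesis unfolding eq .
  qed
  have "((\<lambda>l. \<Sum>i<N. \<Sum>j<N. of_real ((cmod (hat {0..w} l))^2) * expo (- (real i * w - real j * w)) l)
      has_sum (\<Sum>i<N. \<Sum>j<N. if i = j then of_real w else 0)) \<Lambda>"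
    by (intro has_sum_sum hs) auto
  moreover have "(\<Sum>i<N. \<Sum>j<N. of_real ((cmod (hat {0..w} l))^2) * expo (- (real i * w - real j * w)) l) = of_real ((cmod (hat {0..r} l))^2)" for l
  proof -
    define s where "s = (\<Sum>i<N. expo (- (real i * w)) l)"
    have cs: "cnj s = (\<Sum>j<N. expo (real j * w) l)" by (simp add: s_def expo_minus)
    have "expo (- (real i * w - real j * w)) l = expo (- (real i * w)) l * expo (real j * w) l" for i j
      by (simp add: expo_add[symmetric])
    then have "(\<Sum>i<N. \<Sum>j<N. of_real ((cmod (hat {0..w} l))^2) * expo (- (real i * w - real j * w)) l) = of_real ((cmod (hat {0..w} l))^2) * (s * cnj s)"
      unfolding cs unfolding s_def sum_product by (simp add: sum_distrib_left)
    also have "\<dots> = (s * hat {0..w} l) * cnj (s * hat {0..w} l)"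
      by (simp only: complex_norm_square complex_cnj_mult mult_ac)
    also have "\<dots> = of_real ((cmod (hat {0..r} l))^2)"
      unfolding complex_norm_square using hat_Icc_multiple[of w N l] w by (simp add: s_def)
    finally show ?thesis .
  qed
  moreover have "(\<Sum>i<N. \<Sum>j<N. if i = j then of_real w else 0) = (of_real r :: complex)"
  proof -
    have "(\<Sum>i<N. \<Sum>j<N. if i = j then of_real w else 0) = (\<Sum>i<N. of_real w :: complex)"
      by (intro sum.cong refl) simp
    also have "\<dots> = of_real (real N * w)" by simp
    finally show ?thesis unfolding w(3) .
  qed
  ultimately have "((\<lambda>l. of_real ((cmod (hat {0..r} l))^2) :: complex) has_sum of_real r) \<Lambda>" by (simp only:)
  then show ?thesis unfolding has_sum_of_real_iff .
qed

text \<open>The sum in \<open>poisson_interval\<close> contains r^2 at frequency 0, so the term at l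
  is at most r - r^2, which tends to 0 as r increases to 1.\<close>

lemma subset_Ints:
  assumes "0 \<in> \<Lambda>" shows "\<Lambda> \<subseteq> \<int>"
proof
  fix l assume l: "l \<in> \<Lambda>"
  show "l \<in> \<int>"
  proof (cases "l = 0")
    case False
    have le: "(cmod (1 - expo (- l) r))^2 \<le> (2 * pi * l)^2 * (r - r^2)" if r: "0 < r" "r < 1" for r
    proof -
      have "(\<Sum>l\<in>{0, l}. (cmod (hat {0..r} l))^2) \<le> r"
        by (rule has_sum_mono2[OF has_sum_finite poisson_interval[OF r]]) (use assms l in auto)
      moreover have "hat {0..r} 0 = of_real r"
        using r by (simp add: hat_def set_integral_const scaleR_conv_of_real emeasure_lborel_Icc_eq)
      ultimately have "(cmod (hat {0..r} l))^2 \<le> r - r^2" using False by simp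
      moreover have "(cmod (1 - expo (- l) r))^2 = (2 * pi * l)^2 * (cmod (hat {0..r} l))^2"
        using False r by (simp add: hat_Icc norm_divide norm_mult power_divide power_mult_distrib)
      ultimately show ?thesis by (simp add: mult_left_mono)
    qed
    have "((\<lambda>r. (cmod (1 - expo (- l) r))^2) \<longlongrightarrow> (cmod (1 - expo (- l) 1))^2) (at_left 1)"
    proof -
      have "continuous_on UNIV (\<lambda>r. (cmod (1 - expo (- l) r))^2)" by (intro continuous_intros)
      then show ?thesis by (simp add: continuous_on_def filterlim_at_split)
    qed
    moreover have "((\<lambda>r. (2 * pi * l)^2 * (r - r^2)) \<longlongrightarrow> (2 * pi * l)^2 * (1 - 1^2)) (at_left 1)"
      by (intro tendsto_intros)
    moreover have "\<forall>\<^sub>F r in at_left 1. (cmod (1 - expo (- l) r))^2 \<le> (2 * pi * l)^2 * (r - r^2)"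
      using eventually_at_left_real[of 0 1] by (rule eventually_mono) (auto intro: le)
    ultimately have "(cmod (1 - expo (- l) 1))^2 \<le> (2 * pi * l)^2 * (1 - 1^2)"
      by (intro tendsto_le[of "at_left (1::real)"]) auto
    then have "expo (- l) 1 = 1" by simp
    then have "expo l 1 = 1" by (simp add: expo_minus)
    then have "exp (\<i> * of_real (2 * pi * l)) = 1" by (simp add: expo_cis cis_conv_exp)
    then obtain n :: int where "2 * pi * l = of_int (2 * n) * pi"
      unfolding exp_eq_1 by auto
    then have "l = of_int n" by simp
    then show ?thesis by simp
  qed simp
qed

end

text \<open>For \<open>r \<le> 1/2\<close>, Bessel's inequality over all of \<open>\<int>\<close> leaves no room for an integer frequency
  missing from \<open>\<Lambda>\<close>.\<close>

lemma (in spectral_tile) eq_Ints: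
  assumes "0 \<in> \<Lambda>" shows "\<Lambda> = \<int>"
proof
  show "\<Lambda> \<subseteq> \<int>" by (rule subset_Ints[OF assms])
  show "\<int> \<subseteq> \<Lambda>"
  proof
    fix x :: real assume "x \<in> \<int>"
    then obtain n :: int where n: "x = of_int n" by (rule Ints_cases)
    show "x \<in> \<Lambda>"
    proof (rule ccontr)
      assume x: "x \<notin> \<Lambda>"
      then have n0: "n \<noteq> 0" using assms n by auto
      \<comment> \<open>Half a wavelength: \<open>expo (- x) r\<close> is -1, so the transform of
        \<open>{0..r}\<close> does not vanish at x. Since |x| >= 1, also \<open>{0..3*r}\<close>
        lies in \<open>{0..3/2}\<close>, as \<open>coeff_sum_le\<close> demands.\<close>
      define r where "r = 1 / (2 * \<bar>x\<bar>)"
      have "\<bar>n\<bar> \<ge> 1" using n0 by linarith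
      then have "\<bar>x\<bar> \<ge> 1" unfolding n by linarith
      then have r: "0 < r" "r \<le> 1/2" by (auto simp: r_def field_simps)
      \<comment> \<open>Dilation by 3 turns the frequencies k/3 into integers;
        \<open>coeff_sum_le\<close> then reads 9 times the sum <= 9 r.\<close>
      have hat3: "hat {0..3*r} (of_int k / 3) = 3 * hat {0..r} (of_int k)" for k :: int
      proof (cases "k = 0")
        case True
        have "hat {0..v} 0 = of_real v" if "0 \<le> v" for v
          using that by (simp add: hat_def set_integral_const scaleR_conv_of_real emeasure_lborel_Icc_eq)
        with True r show ?thesis by simp
      next
        case False
        then show ?thesis using r by (simp add: hat_Icc expo_def)
      qed
      have le: "(\<Sum>y\<in>F. (cmod (hat {0..r} y))^2) \<le> r" if F: "finite F" "F \<subseteq> \<int>" for F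
      proof -
        obtain K where K: "finite K" "F = of_int ` K"
          using F unfolding Ints_def by (meson finite_subset_image)
        have "(\<Sum>k\<in>K. (cmod (hat {0..3*r} (of_int k / 3)))^2) \<le> 3 * measure lborel {0..3*r}"
          by (rule coeff_sum_le[of _ "3*r"]) (use r K in auto)
        also have "(\<Sum>k\<in>K. (cmod (hat {0..3*r} (of_int k / 3)))^2) = 9 * (\<Sum>y\<in>F. (cmod (hat {0..r} y))^2)"
          unfolding hat3 K(2) by (subst sum.reindex) (auto simp: inj_on_def norm_mult power_mult_distrib sum_distrib_left)
        finally show ?thesis using r by simp
      qed
      have "r \<le> r - (cmod (hat {0..r} x))^2"
      proof (rule has_sum_le_finite_sums[OF poisson_interval])
        fix F assume F: "finite F" "F \<subseteq> \<Lambda>"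
        have "(\<Sum>y\<in>insert x F. (cmod (hat {0..r} y))^2) \<le> r"
          using F subset_Ints[OF assms] n by (intro le) auto
        moreover have "x \<notin> F" using F x by auto
        ultimately show "(\<Sum>y\<in>F. (cmod (hat {0..r} y))^2) \<le> r - (cmod (hat {0..r} x))^2"
          using F(1) by simp
      qed (use r in auto)
      then have "hat {0..r} x = 0" by simp
      moreover have "x \<noteq> 0" using n n0 by simp
      ultimately have "expo (- x) r = 1" using r by (simp add: hat_Icc)
      moreover have "expo (- x) r = -1"
      proof -
        have "2 * pi * (- x) * r = - pi \<or> 2 * pi * (- x) * r = pi"
          using \<open>x \<noteq> 0\<close> by (cases "x > 0") (auto simp: r_def)
        then have "expo (- x) r = cis (- pi) \<or> expo (- x) r = cis pi" unfolding expo_cis by metis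
        then show ?thesis by (auto simp: cis_cnj[symmetric])
      qed
      ultimately show False by simp
    qed
  qed
qed

section \<open>From the definition of a spectrum to the frame identity\<close>

lemma inner_L2_expo_borel:
  assumes "E \<in> sets borel"
  shows "inner_L2 E (expo x) (expo l) = hat E (l - x)"
proof -
  note [measurable] = assms
  have "expo x y * cnj (expo l y) = expo (- (l - x)) y" for y
    using expo_diff[of x l y] by simp
  then have "inner_L2 E (expo x) (expo l) = (LINT y|lebesgue. indicator E y *\<^sub>R expo (- (l - x)) y)"
    by (simp add: inner_L2_def set_lebesgue_integral_def)
  also have "\<dots> = hat E (l - x)"
    unfolding hat_def set_lebesgue_integral_def by (rule integral_completion) measurable
  finally show ?thesis .
qed

text \<open>Total measure 1 makes the exponentials orthonormal rather than merely orthogonal, and it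
  is also the squared norm of \<open>expo x\<close>, the function being expanded.\<close>

lemma spectrum_frame:
  assumes E: "E \<in> sets borel" "E \<subseteq> {0..L}" "measure lborel E = 1" and sp: "spectrum E \<Lambda>"
  shows "((\<lambda>l. (cmod (hat E (l - x)))^2) has_sum 1) \<Lambda>"
proof -
  define M where "M = restrict_space lebesgue E"
  have EL: "E \<inter> space lebesgue \<in> sets lebesgue" using E(1) by simp
  have "emeasure lborel E < \<infinity>" using fmeasurable_Icc_subset[OF E(1,2)] by (simp add: fmeasurable_def)
  then have fin: "emeasure lebesgue E < \<infinity>" using E(1) by simp
  interpret M: finite_measure M
    by (rule finite_measureI) (use fin EL in \<open>simp add: M_def emeasure_restrict_space space_restrict_space\<close>)
  have LM: "integral\<^sup>L M g = (LINT x:E|lebesgue. g x)" for g :: "real \<Rightarrow> 'b::{banach,second_countable_topology}"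
    unfolding M_def set_lebesgue_integral_def by (rule integral_restrict_space[OF EL])
  have e_meas: "expo l \<in> borel_measurable M" for l
    unfolding M_def by (rule measurable_restrict_space1) (rule measurable_completion, simp)
  have hat0: "hat E 0 = 1"
    using E(1,3) \<open>emeasure lborel E < \<infinity>\<close> by (simp add: hat_def set_integral_const scaleR_conv_of_real)
  have inner: "(\<integral>y. expo x y * cnj (expo l y) \<partial>M) = hat E (l - x)" for x l
    unfolding LM using inner_L2_expo_borel[OF E(1), of x l] by (simp add: inner_L2_def)
  have "((\<lambda>l. (cmod (\<integral>y. expo x y * cnj (expo l y) \<partial>M))^2) has_sum (\<integral>y. (cmod (expo x y))^2 \<partial>M)) \<Lambda>"
  proof (rule M.orthonormal_complete_parseval[where B=1])
    fix l m assume lm: "l \<in> \<Lambda>" "m \<in> \<Lambda>"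
    show "(\<integral>y. expo l y * cnj (expo m y) \<partial>M) = (if l = m then 1 else 0)"
      using sp lm hat0 unfolding inner spectrum_def by (auto simp: inner_L2_expo_borel[OF E(1)])
  next
    fix g :: "real \<Rightarrow> complex"
    assume g: "g \<in> borel_measurable M" "integrable M (\<lambda>x. (cmod (g x))^2)"
      "\<And>l. l \<in> \<Lambda> \<Longrightarrow> (\<integral>y. g y * cnj (expo l y) \<partial>M) = 0"
    have "(\<lambda>x. indicator E x *\<^sub>R g x) \<in> borel_measurable lebesgue"
      using g(1) unfolding M_def borel_measurable_restrict_space_iff[OF EL] .
    moreover have "set_integrable lebesgue E (\<lambda>x. (cmod (g x))^2)"
      using g(2) unfolding M_def set_integrable_def integrable_restrict_space[OF EL] .
    ultimately have "L2_on E g" by (simp add: L2_on_def)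
    moreover have "inner_L2 E g (expo l) = 0" if "l \<in> \<Lambda>" for l
      using g(3)[OF that] unfolding LM inner_L2_def .
    ultimately have "AE x in lebesgue. x \<in> E \<longrightarrow> g x = 0" using sp unfolding spectrum_def by blast
    then show "AE x in M. g x = 0" unfolding M_def by (subst AE_restrict_space_iff[OF EL]) auto
  qed (use e_meas in auto)
  moreover have "(\<integral>y. (cmod (expo x y))^2 \<partial>M) = 1"
  proof -
    have "measure M (space M) = 1" using E by (simp add: M_def space_restrict_space measure_restrict_space)
    then show ?thesis by simp
  qed
  ultimately show ?thesis unfolding inner by simp
qed

text \<open>The Fourier analysis is carried out for Borel sets and \<open>lborel\<close>, while a
  set in the theorem is only Lebesgue measurable; this passes to a Borel subset of full
  measure.\<close>

lemma spectrum_AE_subset: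
  assumes E: "E \<in> sets lebesgue" and E': "E' \<in> sets lebesgue" "E' \<subseteq> E" "E - E' \<in> null_sets lebesgue"
    and sp: "spectrum E \<Lambda>"
  shows "spectrum E' \<Lambda>"
  unfolding spectrum_def
proof (intro conjI ballI allI impI)
  have AE': "AE x in lebesgue. x \<in> E \<longleftrightarrow> x \<in> E'"
    using AE_not_in[OF E'(3)] by eventually_elim (use E'(2) in auto)
  have expo_meas: "expo l \<in> borel_measurable lebesgue" for l by (rule measurable_completion) simp
  fix l m assume "l \<in> \<Lambda>" "m \<in> \<Lambda>" "l \<noteq> m"
  then have "inner_L2 E (expo l) (expo m) = 0" using sp by (simp add: spectrum_def)
  moreover have "inner_L2 E (expo l) (expo m) = inner_L2 E' (expo l) (expo m)"
    unfolding inner_L2_def set_lebesgue_integral_def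
  proof (rule integral_cong_AE)
    note [measurable] = expo_meas E E'(1)
    show "(\<lambda>x. indicator E x *\<^sub>R (expo l x * cnj (expo m x))) \<in> borel_measurable lebesgue"
      "(\<lambda>x. indicator E' x *\<^sub>R (expo l x * cnj (expo m x))) \<in> borel_measurable lebesgue" by measurable
    show "AE x in lebesgue. indicator E x *\<^sub>R (expo l x * cnj (expo m x)) = indicator E' x *\<^sub>R (expo l x * cnj (expo m x))"
      using AE' by eventually_elim (simp add: indicator_def)
  qed
  ultimately show "inner_L2 E' (expo l) (expo m) = 0" by simp
next
  fix f assume f: "L2_on E' f \<and> (\<forall>l\<in>\<Lambda>. inner_L2 E' f (expo l) = 0)"
  \<comment> \<open>Extension by 0 makes the integrands over \<open>E\<close> and \<open>E'\<close>
    agree at every point, so that integrability and inner products carry over directly.\<close>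
  define g where "g x = (if x \<in> E' then f x else 0)" for x
  have ind: "indicator E x *\<^sub>R h (g x) x = indicator E' x *\<^sub>R h (f x) x" if "\<And>x. h 0 x = 0"
    for h :: "complex \<Rightarrow> real \<Rightarrow> 'b::real_vector" and x
    using E'(2) that by (auto simp: g_def indicator_def)
  have "L2_on E g"
    using f ind[of "\<lambda>z x. z"] ind[of "\<lambda>z x. (cmod z)^2"] by (simp add: L2_on_def set_integrable_def)
  moreover have "inner_L2 E g (expo l) = inner_L2 E' f (expo l)" for l
    using ind[of "\<lambda>z x. z * cnj (expo l x)"] by (simp add: inner_L2_def set_lebesgue_integral_def)
  ultimately have "AE x in lebesgue. x \<in> E \<longrightarrow> g x = 0" using sp f unfolding spectrum_def by simp
  then show "AE x in lebesgue. x \<in> E' \<longrightarrow> f x = 0"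
    by eventually_elim (use E'(2) in \<open>auto simp: g_def\<close>)
qed

section \<open>Tilings\<close>

lemma discrete_set_countable:
  assumes "discrete_set T" shows "countable T"
proof -
  have "T = (\<Union>n. T \<inter> cball 0 (real n))" by (auto simp: real_arch_simple)
  moreover have "countable (T \<inter> cball 0 (real n))" for n
    using assms by (auto simp: discrete_set_def intro: countable_finite)
  ultimately show ?thesis by (metis countable_UN countableI_type)
qed

text \<open>Countability of T keeps the union of all translates of the null set E - E' null.\<close>

lemma tiling_AE_subset:
  assumes "countable T" and E: "E' \<subseteq> E" "E - E' \<in> null_sets lebesgue" and t: "tiling E T"
  shows "tiling E' T"
  unfolding tiling_def
proof (intro conjI ballI impI)
  fix s t' assume "s \<in> T" "t' \<in> T" "s \<noteq> t'"
  then have "((\<lambda>x. x + s) ` E) \<inter> ((\<lambda>x. x + t') ` E) \<in> null_sets lebesgue" using t by (simp add: tiling_def)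
  then show "((\<lambda>x. x + s) ` E') \<inter> ((\<lambda>x. x + t') ` E') \<in> null_sets lebesgue"
    by (rule null_sets_completion_subset[rotated]) (use E(1) in auto)
next
  have "((\<lambda>x. x + s) ` (E - E')) \<in> null_sets lebesgue" for s
    using E(2) negligible_translation[of "E - E'" s] by (simp add: negligible_iff_null_sets add.commute)
  then have "(\<Union>s\<in>T. (\<lambda>x. x + s) ` (E - E')) \<in> null_sets lebesgue"
    using assms(1) by (intro null_sets_UN') auto
  moreover have "(UNIV - (\<Union>t\<in>T. (\<lambda>x. x + t) ` E)) \<in> null_sets lebesgue" using t by (simp add: tiling_def)
  ultimately have "(\<Union>s\<in>T. (\<lambda>x. x + s) ` (E - E')) \<union> (UNIV - (\<Union>t\<in>T. (\<lambda>x. x + t) ` E)) \<in> null_sets lebesgue"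
    by (rule null_sets.Un)
  then show "(UNIV - (\<Union>t\<in>T. (\<lambda>x. x + t) ` E')) \<in> null_sets lebesgue"
    by (rule null_sets_completion_subset[rotated]) auto
qed

text \<open>The translates by s and t share a copy of a set of measure
  \<open>corr E (s - t)\<close>, which \<open>corr_pos\<close> shows to be positive at distances
  below 1.\<close>

lemma tiling_separated:
  assumes E: "E \<in> sets borel" "E \<subseteq> {0..L}" "L < 3/2" "measure lborel E = 1" and t: "tiling E T"
    and st: "s \<in> T" "t \<in> T" "s \<noteq> t"
  shows "1 \<le> \<bar>s - t\<bar>"
proof (rule ccontr)
  assume "\<not> 1 \<le> \<bar>s - t\<bar>"
  then have "corr E (s - t) > 0" by (intro corr_pos[OF E]) auto
  let ?A = "{y \<in> E. y + (s - t) \<in> E}"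
  have "((\<lambda>x. x + s) ` E) \<inter> ((\<lambda>x. x + t) ` E) \<in> null_sets lebesgue" using t st by (simp add: tiling_def)
  moreover have "(\<lambda>x. x + s) ` ?A \<subseteq> ((\<lambda>x. x + s) ` E) \<inter> ((\<lambda>x. x + t) ` E)"
    by (auto simp: image_iff intro!: bexI[of _ "_ + (s - t)"])
  ultimately have "(+) s ` ?A \<in> null_sets lebesgue"
    by (metis (no_types, lifting) null_sets_completion_subset add.commute image_cong)
  then have "negligible ?A"
    by (rule negligible_translation_rev[OF negligible_iff_null_sets[THEN iffD2]])
  then have "measure lebesgue ?A = 0" by (simp add: negligible_iff_measure)
  then show False using \<open>corr E (s - t) > 0\<close> corr_sets_borel[OF E(1), of "s - t"] by (simp add: corr_def)
qed

text \<open>Counting measure on both sides of a gap of a tiling: the portions of the two adjacent translates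
  that can reach the window have total measure at most \<open>|E| + |{L-1..1}| = 3 - L\<close>.\<close>

lemma window_length_le:
  fixes a b c d L :: real
  assumes E: "E \<in> sets borel" "E \<subseteq> {0..L}" "L < 3/2" "measure lborel E = 1"
    and N: "N \<in> null_sets lebesgue"
    and sub: "{a<..<b} \<subseteq> {x. x - c \<in> E \<inter> {L - 1..}} \<union> {x. x - d \<in> E \<inter> {..<1}} \<union> N"
  shows "b - a \<le> 3 - L"
proof (cases "a < b")
  case True
  let ?A = "E \<inter> {L - 1..}" and ?B = "E \<inter> {..<1}"
  have sets: "?A \<in> sets borel" "?B \<in> sets borel" using E(1) by auto
  have fAB: "?A \<in> fmeasurable lborel" "?B \<in> fmeasurable lborel"
    using E(2) by (auto intro!: fmeasurable_Icc_subset[of _ 0 L] sets)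
  have shift: "{x. x - c \<in> S} \<in> lmeasurable \<and> measure lebesgue {x. x - c \<in> S} = measure lborel S"
    if "S \<in> sets borel" "S \<subseteq> E" for S c
  proof -
    have b: "{x. x - c \<in> S} \<in> sets borel" using shift_sets_borel[OF that(1), of "- c"] by simp
    have "{x. x - c \<in> S} \<subseteq> {c..L + c}" using that(2) E(2) by force
    then have "{x. x - c \<in> S} \<in> fmeasurable lborel" by (rule fmeasurable_Icc_subset[OF b])
    then show ?thesis using b measure_lborel_shift[OF that(1), of "- c"] by (auto simp: fmeasurable_def)
  qed
  have N': "N \<in> lmeasurable" "measure lebesgue N = 0"
    using N by (auto simp: fmeasurable_def null_sets_def measure_def)
  have "b - a = measure lebesgue {a<..<b}" using True by simp
  also have "\<dots> \<le> measure lebesgue ({x. x - c \<in> ?A} \<union> {x. x - d \<in> ?B} \<union> N)"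
    using shift[OF sets(1)] shift[OF sets(2)] N' by (intro measure_mono_fmeasurable[OF sub]) auto
  also have "\<dots> \<le> measure lebesgue {x. x - c \<in> ?A} + measure lebesgue {x. x - d \<in> ?B} + measure lebesgue N"
    using shift[OF sets(1), of c] shift[OF sets(2), of d] N'
    by (intro order_trans[OF measure_Un_le] add_mono) auto
  also have "\<dots> = measure lborel ?A + measure lborel ?B"
    using shift[OF sets(1), of c] shift[OF sets(2), of d] N' by simp
  also have "\<dots> = measure lborel (?A \<union> ?B) + measure lborel (?A \<inter> ?B)"
    using measure_Un3[OF fAB] by simp
  also have "?A \<union> ?B = E" using E(3) by auto
  also have "measure lborel (?A \<inter> ?B) \<le> measure lborel {L - 1..1}"
    using sets fmeasurable_cbox[of "L - 1" 1] by (intro measure_mono_fmeasurable) auto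
  also have "measure lborel {L - 1..1} = 2 - L" using E(3) by simp
  finally show ?thesis using E(4) by simp
qed (use E(3) in simp)

text \<open>Once all integers lie in T, separation by 1 excludes any other point. So it suffices
  that T is closed under adding and subtracting 1.\<close>

lemma tiling_eq_Ints:
  assumes E: "E \<in> sets borel" "E \<subseteq> {0..L}" "L < 3/2" "measure lborel E = 1"
    and disc: "discrete_set T" and t: "tiling E T" and zero: "0 \<in> T"
  shows "T = \<int>"
proof -
  note sep = tiling_separated[OF E t]
  define N where "N = UNIV - (\<Union>t\<in>T. (\<lambda>x. x + t) ` E)"
  have N: "N \<in> null_sets lebesgue" using t by (simp add: tiling_def N_def)
  have cover: "\<exists>t\<in>T. x - t \<in> E" if "x \<notin> N" for x using that by (force simp: N_def)
  have E': "0 \<le> y \<and> y \<le> L" if "y \<in> E" for y using that E(2) by auto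
  have gap: "\<exists>\<delta>>0. \<forall>y\<in>T. \<delta> \<le> \<bar>y - x\<bar>" if "x \<notin> T" for x
  proof -
    have "finite (T \<inter> cball x 1)" using disc by (simp add: discrete_set_def)
    then have "closed (T \<inter> cball x 1)" by (rule finite_imp_closed)
    from separate_point_closed[OF this, of x] that
    obtain \<delta> where \<delta>: "\<delta> > 0" "\<And>y. y \<in> T \<inter> cball x 1 \<Longrightarrow> \<delta> \<le> dist x y" by auto
    have "min \<delta> 1 \<le> \<bar>y - x\<bar>" if "y \<in> T" for y
    proof (cases "\<bar>y - x\<bar> \<le> 1")
      case True
      then have "\<delta> \<le> dist x y" using that by (intro \<delta>(2)) (auto simp: dist_real_def)
      then show ?thesis by (simp add: dist_real_def abs_minus_commute)
    qed simp
    with \<delta>(1) show ?thesis by (intro exI[of _ "min \<delta> 1"]) simp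
  qed
  have right: "l + 1 \<in> T" if l: "l \<in> T" for l
  proof (rule ccontr)
    assume "l + 1 \<notin> T"
    then obtain \<delta> where \<delta>: "\<delta> > 0" "\<And>y. y \<in> T \<Longrightarrow> \<delta> \<le> \<bar>y - (l + 1)\<bar>" using gap by blast
    have far: "l + 1 + \<delta> \<le> y" if "y \<in> T" "l < y" for y
      using sep[OF that(1) l] \<delta>(2)[OF that(1)] that(2) by linarith
    \<comment> \<open>Two elements of T in this range would both be at least l + 1 + \<delta> and at
      distance at least 1, so one would reach l + 2 + \<delta>. If the range contains none, any
      \<open>d\<close> will do.\<close>
    obtain d where d: "\<And>y. y \<in> T \<Longrightarrow> l < y \<Longrightarrow> y < l + 2 + \<delta> \<Longrightarrow> y = d"
    proof (cases "\<exists>d\<in>T. l < d \<and> d < l + 2 + \<delta>")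
      case True
      then obtain d where dT: "d \<in> T" "l < d" "d < l + 2 + \<delta>" by blast
      have "y = d" if "y \<in> T" "l < y" "y < l + 2 + \<delta>" for y
        using sep[OF that(1) dT(1)] far[OF that(1,2)] far[OF dT(1,2)] that(3) dT(3) by linarith
      then show ?thesis using that by blast
    qed (use that in blast)
    \<comment> \<open>The window starts where the translates by elements up to l - 1 end. Its points
      exceed l by more than L - 1, and exceed any later element of T by less than 1, since such an
      element is at least l + 1 + \<delta>. The length 3 - L + \<delta> contradicts
      \<open>window_length_le\<close>.\<close>
    have "{l + L - 1<..<l + 2 + \<delta>} \<subseteq> {x. x - l \<in> E \<inter> {L - 1..}} \<union> {x. x - d \<in> E \<inter> {..<1}} \<union> N"
    proof
      fix x assume x: "x \<in> {l + L - 1<..<l + 2 + \<delta>}"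
      show "x \<in> {x. x - l \<in> E \<inter> {L - 1..}} \<union> {x. x - d \<in> E \<inter> {..<1}} \<union> N"
      proof (cases "x \<in> N")
        case False
        then obtain y where y: "y \<in> T" "x - y \<in> E" using cover by blast
        note b = E'[OF y(2)]
        consider "y = l" | "y < l" | "l < y" by linarith
        then show ?thesis
        proof cases
          case 2
          then have "y \<le> l - 1" using sep[OF y(1) l] by linarith
          then show ?thesis using b x by simp
        next
          case 3
          then have "y = d" using y(1) b x by (intro d) auto
          then show ?thesis using far[OF y(1) 3] y(2) x by auto
        qed (use y x in auto)
      qed simp
    qed
    from window_length_le[OF E N this] show False using \<delta>(1) by simp
  qed
  have left: "l - 1 \<in> T" if l: "l \<in> T" for l
  proof (rule ccontr)
    assume "l - 1 \<notin> T"
    then obtain \<delta> where \<delta>: "\<delta> > 0" "\<And>y. y \<in> T \<Longrightarrow> \<delta> \<le> \<bar>y - (l - 1)\<bar>" using gap by blast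
    have far: "y \<le> l - 1 - \<delta>" if "y \<in> T" "y < l" for y
      using sep[OF that(1) l] \<delta>(2)[OF that(1)] that(2) by linarith
    obtain d where d: "\<And>y. y \<in> T \<Longrightarrow> y < l \<Longrightarrow> l - 2 - \<delta> < y \<Longrightarrow> y = d"
    proof (cases "\<exists>d\<in>T. d < l \<and> l - 2 - \<delta> < d")
      case True
      then obtain d where dT: "d \<in> T" "d < l" "l - 2 - \<delta> < d" by blast
      have "y = d" if "y \<in> T" "y < l" "l - 2 - \<delta> < y" for y
        using sep[OF that(1) dT(1)] far[OF that(1,2)] far[OF dT(1,2)] that(3) dT(3) by linarith
      then show ?thesis using that by blast
    qed (use that in blast)
    \<comment> \<open>Mirror image: the window ends at l + 1, where later translates begin, and
      starts at l + L - 2 - \<delta>, where the translates by elements up to l - 2 - \<delta> end.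
      Its length is again 3 - L + \<delta>.\<close>
    have "{l + L - 2 - \<delta><..<l + 1} \<subseteq> {x. x - d \<in> E \<inter> {L - 1..}} \<union> {x. x - l \<in> E \<inter> {..<1}} \<union> N"
    proof
      fix x assume x: "x \<in> {l + L - 2 - \<delta><..<l + 1}"
      show "x \<in> {x. x - d \<in> E \<inter> {L - 1..}} \<union> {x. x - l \<in> E \<inter> {..<1}} \<union> N"
      proof (cases "x \<in> N")
        case False
        then obtain y where y: "y \<in> T" "x - y \<in> E" using cover by blast
        note b = E'[OF y(2)]
        consider "y = l" | "l < y" | "y < l" by linarith
        then show ?thesis
        proof cases
          case 2
          then have "l + 1 \<le> y" using sep[OF y(1) l] by linarith
          then show ?thesis using b x by simp
        next
          case 3
          then have "y = d" using y(1) b x by (intro d) auto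
          then show ?thesis using far[OF y(1) 3] y(2) x by auto
        qed (use y x in auto)
      qed simp
    qed
    from window_length_le[OF E N this] show False using \<delta>(1) by simp
  qed
  have Z: "of_int n \<in> T" for n :: int
  proof (induction n rule: int_induct[where k=0])
    case (step1 i)
    then show ?case using right[of "of_int i"] by simp
  next
    case (step2 i)
    then show ?case using left[of "of_int i"] by simp
  qed (use zero in simp)
  have "y \<in> \<int>" if "y \<in> T" for y
  proof (rule ccontr)
    assume "y \<notin> \<int>"
    then have "y \<noteq> of_int \<lfloor>y\<rfloor>" by (metis Ints_of_int)
    then show False using sep[OF that Z[of "\<lfloor>y\<rfloor>"]] by linarith
  qed
  then show ?thesis using Z by (auto elim: Ints_cases)
qed

theorem theorem1p1:
  fixes \<epsilon> :: real and E Lam :: "real set"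
  assumes "\<epsilon> > 0"
    and "E \<in> sets lebesgue" and "E \<subseteq> {0..3/2 - \<epsilon>}" and "emeasure lebesgue E = 1"
    and "discrete_set Lam" and "0 \<in> Lam"
  shows "(tiling E Lam \<longrightarrow> Lam = \<int>) \<and> (spectrum E Lam \<longrightarrow> Lam = \<int>)"
proof -
  \<comment> \<open>An F-sigma subset of full measure is Borel, and both the tiling and the spectral
    property descend to it with the same \<open>Lam\<close>.\<close>
  obtain E' N where E': "fsigma E'" "N \<in> null_sets lebesgue" "E' \<union> N = E" "disjnt E' N"
    using lebesgue_set_almost_fsigma[OF assms(2)] by blast
  have borel: "E' \<in> sets borel" using E'(1) by (auto elim!: fsigma.cases)
  have sub: "E' \<subseteq> {0..3/2 - \<epsilon>}" "E' \<subseteq> E" "E - E' \<in> null_sets lebesgue"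
    using assms(3) E' by (auto simp: disjnt_def Un_Diff Diff_triv Int_commute)
  have "emeasure lebesgue E' = 1"
    using emeasure_Un_null_set[of E' lebesgue N] E' borel assms(4) by simp
  then have one: "measure lborel E' = 1" using borel by (simp add: measure_def)
  have L: "3/2 - \<epsilon> < 3/2" using assms(1) by simp
  show ?thesis
  proof (intro conjI impI)
    assume "tiling E Lam"
    then have "tiling E' Lam"
      by (rule tiling_AE_subset[OF discrete_set_countable[OF assms(5)] sub(2,3)])
    then show "Lam = \<int>" by (rule tiling_eq_Ints[OF borel sub(1) L one assms(5) _ assms(6)])
  next
    assume "spectrum E Lam"
    then have sp: "spectrum E' Lam"
      using borel by (intro spectrum_AE_subset[OF assms(2) _ sub(2,3)]) auto
    interpret spectral_tile E' Lam "3/2 - \<epsilon>"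
      by unfold_locales (use borel sub L one spectrum_frame[OF borel sub(1) one sp] in auto)
    show "Lam = \<int>" by (rule eq_Ints[OF assms(6)])
  qed
qed

end
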